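(* Let $\mathcal M=\{A,B,C,D\}$ be a strictly passive and minimal discrete-time model, and let $$\Xi:=\sup\{\xi<1:\ \mathcal T_\xi(z)\ \text{is strictly passive}\}.$$ Then $\Xi$ is a finite (bounded) supremum and, with $\mathcal M_\Xi$ defined by the formula below, (1) $\mathcal T_\Xi(z)$ is passive; (2) the set $\{X\in\mathbb H_n:\widetilde W(X,\mathcal M_\Xi)\ge0\}$ is nonempty; (3) the set $\{X\in\mathbb H_n:\widetilde W(X,\mathcal M_\Xi)>0\}$ is empty; (4) for every $\xi<\Xi$ the set $\{X\in\mathbb H_n:\widetilde W(X,\mathcal M_\xi)>0\}$ is nonempty; (5) $\Xi=\sup_{X\in\mathbb X^{>}(\mathcal M)}\xi^*(X)$.
   Context: A discrete-time model is $\mathcal M=\{A,B,C,D\}$ with $A\in\mathbb C^{n\times n}$, $B\in\mathbb C^{n\times m}$, $C\in\mathbb C^{m\times n}$, $D\in\mathbb C^{m\times m}$, transfer function $\mathcal T(z)=C(zI_n-A)^{-1}B+D$; minimal means $(A,B)$ controllable and $(A,C)$ observable. A transfer function $\mathcal T$ with realization matrix $A$ is passive if $\mathcal T(e^{\imath\omega})^{\mathsf H}+\mathcal T(e^{\imath\omega})\ge0$ for all $\omega\in[-\pi,\pi]$ and the eigenvalues of $A$ lie in the closed unit disc with those on the unit circle semisimple; it is strictly passive if $\mathcal T(e^{\imath\omega})^{\mathsf H}+\mathcal T(e^{\imath\omega})>0$ for all $\omega$ and all eigenvalues of $A$ lie in the open unit disc. For real $\xi\neq1$, $\mathcal M_\xi=\{A_\xi,B_\xi,C_\xi,D_\xi\}=\{\tfrac{A}{1-\xi},\tfrac{B}{1-\xi},\tfrac{C}{1-\xi},\tfrac{D-\xi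 I_m}{1-\xi}\}$ and $\mathcal T_\xi(z)=C_\xi(zI_n-A_\xi)^{-1}B_\xi+D_\xi$. $\mathbb H_n$ is the set of $n\times n$ Hermitian matrices. For $X\in\mathbb H_n$ and a model $\mathcal N=\{A',B',C',D'\}$, $$W(X,\mathcal N)=\begin{bmatrix} X-A'^{\mathsf H}XA' & C'^{\mathsf H}-A'^{\mathsf H}XB'\\ C'-B'^{\mathsf H}XA' & D'^{\mathsf H}+D'-B'^{\mathsf H}XB'\end{bmatrix},\qquad \widetilde W(X,\mathcal N)=\begin{bmatrix} X & XA' & XB'\\ A'^{\mathsf H}X & X & C'^{\mathsf H}\\ B'^{\mathsf H}X & C' & D'^{\mathsf H}+D'\end{bmatrix}.$$ $\mathbb X^{>}(\mathcal M)=\{X\in\mathbb H_n: W(X,\mathcal M)\ge0,\ X>0\}$, and for $X\in\mathbb X^{>}(\mathcal M)$, $\xi^*(X)$ is the largest real $\xi$ with $\widetilde W(X,\mathcal M)\ge\xi\operatorname{diag}(X,X,2I_m)$. *)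

theory Defs
  imports "Jordan_Normal_Form.Matrix" "Jordan_Normal_Form.Char_Poly"
    "Jordan_Normal_Form.Schur_Decomposition" "Jordan_Normal_Form.Matrix_Kernel"
    "Jordan_Normal_Form.DL_Rank" "Jordan_Normal_Form.Gauss_Jordan_Elimination"
begin

type_synonym model = "complex mat \<times> complex mat \<times> complex mat \<times> complex mat"

definition model_dims :: "nat \<Rightarrow> nat \<Rightarrow> model \<Rightarrow> bool" where
  "model_dims n m M = (case M of (A, B, C, D) \<Rightarrow>
     A \<in> carrier_mat n n \<and> B \<in> carrier_mat n m \<and> C \<in> carrier_mat m n \<and> D \<in> carrier_mat m m)"

definition hermitian :: "nat \<Rightarrow> complex mat \<Rightarrow> bool" where
  "hermitian k M = (M \<in> carrier_mat k k \<and> mat_adjoint M = M)"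

definition quad_form :: "complex mat \<Rightarrow> complex vec \<Rightarrow> complex" where
  "quad_form M v = (M *\<^sub>v v) \<bullet> conjugate v"

definition psd :: "nat \<Rightarrow> complex mat \<Rightarrow> bool" where
  "psd k M = (hermitian k M \<and> (\<forall>v \<in> carrier_vec k. 0 \<le> Re (quad_form M v)))"

definition pd :: "nat \<Rightarrow> complex mat \<Rightarrow> bool" where
  "pd k M = (hermitian k M \<and> (\<forall>v \<in> carrier_vec k. v \<noteq> 0\<^sub>v k \<longrightarrow> 0 < Re (quad_form M v)))"

definition loewner_ge :: "nat \<Rightarrow> complex mat \<Rightarrow> complex mat \<Rightarrow> bool" where
  "loewner_ge k M N = psd k (M - N)"

definition transfer :: "nat \<Rightarrow> model \<Rightarrow> complex \<Rightarrow> complex mat" where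
  "transfer n M z = (case M of (A, B, C, D) \<Rightarrow>
     C * the (mat_inverse (z \<cdot>\<^sub>m 1\<^sub>m n - A)) * B + D)"

definition semisimple_eigenvalue :: "complex mat \<Rightarrow> complex \<Rightarrow> bool" where
  "semisimple_eigenvalue A l =
     (eigenvalue A l \<and> order l (char_poly A) = kernel_dim (char_matrix A l))"

text \<open>Passivity. The frequency condition is required at all \<omega> where
  e^{i\<omega>} I - A is invertible (i.e. where T is defined).\<close>
definition is_passive :: "nat \<Rightarrow> nat \<Rightarrow> model \<Rightarrow> bool" where
  "is_passive n m M = (case M of (A, B, C, D) \<Rightarrow>
     (\<forall>\<omega> \<in> {-pi..pi}. invertible_mat (cis \<omega> \<cdot>\<^sub>m 1\<^sub>m n - A) \<longrightarrow>
        psd m (mat_adjoint (transfer n M (cis \<omega>)) + transfer n M (cis \<omega>))) \<and>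
     (\<forall>l. eigenvalue A l \<longrightarrow> cmod l \<le> 1) \<and>
     (\<forall>l. eigenvalue A l \<and> cmod l = 1 \<longrightarrow> semisimple_eigenvalue A l))"

definition is_strictly_passive :: "nat \<Rightarrow> nat \<Rightarrow> model \<Rightarrow> bool" where
  "is_strictly_passive n m M = (case M of (A, B, C, D) \<Rightarrow>
     (\<forall>\<omega> \<in> {-pi..pi}.
        pd m (mat_adjoint (transfer n M (cis \<omega>)) + transfer n M (cis \<omega>))) \<and>
     (\<forall>l. eigenvalue A l \<longrightarrow> cmod l < 1))"

definition ctrb_mat :: "nat \<Rightarrow> nat \<Rightarrow> complex mat \<Rightarrow> complex mat \<Rightarrow> complex mat" where
  "ctrb_mat n m A B = mat n (n * m) (\<lambda>(i, j). (A ^\<^sub>m (j div m) * B) $$ (i, j mod m))"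

definition obsv_mat :: "nat \<Rightarrow> nat \<Rightarrow> complex mat \<Rightarrow> complex mat \<Rightarrow> complex mat" where
  "obsv_mat n m A C = mat (n * m) n (\<lambda>(i, j). (C * A ^\<^sub>m (i div m)) $$ (i mod m, j))"

definition controllable :: "nat \<Rightarrow> nat \<Rightarrow> complex mat \<Rightarrow> complex mat \<Rightarrow> bool" where
  "controllable n m A B = (vec_space.rank n (ctrb_mat n m A B) = n)"

definition observable :: "nat \<Rightarrow> nat \<Rightarrow> complex mat \<Rightarrow> complex mat \<Rightarrow> bool" where
  "observable n m A C = (vec_space.rank (n * m) (obsv_mat n m A C) = n)"

definition minimal :: "nat \<Rightarrow> nat \<Rightarrow> model \<Rightarrow> bool" where
  "minimal n m M = (case M of (A, B, C, D) \<Rightarrow> controllable n m A B \<and> observable n m A C)"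

definition shift_model :: "nat \<Rightarrow> model \<Rightarrow> real \<Rightarrow> model" where
  "shift_model m M \<xi> = (case M of (A, B, C, D) \<Rightarrow>
     (complex_of_real (1 / (1 - \<xi>)) \<cdot>\<^sub>m A,
      complex_of_real (1 / (1 - \<xi>)) \<cdot>\<^sub>m B,
      complex_of_real (1 / (1 - \<xi>)) \<cdot>\<^sub>m C,
      complex_of_real (1 / (1 - \<xi>)) \<cdot>\<^sub>m (D - complex_of_real \<xi> \<cdot>\<^sub>m 1\<^sub>m m)))"

definition W_mat :: "complex mat \<Rightarrow> model \<Rightarrow> complex mat" where
  "W_mat X N = (case N of (A, B, C, D) \<Rightarrow>
     four_block_mat (X - mat_adjoint A * X * A) (mat_adjoint C - mat_adjoint A * X * B)
                    (C - mat_adjoint B * X * A) (mat_adjoint D + D - mat_adjoint B * X * B))"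

definition Wt_mat :: "nat \<Rightarrow> nat \<Rightarrow> complex mat \<Rightarrow> model \<Rightarrow> complex mat" where
  "Wt_mat n m X N = (case N of (A, B, C, D) \<Rightarrow>
     four_block_mat
       (four_block_mat X (X * A) (mat_adjoint A * X) X)
       (four_block_mat (X * B) (0\<^sub>m n 0) (mat_adjoint C) (0\<^sub>m n 0))
       (four_block_mat (mat_adjoint B * X) C (0\<^sub>m 0 n) (0\<^sub>m 0 n))
       (mat_adjoint D + D))"

definition diag3 :: "nat \<Rightarrow> nat \<Rightarrow> complex mat \<Rightarrow> complex mat" where
  "diag3 n m X = four_block_mat (four_block_mat X (0\<^sub>m n n) (0\<^sub>m n n) X)
                    (0\<^sub>m (n + n) m) (0\<^sub>m m (n + n)) (2 \<cdot>\<^sub>m 1\<^sub>m m)"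

definition Xpos :: "nat \<Rightarrow> nat \<Rightarrow> model \<Rightarrow> complex mat set" where
  "Xpos n m M = {X. hermitian n X \<and> psd (n + m) (W_mat X M) \<and> pd n X}"

definition xi_star :: "nat \<Rightarrow> nat \<Rightarrow> model \<Rightarrow> complex mat \<Rightarrow> real" where
  "xi_star n m M X = (GREATEST \<xi>::real.
     loewner_ge (n + n + m) (Wt_mat n m X M) (complex_of_real \<xi> \<cdot>\<^sub>m diag3 n m X))"

end

theory Submission
  imports Defs "HOL-Library.Function_Algebras" "Jordan_Normal_Form.Spectral_Radius"
    "Jordan_Normal_Form.Jordan_Normal_Form_Uniqueness"
begin

text \<open>
  Evaluating the matrix \<open>W\<close> with a tilde at \<open>(y, x, u)\<close> turns all matrix inequalities into the scalar
  dissipation inequality \<open>V (A x + B u) \<le> V x + 2 Re \<langle>C x + D u, u\<rangle>\<close> for \<open>V x = \<langle>X x, x\<rangle>\<close>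
  (put \<open>y = - (A x + B u)\<close>).

  The core is the strict KYP lemma. On a periodic trajectory a finite Fourier transform decomposes
  the supplied energy into single frequencies, so strict passivity makes it nonnegative, even
  after subtracting a small multiple of \<open>\<bar>x\<bar>\<^sup>2 + \<bar>u\<bar>\<^sup>2\<close>. By controllability every path from \<open>0\<close> to
  \<open>x\<close> can be closed to a cycle at bounded cost. Hence the required supply, the infimum
  of the energy over all paths from \<open>0\<close> to \<open>x\<close>, is finite. It satisfies the parallelogram law, so by
  Jordan and von Neumann it is a Hermitian form, and this form solves the strict inequality.

  Solutions \<open>X\<close> for \<open>0 \<le> \<xi>\<close> are bounded through the energy of a fixed path from \<open>0\<close> to \<open>x\<close>, so they
  subconverge as \<open>\<xi>\<close> tends to the supremum. Observability makes the limit positive definite, and it also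
  keeps the supremum below \<open>1\<close>. A strict solution at the supremum would survive a small increase of \<open>\<xi>\<close>.
\<close>

section \<open>Hermitian forms and the Jordan--von Neumann theorem\<close>

text \<open>All claims are read off one function, \<open>gap X \<xi> y x u\<close>, affine in \<xi>.
  It is the form of the extended matrix of the given model minus \<xi> times the form of
  \<open>diag3\<close>, and divided by 1 - \<xi> it is the form of the extended matrix of the
  shifted model. So strict passivity of the shifted model, its matrix inequality and the value of
  \<open>xi_star\<close> all become statements about the sign of \<open>gap\<close>. The given model
  is strictly passive, which puts 0 among the admissible shifts, so only shifts \<xi> \<ge> 0 matter
  near the supremum. The required supply is built by adding, scaling and Fourier transforming
  trajectories. This part works with functions from \<open>nat\<close> to \<open>complex\<close>,
  which form an additive group, so that sums over time need no dimension bookkeeping; vectors of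
  fixed dimension return when the strict KYP lemma is stated.\<close>

definition fscale :: "complex \<Rightarrow> (nat \<Rightarrow> complex) \<Rightarrow> nat \<Rightarrow> complex" (infixr "*\<^sub>f" 75)
  where "c *\<^sub>f x = (\<lambda>i. c * x i)"

definition hform :: "nat \<Rightarrow> (nat \<Rightarrow> nat \<Rightarrow> complex) \<Rightarrow> (nat \<Rightarrow> complex) \<Rightarrow> real"
  where "hform d H x = Re (\<Sum>a<d. \<Sum>b<d. H a b * x b * cnj (x a))"

lemma fscale_apply [simp]: "(c *\<^sub>f x) i = c * x i"
  by (simp add: fscale_def)

lemma fscale_simps [simp]:
  "c *\<^sub>f 0 = 0" "0 *\<^sub>f x = 0" "1 *\<^sub>f x = x" "c *\<^sub>f (d *\<^sub>f x) = (c * d) *\<^sub>f x"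
  by (auto simp: fun_eq_iff)

lemma fscale_add: "c *\<^sub>f (x + y) = c *\<^sub>f x + c *\<^sub>f y"
  by (auto simp: fun_eq_iff algebra_simps)

lemma fscale_add_left: "(c + d) *\<^sub>f x = c *\<^sub>f x + d *\<^sub>f x"
  by (auto simp: fun_eq_iff algebra_simps)

lemma fscale_minus: "(- 1) *\<^sub>f x = - x"
  by (auto simp: fun_eq_iff)

lemma fun_sum_apply: "(\<Sum>k\<in>A. g k) i = (\<Sum>k\<in>A. g k i)" for g :: "'b \<Rightarrow> nat \<Rightarrow> complex"
  by (induction A rule: infinite_finite_induct) auto

lemma fscale_sum: "c *\<^sub>f (\<Sum>k\<in>A. g k) = (\<Sum>k\<in>A. c *\<^sub>f g k)"
  by (rule ext) (simp add: fun_sum_apply sum_distrib_left)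

lemma hform_parallelogram: "hform d H (x + y) + hform d H (x - y) = 2 * hform d H x + 2 * hform d H y"
proof -
  have "(\<Sum>a<d. \<Sum>b<d. H a b * (x + y) b * cnj ((x + y) a)) + (\<Sum>a<d. \<Sum>b<d. H a b * (x - y) b * cnj ((x - y) a))
     = 2 * (\<Sum>a<d. \<Sum>b<d. H a b * x b * cnj (x a)) + 2 * (\<Sum>a<d. \<Sum>b<d. H a b * y b * cnj (y a))"
    unfolding sum.distrib[symmetric] sum_distrib_left
    by (intro sum.cong refl) (simp add: algebra_simps)
  from arg_cong[OF this, of Re] show ?thesis unfolding hform_def by simp
qed

lemma hform_scale: "hform d H (c *\<^sub>f x) = (cmod c)\<^sup>2 * hform d H x"
proof -
  have "(\<Sum>a<d. \<Sum>b<d. H a b * (c *\<^sub>f x) b * cnj ((c *\<^sub>f x) a))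
      = complex_of_real ((cmod c)\<^sup>2) * (\<Sum>a<d. \<Sum>b<d. H a b * x b * cnj (x a))"
    unfolding sum_distrib_left complex_norm_square
    by (intro sum.cong refl) (simp add: algebra_simps)
  from arg_cong[OF this, of Re] show ?thesis unfolding hform_def by simp
qed

lemma hform_zero [simp]: "hform d H 0 = 0"
  by (simp add: hform_def)

text \<open>One bound for a whole segment. \<open>jordan_von_neumann\<close> asks for this in place
  of continuity, and the required supply inherits it from the cost of fixed paths.\<close>

lemma hform_segment_bounded:
  "\<exists>c. \<forall>t\<in>{0..1::real}. hform d H (complex_of_real t *\<^sub>f x + y) \<le> c"
proof (intro exI ballI)
  fix t :: real assume t: "t \<in> {0..1}"
  have le: "cmod ((complex_of_real t *\<^sub>f x + y) a) \<le> cmod (x a) + cmod (y a)" for a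
  proof -
    have "cmod ((complex_of_real t *\<^sub>f x + y) a) \<le> t * cmod (x a) + cmod (y a)"
      using t by (auto intro!: order.trans[OF norm_triangle_ineq] simp: norm_mult)
    also have "\<dots> \<le> cmod (x a) + cmod (y a)"
      using t by (simp add: mult_left_le_one_le)
    finally show ?thesis .
  qed
  have "hform d H (complex_of_real t *\<^sub>f x + y)
      \<le> cmod (\<Sum>a<d. \<Sum>b<d. H a b * (complex_of_real t *\<^sub>f x + y) b * cnj ((complex_of_real t *\<^sub>f x + y) a))"
    unfolding hform_def by (rule complex_Re_le_cmod)
  also have "\<dots> \<le> (\<Sum>a<d. \<Sum>b<d. cmod (H a b) * (cmod (x b) + cmod (y b)) * (cmod (x a) + cmod (y a)))"
  proof (rule sum_norm_le, rule sum_norm_le)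
    fix a b
    show "cmod (H a b * (complex_of_real t *\<^sub>f x + y) b * cnj ((complex_of_real t *\<^sub>f x + y) a))
      \<le> cmod (H a b) * (cmod (x b) + cmod (y b)) * (cmod (x a) + cmod (y a))"
      unfolding norm_mult complex_mod_cnj
      by (intro mult_mono le) auto
  qed
  finally show "hform d H (complex_of_real t *\<^sub>f x + y)
    \<le> (\<Sum>a<d. \<Sum>b<d. cmod (H a b) * (cmod (x b) + cmod (y b)) * (cmod (x a) + cmod (y a)))" .
qed

section \<open>Orthogonality of roots of unity and Parseval's identity\<close>

lemma roots_of_unity_orthogonal:
  fixes N k l :: nat
  assumes "k < N" "l < N"
  defines "\<zeta> \<equiv> cis (2 * pi / real N)"
  shows "(\<Sum>j<N. \<zeta> ^ (j * k) * cnj (\<zeta> ^ (j * l))) = (if k = l then of_nat N else 0)"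
proof -
  have N: "N > 0" using assms by auto
  \<comment> \<open>The summand is \<open>q ^ j\<close> for an \<open>N\<close>-th root of unity
    \<open>q\<close>, which is 1 exactly when \<open>k = l\<close>; otherwise the geometric sum
    vanishes.\<close>
  define q where "q = \<zeta> ^ k * cnj (\<zeta> ^ l)"
  have un: "cmod (\<zeta> ^ i) = 1" for i by (simp add: \<zeta>_def norm_power)
  have cn: "\<zeta> ^ i * cnj (\<zeta> ^ i) = 1" for i
    using complex_norm_square[of "\<zeta> ^ i"] un[of i] by (simp del: complex_cnj_power)
  have pw: "\<zeta> ^ N = 1" using N by (simp add: \<zeta>_def DeMoivre)
  have term_eq: "\<zeta> ^ (j * k) * cnj (\<zeta> ^ (j * l)) = q ^ j" for j
    by (simp add: q_def power_mult_distrib power_mult[symmetric] mult.commute)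
  show ?thesis
  proof (cases "k = l")
    case True
    then have "q = 1" using cn by (simp add: q_def del: complex_cnj_power)
    then show ?thesis unfolding term_eq using True by simp
  next
    case False
    have "q \<noteq> 1"
    proof
      assume "q = 1"
      then have "\<zeta> ^ l = \<zeta> ^ l * (\<zeta> ^ k * cnj (\<zeta> ^ l))" by (simp add: q_def)
      also have "\<dots> = \<zeta> ^ k" using cn[of l] by (simp add: mult.assoc mult.commute mult.left_commute)
      finally have "\<zeta> ^ l = \<zeta> ^ k" .
      then have eq: "cis (2 * pi * real l / real N) = cis (2 * pi * real k / real N)"
        by (simp add: \<zeta>_def DeMoivre mult.commute mult.left_commute)
      have "inj_on (\<lambda>k. cis (2 * pi * real k / real N)) {..<N}"
        using bij_betw_roots_unity[OF N] by (rule bij_betw_imp_inj_on)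
      from inj_onD[OF this eq] show False using assms False by auto
    qed
    moreover have "q ^ N = 1"
    proof -
      have "q ^ N = (\<zeta> ^ N) ^ k * cnj ((\<zeta> ^ N) ^ l)"
        by (simp add: q_def power_mult_distrib power_mult[symmetric] mult.commute)
      then show ?thesis by (simp add: pw)
    qed
    ultimately show ?thesis unfolding term_eq using False by (simp add: geometric_sum)
  qed
qed

text \<open>Expanding both factors gives a double sum over times \<open>k\<close>, \<open>l\<close>;
  summing over the frequency \<open>j\<close>, orthogonality keeps only \<open>k = l\<close>. An
  indefinite supply form is thus handled like a norm.\<close>

lemma hform_parseval:
  fixes N :: nat
  defines "\<zeta> \<equiv> cis (2 * pi / real N)"
  shows "(\<Sum>j<N. hform d H (\<Sum>k<N. \<zeta> ^ (j * k) *\<^sub>f w k)) = real N * (\<Sum>k<N. hform d H (w k))"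
proof -
  let ?Z = "\<lambda>j k. \<zeta> ^ (j * k)"
  have "(\<Sum>j<N. \<Sum>a<d. \<Sum>b<d. H a b * (\<Sum>k<N. ?Z j k *\<^sub>f w k) b * cnj ((\<Sum>k<N. ?Z j k *\<^sub>f w k) a))
     = (\<Sum>j<N. \<Sum>a<d. \<Sum>b<d. \<Sum>k<N. \<Sum>l<N. H a b * w k b * cnj (w l a) * (?Z j k * cnj (?Z j l)))"
    by (intro sum.cong refl)
       (simp add: fun_sum_apply sum_product sum_distrib_left mult.assoc mult.commute mult.left_commute)
  \<comment> \<open>The sum over \<open>j\<close> is carried inwards past the other four sums, one
    exchange at a time.\<close>
  also have "\<dots> = (\<Sum>a<d. \<Sum>b<d. \<Sum>k<N. \<Sum>l<N. \<Sum>j<N. H a b * w k b * cnj (w l a) * (?Z j k * cnj (?Z j l)))"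
    by (rule trans[OF sum.swap sum.cong[OF refl trans[OF sum.swap sum.cong[OF refl
          trans[OF sum.swap sum.cong[OF refl sum.swap]]]]]])
  also have "\<dots> = (\<Sum>a<d. \<Sum>b<d. \<Sum>k<N. \<Sum>l<N. H a b * w k b * cnj (w l a) * (if k = l then of_nat N else 0))"
    unfolding sum_distrib_left[symmetric]
    by (intro sum.cong refl arg_cong2[where f = "(*)"])
       (use roots_of_unity_orthogonal[of _ N] in \<open>simp add: \<zeta>_def\<close>)
  also have "\<dots> = (\<Sum>a<d. \<Sum>b<d. \<Sum>k<N. of_nat N * (H a b * w k b * cnj (w k a)))"
    by (intro sum.cong refl) (simp add: if_distrib sum.delta cong: if_cong)
  also have "\<dots> = (\<Sum>k<N. of_nat N * (\<Sum>a<d. \<Sum>b<d. H a b * w k b * cnj (w k a)))"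
    unfolding sum_distrib_left
    by (rule trans[OF sum.cong[OF refl sum.swap] sum.swap])
  finally show ?thesis
    unfolding hform_def sum_distrib_left Re_sum[symmetric]
    by (simp flip: of_nat_mult Re_sum sum_distrib_left)
qed


text \<open>An additive function vanishing at 1 has period 1, so the bound on the unit interval
  holds everywhere. Integer multiples of a positive value would exceed it, and \<open>t\<close> and
  \<open>- t\<close> together leave only 0.\<close>

lemma periodic_additive_zero:
  fixes g :: "real \<Rightarrow> real"
  assumes add: "\<And>s t. g (s + t) = g s + g t" and one: "g 1 = 0"
    and bd: "\<And>t. 0 \<le> t \<Longrightarrow> t \<le> 1 \<Longrightarrow> g t \<le> c"
  shows "g t = 0"
proof -
  have z: "g 0 = 0" using add[of 0 0] by simp
  have mn: "g (- t) = - g t" for t using add[of t "- t"] z by simp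
  have nat: "g (real k * t) = real k * g t" for k t
    by (induction k) (simp_all add: z add distrib_right)
  have int: "g (of_int i) = 0" for i
  proof (cases "0 \<le> i")
    case True
    then show ?thesis using nat[of "nat i" 1] one by simp
  next
    case False
    then show ?thesis using nat[of "nat (- i)" 1] one mn[of "of_int i"] by simp
  qed
  have ub: "g t \<le> c" for t
  proof -
    have "g t = g (t - of_int \<lfloor>t\<rfloor>) + g (of_int \<lfloor>t\<rfloor>)" by (subst add[symmetric]) simp
    also have "\<dots> \<le> c" using bd[of "t - of_int \<lfloor>t\<rfloor>"] int by (simp; linarith)
    finally show ?thesis .
  qed
  have np: "g t \<le> 0" for t
  proof (rule ccontr)
    assume "\<not> g t \<le> 0"
    then obtain k :: nat where "c < real k * g t" using reals_Archimedean3[of "g t"] by auto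
    then show False using ub[of "real k * t"] nat[of k t] by simp
  qed
  show ?thesis using np[of t] np[of "- t"] mn[of t] by simp
qed

section \<open>Finitely supported functions as coordinate vectors\<close>

definition supp :: "nat \<Rightarrow> (nat \<Rightarrow> complex) set"
  where "supp n = {x. \<forall>i\<ge>n. x i = 0}"

definition basis_fun :: "nat \<Rightarrow> nat \<Rightarrow> complex" where "basis_fun i = (\<lambda>j. if j = i then 1 else 0)"

lemma supp_closed [simp, intro]:
  "0 \<in> supp n"
  "x \<in> supp n \<Longrightarrow> y \<in> supp n \<Longrightarrow> x + y \<in> supp n"
  "x \<in> supp n \<Longrightarrow> y \<in> supp n \<Longrightarrow> x - y \<in> supp n"
  "x \<in> supp n \<Longrightarrow> c *\<^sub>f x \<in> supp n"
  "i < n \<Longrightarrow> basis_fun i \<in> supp n"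
  by (auto simp: supp_def basis_fun_def)

lemma supp_sum [intro]: "(\<And>k. k \<in> A \<Longrightarrow> g k \<in> supp n) \<Longrightarrow> (\<Sum>k\<in>A. g k) \<in> supp n"
  by (induction A rule: infinite_finite_induct) auto

lemma supp_basis_expansion:
  assumes "x \<in> supp n"
  shows "x = (\<Sum>i<n. x i *\<^sub>f basis_fun i)"
proof (rule ext)
  fix j
  have "(\<Sum>i<n. x i *\<^sub>f basis_fun i) j = (\<Sum>i<n. if i = j then x i else 0)"
    unfolding fun_sum_apply by (intro sum.cong refl) (auto simp: basis_fun_def)
  also have "\<dots> = x j" using assms by (auto simp: supp_def)
  finally show "x j = (\<Sum>i<n. x i *\<^sub>f basis_fun i) j" by simp
qed

text \<open>Polarization gives a form \<open>b\<close> that is additive in each argument. Real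
  homogeneity, usually drawn from continuity, comes here from the upper bound on segments;
  homogeneity under complex scalars then makes \<open>b\<close> the real part of a sesquilinear
  form, whose values on basis vectors are the matrix.\<close>

proposition jordan_von_neumann:
  fixes V :: "(nat \<Rightarrow> complex) \<Rightarrow> real"
  assumes par: "\<And>x y. x \<in> supp n \<Longrightarrow> y \<in> supp n \<Longrightarrow> V (x + y) + V (x - y) = 2 * V x + 2 * V y"
    and hom: "\<And>c x. x \<in> supp n \<Longrightarrow> V (c *\<^sub>f x) = (cmod c)\<^sup>2 * V x"
    and ub: "\<And>x y. x \<in> supp n \<Longrightarrow> y \<in> supp n \<Longrightarrow>
       \<exists>c. \<forall>t\<in>{0..1::real}. V (complex_of_real t *\<^sub>f x + y) \<le> c"
  shows "\<exists>X. (\<forall>i j. X j i = cnj (X i j)) \<and> (\<forall>x\<in>supp n. V x = hform n X x)"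
proof -
  define b where "b x y = (V (x + y) - V x - V y) / 2" for x y
  have V0: "V 0 = 0" using hom[of 0 0] by simp
  have Vneg: "V (- x) = V x" if "x \<in> supp n" for x
    using hom[OF that, of "- 1"] by (simp add: fscale_minus)
  have sym: "b x y = b y x" for x y by (simp add: b_def add.commute)
  have addl: "b (x + x') y = b x y + b x' y" if "x \<in> supp n" "x' \<in> supp n" "y \<in> supp n" for x x' y
  proof -
    \<comment> \<open>The four parallelogram identities involve \<open>V (x + y - x')\<close>,
      \<open>V (x + x' - y)\<close> and \<open>V (y - x')\<close>; eliminating these three expresses
      \<open>V\<close> at the triple sum by its values at pair sums.\<close>
    have 1: "V (x + x' + y) + V (x + y - x') = 2 * V (x + y) + 2 * V x'"
      using par[of "x + y" x'] that by (simp add: algebra_simps)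
    have 2: "V (x + y - x') + V (x + x' - y) = 2 * V x + 2 * V (y - x')"
      using par[of x "y - x'"] that by (simp add: algebra_simps)
    have 3: "V (x + x' + y) + V (x + x' - y) = 2 * V (x + x') + 2 * V y"
      using par[of "x + x'" y] that by (simp add: algebra_simps)
    have 4: "V (x' + y) + V (y - x') = 2 * V x' + 2 * V y"
      using par[of y x'] that by (simp add: algebra_simps)
    have "V (x + x' + y) = V (x + x') + V (x + y) + V (x' + y) - V x - V x' - V y"
      using 1 2 3 4 by linarith
    then show ?thesis by (simp add: b_def field_simps)
  qed
  have bsc: "b (c *\<^sub>f x) (c *\<^sub>f y) = (cmod c)\<^sup>2 * b x y" if "x \<in> supp n" "y \<in> supp n" for c x y
    using that by (simp add: b_def hom fscale_add[symmetric] field_simps)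
  have real_hom: "b (complex_of_real t *\<^sub>f x) y = t * b x y" if x: "x \<in> supp n" and y: "y \<in> supp n" for t x y
  proof -
    obtain c where c: "\<And>t. t \<in> {0..1} \<Longrightarrow> V (complex_of_real t *\<^sub>f x + y) \<le> c"
      using ub[OF x y] by blast
    \<comment> \<open>\<open>g\<close> is the defect of real homogeneity: additive in
      \<open>t\<close>, zero at \<open>t = 1\<close>, and bounded above on the unit interval since
      \<open>V\<close> is bounded above on the segment.\<close>
    define g where "g t = b (complex_of_real t *\<^sub>f x) y - t * b x y" for t
    have "g t = 0"
    proof (rule periodic_additive_zero[of g "\<bar>c\<bar> + \<bar>V x\<bar> + \<bar>V y\<bar> + \<bar>b x y\<bar>"])
      show "g (s + t) = g s + g t" for s t
        using x y by (simp add: g_def fscale_add_left addl algebra_simps)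
      show "g 1 = 0" by (simp add: g_def)
      show "g t \<le> \<bar>c\<bar> + \<bar>V x\<bar> + \<bar>V y\<bar> + \<bar>b x y\<bar>" if "0 \<le> t" "t \<le> 1" for t
      proof -
        have t2: "t\<^sup>2 \<le> 1" using that by (simp add: power_le_one)
        have a: "- (t\<^sup>2 * V x) \<le> \<bar>V x\<bar>"
          using t2 by (intro order.trans[OF abs_ge_minus_self]) (simp add: abs_mult mult_left_le_one_le)
        have d: "- (t * b x y) \<le> \<bar>b x y\<bar>"
          using that by (intro order.trans[OF abs_ge_minus_self]) (simp add: abs_mult mult_left_le_one_le)
        have "2 * b (complex_of_real t *\<^sub>f x) y = V (complex_of_real t *\<^sub>f x + y) - t\<^sup>2 * V x - V y"
          using hom[OF x, of "complex_of_real t"] by (simp add: b_def)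
        also have "\<dots> \<le> \<bar>c\<bar> + \<bar>V x\<bar> + \<bar>V y\<bar>"
          using c[of t] that a abs_ge_self[of c] abs_ge_minus_self[of "V y"] by simp
        finally have "2 * b (complex_of_real t *\<^sub>f x) y \<le> \<bar>c\<bar> + \<bar>V x\<bar> + \<bar>V y\<bar>" .
        then show ?thesis
          using d abs_ge_zero[of c] abs_ge_zero[of "V x"] abs_ge_zero[of "V y"] unfolding g_def by argo
      qed
    qed
    then show ?thesis by (simp add: g_def)
  qed
  \<comment> \<open>A form that is linear in the first and conjugate linear in the second argument
    is determined by its real part \<open>b\<close>: its imaginary part at \<open>(x, y)\<close> is
    its real part at \<open>(x, \<i> y)\<close>.\<close>
  define S where "S x y = Complex (b x y) (b x (\<i> *\<^sub>f y))" for x y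
  have bi: "b (\<i> *\<^sub>f x) y = - b x (\<i> *\<^sub>f y)" if "x \<in> supp n" "y \<in> supp n" for x y
  proof -
    have "b (\<i> *\<^sub>f x) y = b (\<i> *\<^sub>f \<i> *\<^sub>f x) (\<i> *\<^sub>f y)" using bsc[of "\<i> *\<^sub>f x" y \<i>] that by simp
    also have "\<dots> = - b x (\<i> *\<^sub>f y)"
      using real_hom[of x "\<i> *\<^sub>f y" "- 1"] that by simp
    finally show ?thesis .
  qed
  have left: "b (c *\<^sub>f x) y = Re (c * S x y)" if "x \<in> supp n" "y \<in> supp n" for c x y
  proof -
    have "c *\<^sub>f x = complex_of_real (Re c) *\<^sub>f x + complex_of_real (Im c) *\<^sub>f \<i> *\<^sub>f x"
      by (subst complex_eq[of c]) (simp add: fscale_add_left mult.commute)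
    then have "b (c *\<^sub>f x) y = Re c * b x y + Im c * b (\<i> *\<^sub>f x) y"
      using that by (simp add: addl real_hom del: fscale_simps)
    then show ?thesis using that by (simp add: bi S_def)
  qed
  have both: "b (c *\<^sub>f x) (d *\<^sub>f y) = Re (c * S x y * cnj d)" if "x \<in> supp n" "y \<in> supp n" for c d x y
  proof (cases "d = 0")
    case True
    then show ?thesis by (simp add: b_def V0)
  next
    case False
    \<comment> \<open>Pulling the common scalar \<open>d\<close> out of both arguments reduces
      conjugate linearity in the second one to linearity in the first.\<close>
    have "b (c *\<^sub>f x) (d *\<^sub>f y) = b (d *\<^sub>f (c / d) *\<^sub>f x) (d *\<^sub>f y)" using False by simp
    also have "\<dots> = (cmod d)\<^sup>2 * b ((c / d) *\<^sub>f x) y" using that by (subst bsc) auto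
    also have "\<dots> = (cmod d)\<^sup>2 * Re (c / d * S x y)" using that by (simp only: left)
    also have "\<dots> = Re (complex_of_real ((cmod d)\<^sup>2) * (c / d * S x y))"
      by (simp only: times_complex.simps Re_complex_of_real Im_complex_of_real)
    also have "complex_of_real ((cmod d)\<^sup>2) * (c / d * S x y) = c * S x y * cnj d"
      unfolding complex_norm_square using False by simp
    finally show ?thesis .
  qed
  have suml: "b (\<Sum>i\<in>A. g i) y = (\<Sum>i\<in>A. b (g i) y)" if "\<And>i. i \<in> A \<Longrightarrow> g i \<in> supp n" "y \<in> supp n" "finite A" for A g y
    using that(3,1,2)
    by (induction A rule: finite_induct) (auto simp: b_def V0 addl[unfolded b_def] supp_sum)
  define X where "X i j = S (basis_fun j) (basis_fun i)" for i j
  \<comment> \<open>Cutting off to zero makes the symmetry hold for all index pairs, since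
    \<open>bi\<close> is available only for basis vectors in \<open>supp n\<close>.\<close>
  define Y where "Y i j = (if i < n \<and> j < n then X i j else 0)" for i j
  have "Y j i = cnj (Y i j)" for i j
    using bi[of "basis_fun i" "basis_fun j"] sym[of "basis_fun i" "basis_fun j"] sym[of "\<i> *\<^sub>f basis_fun i" "basis_fun j"]
    by (auto simp: Y_def X_def S_def complex_eq_iff)
  moreover have "V x = hform n Y x" if x: "x \<in> supp n" for x
  proof -
    have "2 *\<^sub>f x = x + x" by (simp add: fun_eq_iff)
    then have "V x = b x x" using hom[OF x, of 2] by (simp add: b_def)
    also have "\<dots> = b (\<Sum>i<n. x i *\<^sub>f basis_fun i) x" using supp_basis_expansion[OF x] by simp
    also have "\<dots> = (\<Sum>i<n. b (x i *\<^sub>f basis_fun i) x)" using x by (subst suml) auto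
    also have "\<dots> = (\<Sum>i<n. \<Sum>j<n. b (x i *\<^sub>f basis_fun i) (x j *\<^sub>f basis_fun j))"
    proof (rule sum.cong[OF refl])
      fix i assume i: "i \<in> {..<n}"
      have "b (x i *\<^sub>f basis_fun i) x = b (\<Sum>j<n. x j *\<^sub>f basis_fun j) (x i *\<^sub>f basis_fun i)"
        using supp_basis_expansion[OF x] by (simp add: sym)
      also have "\<dots> = (\<Sum>j<n. b (x j *\<^sub>f basis_fun j) (x i *\<^sub>f basis_fun i))" using i by (subst suml) auto
      finally show "b (x i *\<^sub>f basis_fun i) x = (\<Sum>j<n. b (x i *\<^sub>f basis_fun i) (x j *\<^sub>f basis_fun j))" by (simp add: sym)
    qed
    also have "\<dots> = (\<Sum>i<n. \<Sum>j<n. Re (X j i * x i * cnj (x j)))"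
      by (intro sum.cong refl) (auto simp: both X_def mult.commute mult.left_commute)
    also have "\<dots> = (\<Sum>j<n. \<Sum>i<n. Re (X j i * x i * cnj (x j)))" by (rule sum.swap)
    also have "\<dots> = hform n Y x" unfolding hform_def Re_sum
      by (intro sum.cong refl) (auto simp: Y_def)
    finally show ?thesis .
  qed
  ultimately show ?thesis by blast
qed

section \<open>The required supply\<close>

lemma additive_sum_fscale:
  assumes add: "\<And>x y. h (x + y) = h x + h y" and sc: "\<And>c x. h (c *\<^sub>f x) = c *\<^sub>f h x"
  shows "h (\<Sum>k\<in>A. c k *\<^sub>f w k) = (\<Sum>k\<in>A. c k *\<^sub>f h (w k))"
proof -
  have "h 0 = 0" using sc[of 0 0] by simp
  then show ?thesis by (induction A rule: infinite_finite_induct) (simp_all add: add sc)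
qed

text \<open>An element \<open>w\<close> stands for a pair of a state \<open>p w\<close> and an input;
  \<open>f w\<close> is the successor state and \<open>hform d H w\<close> the supplied energy.
  Trajectories run backwards in time: \<open>w 0\<close> is the last pair.\<close>

locale dissipative_system =
  fixes n d :: nat and p f :: "(nat \<Rightarrow> complex) \<Rightarrow> nat \<Rightarrow> complex" and H :: "nat \<Rightarrow> nat \<Rightarrow> complex" and K :: nat
  assumes p_add: "p (x + y) = p x + p y" and p_scale: "p (c *\<^sub>f x) = c *\<^sub>f p x"
    and f_add: "f (x + y) = f x + f y" and f_scale: "f (c *\<^sub>f x) = c *\<^sub>f f x"
    and p_supp: "p x \<in> supp n" and f_supp: "f x \<in> supp n"
    and p_surj: "x \<in> supp n \<Longrightarrow> \<exists>w. p w = x"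
    and freq: "cmod z = 1 \<Longrightarrow> f w = z *\<^sub>f p w \<Longrightarrow> 0 \<le> hform d H w"
    and reach: "x \<in> supp n \<Longrightarrow> \<exists>w. (\<forall>k. p (w k) = f (w (Suc k))) \<and> (\<forall>k\<ge>K. w k = 0) \<and> f (w 0) = x"
begin

abbreviation "s \<equiv> hform d H"

text \<open>An infinite sequence that vanishes from \<open>N\<close> on: paths of different lengths
  can be added termwise, and \<open>N\<close> can be enlarged without changing the cost.\<close>

definition path :: "nat \<Rightarrow> (nat \<Rightarrow> nat \<Rightarrow> complex) \<Rightarrow> bool"
  where "path N w \<longleftrightarrow> (\<forall>k. p (w k) = f (w (Suc k))) \<and> (\<forall>k\<ge>N. w k = 0)"

definition cost :: "nat \<Rightarrow> (nat \<Rightarrow> nat \<Rightarrow> complex) \<Rightarrow> real"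
  where "cost N w = (\<Sum>k<N. s (w k))"

text \<open>The infimum is meaningful because \<open>reach\<close> makes the set nonempty and
  \<open>path_cost_bounded_below\<close> bounds it from below.\<close>

definition req_supply :: "(nat \<Rightarrow> complex) \<Rightarrow> real"
  where "req_supply x = Inf {cost N w | N w. path N w \<and> f (w 0) = x}"

lemma p_zero [simp]: "p 0 = 0" and f_zero [simp]: "f 0 = 0"
  using p_scale[of 0 0] f_scale[of 0 0] by simp_all

lemma p_diff: "p (x - y) = p x - p y" and f_diff: "f (x - y) = f x - f y"
  using p_add[of x "(- 1) *\<^sub>f y"] f_add[of x "(- 1) *\<^sub>f y"] by (simp_all add: p_scale f_scale) (simp_all add: fscale_minus)

text \<open>A shift of time by one step multiplies the Fourier transform of a periodic trajectory by
  a phase. So each transformed pair satisfies the hypothesis of \<open>freq\<close>, and every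
  frequency contributes a nonnegative amount to Parseval's identity, although single summands
  \<open>s (w k)\<close> may be negative.\<close>

lemma cycle_cost_nonneg:
  assumes "N > 0" and per: "w N = w 0" and step: "\<And>k. k < N \<Longrightarrow> p (w k) = f (w (Suc k))"
  shows "0 \<le> (\<Sum>k<N. s (w k))"
proof -
  define \<zeta> where "\<zeta> = cis (2 * pi / real N)"
  have pw: "\<zeta> ^ N = 1" using assms(1) by (simp add: \<zeta>_def DeMoivre)
  have un: "cmod (\<zeta> ^ i) = 1" for i by (simp add: \<zeta>_def norm_power)
  have "0 \<le> s (\<Sum>k<N. \<zeta> ^ (j * k) *\<^sub>f w k)" (is "0 \<le> s ?w") for j
  proof (rule freq[OF un])
    \<comment> \<open>\<open>g\<close> has period \<open>N\<close>, so its sum over one period is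
      unchanged by the index shift that turns \<open>f (w (Suc k))\<close> into
      \<open>p (w k)\<close>.\<close>
    define g where "g k = \<zeta> ^ (j * k) *\<^sub>f f (w k)" for k
    have gN: "g N = g 0"
      by (simp add: g_def per power_mult mult.commute[of j] pw)
    have "f ?w = (\<Sum>k<N. g k)"
      unfolding g_def by (rule additive_sum_fscale) (rule f_add f_scale)+
    also have "\<dots> = (\<Sum>k<N. g (Suc k))"
      using sum.lessThan_Suc_shift[of g N] gN by (simp add: add.commute)
    also have "\<dots> = (\<Sum>k<N. \<zeta> ^ j *\<^sub>f \<zeta> ^ (j * k) *\<^sub>f p (w k))"
      by (intro sum.cong refl) (simp add: g_def step power_add)
    also have "\<dots> = \<zeta> ^ j *\<^sub>f p ?w"
      unfolding fscale_sum[symmetric] additive_sum_fscale[of p, OF p_add p_scale] ..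
    finally show "f ?w = \<zeta> ^ j *\<^sub>f p ?w" .
  qed
  then have "0 \<le> (\<Sum>j<N. s (\<Sum>k<N. \<zeta> ^ (j * k) *\<^sub>f w k))" by (intro sum_nonneg) auto
  also have "\<dots> = real N * (\<Sum>k<N. s (w k))" unfolding \<zeta>_def by (rule hform_parseval)
  finally show ?thesis using assms(1) by (simp add: zero_le_mult_iff)
qed

lemma path_mono: "path N w \<Longrightarrow> N \<le> N' \<Longrightarrow> path N' w"
  by (auto simp: path_def)

lemma cost_mono:
  assumes "path N w" "N \<le> N'"
  shows "cost N' w = cost N w"
  unfolding cost_def using assms by (intro sum.mono_neutral_right) (auto simp: path_def)

lemma path_add: "path N w \<Longrightarrow> path N w' \<Longrightarrow> path N (\<lambda>k. w k + w' k)"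
  and path_diff: "path N w \<Longrightarrow> path N w' \<Longrightarrow> path N (\<lambda>k. w k - w' k)"
  and path_scale: "path N w \<Longrightarrow> path N (\<lambda>k. c *\<^sub>f w k)"
  by (auto simp: path_def p_add f_add p_diff f_diff p_scale f_scale)

lemma path_to_zero_cost:
  assumes "path N w" "f (w 0) = 0"
  shows "0 \<le> cost N w"
proof -
  \<comment> \<open>\<open>w N\<close> is the zero pair, so it may follow the final state 0 of the
    path; repeating \<open>w 0\<close> at \<open>Suc N\<close> closes the loop.\<close>
  let ?w = "w(Suc N := w 0)"
  have "0 \<le> (\<Sum>k<Suc N. s (?w k))"
  proof (rule cycle_cost_nonneg)
    fix k assume "k < Suc N"
    then show "p (?w k) = f (?w (Suc k))"
      using assms by (cases "k = N") (auto simp: path_def)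
  qed auto
  also have "(\<Sum>k<Suc N. s (?w k)) = cost (Suc N) w" unfolding cost_def by (intro sum.cong) auto
  also have "\<dots> = cost N w" using assms by (intro cost_mono) auto
  finally show ?thesis .
qed

lemma reach_path: "x \<in> supp n \<Longrightarrow> \<exists>w. path K w \<and> f (w 0) = x"
  using reach unfolding path_def by blast

text \<open>All paths to \<open>x\<close> are prolonged by one and the same continuation from
  \<open>x\<close> to 0, chosen before the path. The closed trajectory has nonnegative cost, so
  minus the cost of the continuation is a common lower bound.\<close>

lemma path_cost_bounded_below:
  assumes x: "x \<in> supp n"
  shows "\<exists>c. \<forall>N w. path N w \<longrightarrow> f (w 0) = x \<longrightarrow> c \<le> cost N w"
proof -
  define L where "L = Suc K"
  define e where "e x = (SOME w. p w = x)" for x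
  have e: "p (e x) = x" if "x \<in> supp n" for x
    unfolding e_def using p_surj[OF that] by (rule someI_ex)
  \<comment> \<open>\<open>q\<close> runs forward from \<open>x\<close> with arbitrary inputs.
    Superposing a path \<open>r\<close> from 0 to the negative of its end state steers the sum to
    0.\<close>
  define q where "q k = e (((\<lambda>y. f (e y)) ^^ k) x)" for k
  have it: "((\<lambda>y. f (e y)) ^^ k) x \<in> supp n" for k
    using x f_supp by (cases k) auto
  have q0: "p (q 0) = x" using e[OF x] by (simp add: q_def)
  have qS: "p (q (Suc k)) = f (q k)" for k
    using e[OF it[of "Suc k"]] by (simp add: q_def)
  have "- f (q K) \<in> supp n" using f_scale[of "- 1"] f_supp[of "(-1) *\<^sub>f q K"] by (simp add: fscale_minus)
  from reach_path[OF this] obtain r where r: "path K r" "f (r 0) = - f (q K)" by blast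
  show ?thesis
  proof (intro exI allI impI)
    fix N w assume w: "path N w" "f (w 0) = x"
    \<comment> \<open>Indices count backwards, hence \<open>q (K - k)\<close>. There are
      \<open>L = Suc K\<close> new pairs because \<open>q\<close> uses the indices 0 to
      \<open>K\<close>; at index \<open>K\<close>, where the continuation starts from
      \<open>x\<close>, \<open>r\<close> is already zero.\<close>
    define w' where "w' k = (if k < L then q (K - k) + r k else w (k - L))" for k
    have rK: "r k = 0" if "k \<ge> K" for k using r that by (auto simp: path_def)
    have "path (L + N) w'" unfolding path_def
    proof (intro conjI allI impI)
      fix k
      consider "k < K" | "k = K" | "k > K" by linarith
      then show "p (w' k) = f (w' (Suc k))"
      proof cases
        case 1
        then have "p (q (K - k)) = f (q (K - Suc k))" using qS[of "K - Suc k"] by (simp add: Suc_diff_Suc)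
        then show ?thesis using 1 r by (simp add: w'_def L_def p_add f_add path_def)
      next
        case 2
        then show ?thesis using w q0 rK[of k] by (simp add: w'_def L_def p_add)
      next
        case 3
        then show ?thesis using w by (simp add: w'_def L_def path_def Suc_diff_Suc)
      qed
    next
      fix k assume "L + N \<le> k"
      then show "w' k = 0" using w by (simp add: w'_def path_def)
    qed
    moreover have "f (w' 0) = 0" using r by (simp add: w'_def L_def f_add)
    ultimately have "0 \<le> cost (L + N) w'" by (rule path_to_zero_cost)
    also have "cost (L + N) w' = (\<Sum>k<L. s (q (K - k) + r k)) + cost N w"
    proof -
      have "cost (L + N) w' = (\<Sum>k<L. s (w' k)) + (\<Sum>k<N. s (w' (L + k)))"
        unfolding cost_def by (induction N) (simp_all add: add.assoc)
      then show ?thesis by (simp add: w'_def cost_def)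
    qed
    finally show "- (\<Sum>k<L. s (q (K - k) + r k)) \<le> cost N w" by simp
  qed
qed

lemma req_supply_le:
  assumes "path N w"
  shows "req_supply (f (w 0)) \<le> cost N w"
proof -
  obtain c where "\<forall>N w'. path N w' \<longrightarrow> f (w' 0) = f (w 0) \<longrightarrow> c \<le> cost N w'"
    using path_cost_bounded_below[OF f_supp] by blast
  then have "bdd_below {cost N w' | N w'. path N w' \<and> f (w' 0) = f (w 0)}"
    by (intro bdd_belowI[of _ c]) auto
  then show ?thesis unfolding req_supply_def using assms by (intro cInf_lower) auto
qed

lemma req_supply_ge:
  assumes "x \<in> supp n" "\<And>N w. path N w \<Longrightarrow> f (w 0) = x \<Longrightarrow> c \<le> cost N w"
  shows "c \<le> req_supply x"
  unfolding req_supply_def using assms reach_path[of x] by (intro cInf_greatest) blast+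

text \<open>Reaching \<open>p w\<close> and then applying \<open>w\<close> is one way to reach
  \<open>f w\<close>. Since time runs backwards, the new pair goes to index 0.\<close>

lemma req_supply_step: "req_supply (f w) \<le> req_supply (p w) + s w"
proof -
  have "req_supply (f w) - s w \<le> req_supply (p w)"
  proof (rule req_supply_ge[OF p_supp])
    fix N v assume v: "path N v" "f (v 0) = p w"
    let ?v = "case_nat w v"
    have "path (Suc N) ?v" using v by (auto simp: path_def split: nat.split)
    from req_supply_le[OF this] have "req_supply (f w) \<le> cost (Suc N) ?v" by simp
    also have "\<dots> = s w + cost N v" unfolding cost_def by (subst sum.lessThan_Suc_shift) simp
    finally show "req_supply (f w) - s w \<le> cost N v" by simp
  qed
  then show ?thesis by simp
qed

lemma req_supply_scale_le:
  assumes "x \<in> supp n" "c \<noteq> 0"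
  shows "req_supply (c *\<^sub>f x) \<le> (cmod c)\<^sup>2 * req_supply x"
proof -
  have "req_supply (c *\<^sub>f x) / (cmod c)\<^sup>2 \<le> req_supply x"
  proof (rule req_supply_ge[OF assms(1)])
    fix N w assume w: "path N w" "f (w 0) = x"
    have "req_supply (c *\<^sub>f x) \<le> cost N (\<lambda>k. c *\<^sub>f w k)"
      using req_supply_le[OF path_scale[OF w(1), of c]] w by (simp add: f_scale)
    also have "\<dots> = (cmod c)\<^sup>2 * cost N w" by (simp add: cost_def hform_scale sum_distrib_left)
    finally show "req_supply (c *\<^sub>f x) / (cmod c)\<^sup>2 \<le> cost N w"
      using assms(2) by (simp add: divide_le_eq mult.commute)
  qed
  then show ?thesis using assms(2) by (simp add: divide_le_eq mult.commute)
qed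

lemma req_supply_zero: "req_supply 0 = 0"
proof (rule antisym)
  have "path 0 (\<lambda>_. 0)" by (simp add: path_def)
  from req_supply_le[OF this] show "req_supply 0 \<le> 0" by (simp add: cost_def)
  show "0 \<le> req_supply 0" by (rule req_supply_ge) (auto intro: path_to_zero_cost)
qed

lemma req_supply_scale:
  assumes "x \<in> supp n"
  shows "req_supply (c *\<^sub>f x) = (cmod c)\<^sup>2 * req_supply x"
proof (cases "c = 0")
  case True
  then show ?thesis by (simp add: req_supply_zero)
next
  case False
  have "req_supply (inverse c *\<^sub>f c *\<^sub>f x) \<le> (cmod (inverse c))\<^sup>2 * req_supply (c *\<^sub>f x)"
    using assms False by (intro req_supply_scale_le) auto
  then have "(cmod c)\<^sup>2 * req_supply x \<le> req_supply (c *\<^sub>f x)"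
    using False by (simp add: norm_divide power_divide field_simps)
  then show ?thesis using req_supply_scale_le[OF assms False] by simp
qed

text \<open>The sum and the difference of paths to \<open>x\<close> and \<open>y\<close> reach
  \<open>x + y\<close> and \<open>x - y\<close>, and their costs obey the parallelogram identity of
  \<open>s\<close>.\<close>

lemma req_supply_parallelogram_le:
  assumes "x \<in> supp n" "y \<in> supp n"
  shows "req_supply (x + y) + req_supply (x - y) \<le> 2 * req_supply x + 2 * req_supply y"
proof -
  let ?l = "req_supply (x + y) + req_supply (x - y)"
  have main: "?l \<le> 2 * cost N w + 2 * cost N' w'"
    if w: "path N w" "f (w 0) = x" and w': "path N' w'" "f (w' 0) = y" for N w N' w'
  proof -
    define M where "M = max N N'"
    have p: "path M w" "path M w'" using path_mono w w' by (auto simp: M_def)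
    have "?l \<le> cost M (\<lambda>k. w k + w' k) + cost M (\<lambda>k. w k - w' k)"
      using req_supply_le[OF path_add[OF p]] req_supply_le[OF path_diff[OF p]] w w'
      by (simp add: f_add f_diff)
    also have "\<dots> = 2 * cost M w + 2 * cost M w'"
      unfolding cost_def sum.distrib[symmetric] hform_parallelogram by (simp add: sum.distrib sum_distrib_left)
    also have "\<dots> = 2 * cost N w + 2 * cost N' w'"
      using cost_mono[OF w(1), of M] cost_mono[OF w'(1), of M] by (simp add: M_def)
    finally show ?thesis .
  qed
  \<comment> \<open>The infimum is taken over one path at a time: over those to \<open>x\<close>
    with the path to \<open>y\<close> fixed, and over those to \<open>y\<close> afterwards.\<close>
  have "(?l - 2 * cost N' w') / 2 \<le> req_supply x" if "path N' w'" "f (w' 0) = y" for N' w'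
    using main[OF _ _ that] by (intro req_supply_ge assms) (simp add: field_simps)
  then have "(?l - 2 * req_supply x) / 2 \<le> req_supply y"
    by (intro req_supply_ge assms) (simp add: field_simps)
  then show ?thesis by (simp add: field_simps)
qed

text \<open>The reverse inequality is the same inequality for the pair \<open>x + y\<close>,
  \<open>x - y\<close>, combined with homogeneity for the scalar 2.\<close>

lemma req_supply_parallelogram:
  assumes "x \<in> supp n" "y \<in> supp n"
  shows "req_supply (x + y) + req_supply (x - y) = 2 * req_supply x + 2 * req_supply y"
proof (rule antisym[OF req_supply_parallelogram_le[OF assms]])
  have two: "(x + y) + (x - y) = 2 *\<^sub>f x" "(x + y) - (x - y) = 2 *\<^sub>f y" by (auto simp: fun_eq_iff)
  show "2 * req_supply x + 2 * req_supply y \<le> req_supply (x + y) + req_supply (x - y)"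
    using req_supply_parallelogram_le[of "x + y" "x - y"] assms
    unfolding two by (simp add: req_supply_scale)
qed

text \<open>Two fixed paths are superposed with weight \<open>t\<close>; the cost of the result is
  bounded above for \<open>t\<close> in the unit interval and dominates the required supply.\<close>

lemma req_supply_segment:
  assumes "x \<in> supp n" "y \<in> supp n"
  shows "\<exists>c. \<forall>t\<in>{0..1::real}. req_supply (complex_of_real t *\<^sub>f x + y) \<le> c"
proof -
  obtain w w' where w: "path K w" "f (w 0) = x" and w': "path K w'" "f (w' 0) = y"
    using reach_path assms by metis
  obtain c where c: "\<And>k t. t \<in> {0..1} \<Longrightarrow> s (complex_of_real t *\<^sub>f w k + w' k) \<le> c k"
    using choice[of "\<lambda>k c. \<forall>t\<in>{0..1::real}. s (complex_of_real t *\<^sub>f w k + w' k) \<le> c"]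
      hform_segment_bounded[of d H] by blast
  show ?thesis
  proof (intro exI ballI)
    fix t :: real assume t: "t \<in> {0..1}"
    have "req_supply (complex_of_real t *\<^sub>f x + y) \<le> cost K (\<lambda>k. complex_of_real t *\<^sub>f w k + w' k)"
      using req_supply_le[OF path_add[OF path_scale[OF w(1)] w'(1)], of "complex_of_real t"] w w'
      by (simp add: f_add f_scale)
    also have "\<dots> \<le> (\<Sum>k<K. c k)" unfolding cost_def by (intro sum_mono c t)
    finally show "req_supply (complex_of_real t *\<^sub>f x + y) \<le> (\<Sum>k<K. c k)" .
  qed
qed

theorem storage_exists:
  "\<exists>X. (\<forall>i j. X j i = cnj (X i j)) \<and> (\<forall>w. hform n X (f w) \<le> hform n X (p w) + s w)"
proof -
  obtain X where "\<forall>i j. X j i = cnj (X i j)" "\<forall>x\<in>supp n. req_supply x = hform n X x"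
    using jordan_von_neumann[of n req_supply, OF req_supply_parallelogram req_supply_scale
      req_supply_segment] by blast
  then show ?thesis using req_supply_step p_supp f_supp by metis
qed

end

section \<open>Quadratic forms of block matrices\<close>

text \<open>Bolzano-Weierstrass, refining the subsequence coordinate by coordinate, for real and
  imaginary part in turn. The index set is arbitrary so that vectors, matrix entries and a frequency
  can all be treated as coordinates.\<close>

lemma bounded_coordinates_convergent_subseq:
  fixes g :: "nat \<Rightarrow> 'a \<Rightarrow> complex"
  assumes "finite I" and "\<And>a. a \<in> I \<Longrightarrow> \<exists>K. \<forall>k. cmod (g k a) \<le> K"
  shows "\<exists>r :: nat \<Rightarrow> nat. strict_mono r \<and> (\<forall>a\<in>I. convergent (\<lambda>k. g (r k) a))"
  using assms
proof (induction I rule: finite_induct)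
  case empty
  then show ?case by (intro exI[of _ id]) (auto simp: strict_mono_def)
next
  case (insert a I)
  have real_subseq: "\<exists>r :: nat \<Rightarrow> nat. strict_mono r \<and> convergent (h \<circ> r)" if "\<And>k. \<bar>h k\<bar> \<le> K" for h :: "nat \<Rightarrow> real" and K
  proof -
    obtain r :: "nat \<Rightarrow> nat" where r: "strict_mono r" "monoseq (\<lambda>k. h (r k))" using seq_monosub by blast
    have "Bseq (\<lambda>k. h (r k))" using that by (intro BseqI'[of _ K]) auto
    then show ?thesis using r Bseq_monoseq_convergent by (auto simp: o_def)
  qed
  obtain r :: "nat \<Rightarrow> nat" where r: "strict_mono r" "\<And>b. b \<in> I \<Longrightarrow> convergent (\<lambda>k. g (r k) b)"
    using insert by auto
  obtain K where K: "\<And>k. cmod (g k a) \<le> K" using insert.prems[of a] by blast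
  have "\<bar>Re (g (r k) a)\<bar> \<le> K" "\<bar>Im (g (r k) a)\<bar> \<le> K" for k
    using abs_Re_le_cmod[of "g (r k) a"] abs_Im_le_cmod[of "g (r k) a"] K[of "r k"] by linarith+
  note bd = this
  obtain r1 :: "nat \<Rightarrow> nat" where r1: "strict_mono r1" "convergent (\<lambda>k. Re (g (r (r1 k)) a))"
    using real_subseq[of "\<lambda>k. Re (g (r k) a)", OF bd(1)] by (auto simp: o_def)
  obtain r2 :: "nat \<Rightarrow> nat" where r2: "strict_mono r2" "convergent (\<lambda>k. Im (g (r (r1 (r2 k))) a))"
    using real_subseq[of "\<lambda>k. Im (g (r (r1 k)) a)", OF bd(2)] by (auto simp: o_def)
  have "convergent (\<lambda>k. Re (g (r (r1 (r2 k))) a))"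
    using convergent_subseq_convergent[OF r1(2) r2(1)] by (simp add: o_def)
  with r2(2) have "convergent (\<lambda>k. Complex (Re (g (r (r1 (r2 k))) a)) (Im (g (r (r1 (r2 k))) a)))"
    unfolding convergent_def using tendsto_Complex by blast
  then have a: "convergent (\<lambda>k. g (r (r1 (r2 k))) a)" by simp
  have sm: "strict_mono (\<lambda>k. r1 (r2 k))" using strict_mono_o[OF r1(1) r2(1)] by (simp add: o_def)
  have "convergent (\<lambda>k. g (r (r1 (r2 k))) b)" if "b \<in> I" for b
    using convergent_subseq_convergent[OF r(2)[OF that] sm] by (simp add: o_def)
  moreover have "strict_mono (\<lambda>k. r (r1 (r2 k)))" using strict_mono_o[OF r(1) sm] by (simp add: o_def)
  ultimately show ?case using a by (intro exI[of _ "\<lambda>k. r (r1 (r2 k))"]) auto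
qed

section \<open>Adjoints, inner products and Hermitian forms in coordinates\<close>

lemma mat_adjoint_dims [simp]:
  "dim_row (mat_adjoint A) = dim_col A" "dim_col (mat_adjoint A) = dim_row A"
  by (auto simp: mat_adjoint_def)

lemma mat_adjoint_carrier [simp]: "A \<in> carrier_mat k l \<Longrightarrow> mat_adjoint A \<in> carrier_mat l k"
  by (intro carrier_matI) simp_all

lemma mat_adjoint_index [simp]:
  "i < dim_col A \<Longrightarrow> j < dim_row A \<Longrightarrow> mat_adjoint A $$ (i, j) = conjugate (A $$ (j, i))"
  by (simp add: mat_adjoint_def mat_of_rows_index conjugate_vec_def)

lemma cprod_add_left:
  fixes x :: "complex vec"
  assumes "x \<in> carrier_vec k" "y \<in> carrier_vec k" "z \<in> carrier_vec k"
  shows "(x + y) \<bullet>c z = x \<bullet>c z + y \<bullet>c z"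
  using assms by (intro add_scalar_prod_distrib) auto

lemma cprod_add_right:
  fixes x :: "complex vec"
  assumes "x \<in> carrier_vec k" "y \<in> carrier_vec k" "z \<in> carrier_vec k"
  shows "z \<bullet>c (x + y) = z \<bullet>c x + z \<bullet>c y"
  using assms by (simp add: conjugate_add_vec scalar_prod_add_distrib[of _ k])

lemma cprod_smult_left:
  fixes x :: "complex vec"
  assumes "x \<in> carrier_vec k" "z \<in> carrier_vec k"
  shows "(c \<cdot>\<^sub>v x) \<bullet>c z = c * (x \<bullet>c z)"
  using assms by (intro smult_scalar_prod_distrib) auto

lemma cprod_smult_right:
  fixes x :: "complex vec"
  assumes "x \<in> carrier_vec k" "z \<in> carrier_vec k"
  shows "z \<bullet>c (c \<cdot>\<^sub>v x) = cnj c * (z \<bullet>c x)"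
  using assms by (simp add: conjugate_smult_vec scalar_prod_smult_distrib[of _ k])

lemma cprod_swap:
  fixes x :: "complex vec"
  assumes "x \<in> carrier_vec k" "y \<in> carrier_vec k"
  shows "x \<bullet>c y = cnj (y \<bullet>c x)"
  using assms unfolding scalar_prod_def by (auto intro!: sum.cong simp: mult.commute)

lemma cprod_adjoint:
  fixes A :: "complex mat"
  assumes A: "A \<in> carrier_mat k l" and x: "x \<in> carrier_vec l" and y: "y \<in> carrier_vec k"
  shows "(mat_adjoint A *\<^sub>v y) \<bullet>c x = y \<bullet>c (A *\<^sub>v x)"
proof -
  have "(mat_adjoint A *\<^sub>v y) \<bullet>c x = (\<Sum>j<l. \<Sum>i<k. cnj (A $$ (i, j)) * y $ i * cnj (x $ j))"
    using A x y by (auto simp: scalar_prod_def sum_distrib_right atLeast0LessThan intro!: sum.cong)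
  also have "\<dots> = (\<Sum>i<k. \<Sum>j<l. cnj (A $$ (i, j)) * y $ i * cnj (x $ j))" by (rule sum.swap)
  also have "\<dots> = y \<bullet>c (A *\<^sub>v x)"
    using A x y by (auto simp: scalar_prod_def sum_distrib_left atLeast0LessThan mult_ac intro!: sum.cong)
  finally show ?thesis .
qed

lemma mat_adjoint_mult_vec_carrier [simp]:
  "A \<in> carrier_mat k l \<Longrightarrow> y \<in> carrier_vec k \<Longrightarrow> mat_adjoint A *\<^sub>v y \<in> carrier_vec l"
  by (rule mult_mat_vec_carrier[OF mat_adjoint_carrier])

lemma cprod_self:
  fixes x :: "complex vec"
  shows "x \<bullet>c x = complex_of_real (\<Sum>i<dim_vec x. (cmod (x $ i))\<^sup>2)"
  by (simp add: scalar_prod_def atLeast0LessThan complex_norm_square del: of_real_power)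

lemma cprod_self_pos:
  fixes x :: "complex vec"
  assumes "x \<in> carrier_vec k" "x \<noteq> 0\<^sub>v k"
  shows "0 < Re (x \<bullet>c x)"
proof -
  obtain i where i: "i < k" "x $ i \<noteq> 0"
    using assms by (metis carrier_vecD eq_vecI index_zero_vec)
  have "0 < (\<Sum>i<k. (cmod (x $ i))\<^sup>2)" using i by (intro sum_pos2[of _ i]) auto
  then show ?thesis using assms by (simp add: cprod_self del: of_real_sum)
qed

lemma cprod_self_nonneg: "0 \<le> Re ((x :: complex vec) \<bullet>c x)"
  by (simp add: cprod_self sum_nonneg del: of_real_sum)

lemma quad_form_sum:
  assumes "X \<in> carrier_mat k k" "x \<in> carrier_vec k"
  shows "quad_form X x = (\<Sum>i<k. \<Sum>j<k. X $$ (i, j) * x $ j * cnj (x $ i))"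
  using assms
  by (auto simp: quad_form_def scalar_prod_def sum_distrib_right atLeast0LessThan intro!: sum.cong)

lemma quad_form_smult:
  assumes "X \<in> carrier_mat k k" "x \<in> carrier_vec k"
  shows "Re (quad_form X (c \<cdot>\<^sub>v x)) = (cmod c)\<^sup>2 * Re (quad_form X x)"
proof -
  have "quad_form X (c \<cdot>\<^sub>v x) = complex_of_real ((cmod c)\<^sup>2) * quad_form X x"
    using assms unfolding complex_norm_square
    by (simp add: quad_form_def mult_mat_vec[of _ k k] cprod_smult_left[of _ k] cprod_smult_right[of _ k])
  then show ?thesis by (simp del: of_real_power)
qed

lemma hermitian_form_swap:
  assumes "hermitian k X" "x \<in> carrier_vec k" "y \<in> carrier_vec k"
  shows "Re ((X *\<^sub>v x) \<bullet>c y) = Re ((X *\<^sub>v y) \<bullet>c x)"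
proof -
  have X: "X \<in> carrier_mat k k" "mat_adjoint X = X" using assms by (auto simp: hermitian_def)
  have "(X *\<^sub>v x) \<bullet>c y = cnj ((X *\<^sub>v y) \<bullet>c x)"
    using X assms cprod_adjoint[of X k k y x] cprod_swap[of "x" k "X *\<^sub>v y"]
      mult_mat_vec_carrier[OF X(1) assms(3)] by simp
  then show ?thesis by simp
qed

lemma quad_form_add:
  assumes "hermitian k X" "x \<in> carrier_vec k" "y \<in> carrier_vec k"
  shows "Re (quad_form X (x + y)) = Re (quad_form X x) + 2 * Re ((X *\<^sub>v y) \<bullet>c x) + Re (quad_form X y)"
proof -
  have X: "X \<in> carrier_mat k k" using assms by (auto simp: hermitian_def)
  then show ?thesis using assms hermitian_form_swap[OF assms]
    by (simp add: quad_form_def mult_add_distrib_mat_vec[of _ k k] cprod_add_left[of _ k] cprod_add_right[of _ k])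
qed

lemma hermitianI:
  assumes "X \<in> carrier_mat k k" "\<And>i j. i < k \<Longrightarrow> j < k \<Longrightarrow> X $$ (j, i) = cnj (X $$ (i, j))"
  shows "hermitian k X"
  unfolding hermitian_def
proof (intro conjI eq_matI)
  fix i j assume "i < dim_row X" "j < dim_col X"
  then show "mat_adjoint X $$ (i, j) = X $$ (i, j)" using assms(1) assms(2)[of j i] by simp
qed (use assms(1) in auto)

lemma hermitian_index:
  assumes "hermitian k X" "i < k" "j < k"
  shows "X $$ (j, i) = cnj (X $$ (i, j))"
proof -
  have X: "X \<in> carrier_mat k k" and eq: "mat_adjoint X = X" using assms(1) by (auto simp: hermitian_def)
  have "mat_adjoint X $$ (j, i) = cnj (X $$ (i, j))" using X assms(2,3) by simp
  then show ?thesis unfolding eq .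
qed

lemma hermitian_carrier [simp]: "hermitian k X \<Longrightarrow> X \<in> carrier_mat k k"
  by (simp add: hermitian_def)

lemma adjoint_mult_hermitian_index:
  assumes "hermitian k X" "B \<in> carrier_mat k l" "i < k" "j < l"
  shows "(mat_adjoint B * X) $$ (j, i) = cnj ((X * B) $$ (i, j))"
proof -
  have X: "X \<in> carrier_mat k k" using assms by simp
  have "(mat_adjoint B * X) $$ (j, i) = (\<Sum>a<k. cnj (B $$ (a, j)) * X $$ (a, i))"
    using X assms(2-) by (auto simp: scalar_prod_def atLeast0LessThan intro!: sum.cong)
  also have "\<dots> = (\<Sum>a<k. cnj (X $$ (i, a)) * cnj (B $$ (a, j)))"
    by (intro sum.cong refl) (use hermitian_index[OF assms(1,3)] in simp)
  also have "\<dots> = cnj ((X * B) $$ (i, j))"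
    using X assms(2-) by (auto simp: scalar_prod_def atLeast0LessThan intro!: sum.cong)
  finally show ?thesis .
qed

lemma hermitian_four_block:
  assumes "hermitian k P" "hermitian l S" "Q \<in> carrier_mat k l" "R \<in> carrier_mat l k"
    and "\<And>i j. i < k \<Longrightarrow> j < l \<Longrightarrow> R $$ (j, i) = cnj (Q $$ (i, j))"
  shows "hermitian (k + l) (four_block_mat P Q R S)"
proof (rule hermitianI)
  show "four_block_mat P Q R S \<in> carrier_mat (k + l) (k + l)"
    using assms by (intro four_block_carrier_mat) auto
  fix i j assume ij: "i < k + l" "j < k + l"
  note d = carrier_matD[OF hermitian_carrier[OF assms(1)]] carrier_matD[OF hermitian_carrier[OF assms(2)]]
  consider "i < k" "j < k" | "i < k" "k \<le> j" | "k \<le> i" "j < k" | "k \<le> i" "k \<le> j" by linarith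
  then show "four_block_mat P Q R S $$ (j, i) = cnj (four_block_mat P Q R S $$ (i, j))"
  proof cases
    case 1
    then show ?thesis using ij d hermitian_index[OF assms(1), of i j] by simp
  next
    case 2
    then show ?thesis using ij d assms(5)[of i "j - k"] by simp
  next
    case 3
    then show ?thesis using ij d assms(5)[of j "i - k"] by simp
  next
    case 4
    then show ?thesis using ij d hermitian_index[OF assms(2), of "i - k" "j - k"] by simp
  qed
qed

lemma quad_form_four_block:
  assumes "P \<in> carrier_mat k k" "Q \<in> carrier_mat k l" "R \<in> carrier_mat l k" "S \<in> carrier_mat l l"
    and "x \<in> carrier_vec k" "u \<in> carrier_vec l"
  shows "quad_form (four_block_mat P Q R S) (x @\<^sub>v u)
     = quad_form P x + (Q *\<^sub>v u) \<bullet>c x + (R *\<^sub>v x) \<bullet>c u + quad_form S u"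
proof -
  have "conjugate (x @\<^sub>v u) = conjugate x @\<^sub>v conjugate u"
    using assms by (intro eq_vecI) auto
  then show ?thesis using assms
    by (simp add: quad_form_def four_block_mat_mult_vec[of _ k k _ l _ l] 
      scalar_prod_append[of _ k _ l] cprod_add_left[of _ k] cprod_add_left[of _ l])
qed

section \<open>The linear system and its block matrices\<close>

definition state_step :: "complex mat \<Rightarrow> complex mat \<Rightarrow> complex vec \<Rightarrow> complex vec \<Rightarrow> complex vec"
  where "state_step A B x u = A *\<^sub>v x + B *\<^sub>v u"

definition supply_rate :: "complex mat \<Rightarrow> complex mat \<Rightarrow> complex vec \<Rightarrow> complex vec \<Rightarrow> real"
  where "supply_rate C D x u = 2 * Re ((C *\<^sub>v x + D *\<^sub>v u) \<bullet>c u)"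

abbreviation storage :: "complex mat \<Rightarrow> complex vec \<Rightarrow> real"
  where "storage X x \<equiv> Re (quad_form X x)"

lemma hermitian_add_adjoint:
  fixes D :: "complex mat"
  shows "D \<in> carrier_mat k k \<Longrightarrow> hermitian k (mat_adjoint D + D)"
  by (rule hermitianI) (auto simp: carrier_matD)

lemma hermitian_diff:
  assumes "hermitian k X" "hermitian k Y"
  shows "hermitian k (X - Y)"
proof (rule hermitianI)
  note d = carrier_matD[OF hermitian_carrier[OF assms(1)]] carrier_matD[OF hermitian_carrier[OF assms(2)]]
  show "X - Y \<in> carrier_mat k k" using d by (intro carrier_matI) auto
  fix i j assume "i < k" "j < k"
  then show "(X - Y) $$ (j, i) = cnj ((X - Y) $$ (i, j))"
    using d hermitian_index[OF assms(1), of i j] hermitian_index[OF assms(2), of i j] by simp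
qed

lemma hermitian_smult_real:
  assumes "hermitian k X"
  shows "hermitian k (complex_of_real c \<cdot>\<^sub>m X)"
proof (rule hermitianI)
  note d = carrier_matD[OF hermitian_carrier[OF assms]]
  show "complex_of_real c \<cdot>\<^sub>m X \<in> carrier_mat k k" using d by (intro carrier_matI) auto
  fix i j assume "i < k" "j < k"
  then show "(complex_of_real c \<cdot>\<^sub>m X) $$ (j, i) = cnj ((complex_of_real c \<cdot>\<^sub>m X) $$ (i, j))"
    using d hermitian_index[OF assms, of i j] by simp
qed

lemma split_vec:
  assumes "v \<in> carrier_vec (k + l)"
  obtains x y where "x \<in> carrier_vec k" "y \<in> carrier_vec l" "v = x @\<^sub>v y"
  using vec_first_last_append[OF assms] vec_first_carrier vec_last_carrier by metis

lemma append_zero_vec: "0\<^sub>v k @\<^sub>v 0\<^sub>v l = 0\<^sub>v (k + l)"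
  by (intro eq_vecI) auto

lemma append_eq_zero_iff:
  assumes "x \<in> carrier_vec k" "y \<in> carrier_vec l"
  shows "x @\<^sub>v y = 0\<^sub>v (k + l) \<longleftrightarrow> x = 0\<^sub>v k \<and> y = 0\<^sub>v l"
  unfolding append_zero_vec[symmetric] using assms by (intro append_vec_eq) auto

locale linear_system =
  fixes n m :: nat and A B C D :: "complex mat"
  assumes A [simp]: "A \<in> carrier_mat n n" and B [simp]: "B \<in> carrier_mat n m"
    and C [simp]: "C \<in> carrier_mat m n" and D [simp]: "D \<in> carrier_mat m m"
begin

abbreviation "step x u \<equiv> state_step A B x u"
abbreviation "supplied x u \<equiv> supply_rate C D x u"
abbreviation "Wt X \<equiv> Wt_mat n m X (A, B, C, D)"
abbreviation "shifted \<xi> \<equiv> shift_model m (A, B, C, D) \<xi>"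

lemma step_carrier [simp]: "x \<in> carrier_vec n \<Longrightarrow> u \<in> carrier_vec m \<Longrightarrow> step x u \<in> carrier_vec n"
  unfolding state_step_def by (intro add_carrier_vec mult_mat_vec_carrier[OF A] mult_mat_vec_carrier[OF B])

lemma mult_vec_carriers [simp]:
  "x \<in> carrier_vec n \<Longrightarrow> A *\<^sub>v x \<in> carrier_vec n" "u \<in> carrier_vec m \<Longrightarrow> B *\<^sub>v u \<in> carrier_vec n"
  "x \<in> carrier_vec n \<Longrightarrow> C *\<^sub>v x \<in> carrier_vec m" "u \<in> carrier_vec m \<Longrightarrow> D *\<^sub>v u \<in> carrier_vec m"
  by (rule mult_mat_vec_carrier[OF A] mult_mat_vec_carrier[OF B] mult_mat_vec_carrier[OF C]
      mult_mat_vec_carrier[OF D], assumption)+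

lemma adjoint_mult_vec_carriers [simp]:
  "x \<in> carrier_vec n \<Longrightarrow> mat_adjoint A *\<^sub>v x \<in> carrier_vec n"
  "x \<in> carrier_vec n \<Longrightarrow> mat_adjoint B *\<^sub>v x \<in> carrier_vec m"
  "u \<in> carrier_vec m \<Longrightarrow> mat_adjoint C *\<^sub>v u \<in> carrier_vec n"
  "u \<in> carrier_vec m \<Longrightarrow> mat_adjoint D *\<^sub>v u \<in> carrier_vec m"
  by (rule mat_adjoint_mult_vec_carrier[OF A] mat_adjoint_mult_vec_carrier[OF B]
      mat_adjoint_mult_vec_carrier[OF C] mat_adjoint_mult_vec_carrier[OF D], assumption)+

lemma Wt_hermitian:
  assumes X: "hermitian n X"
  shows "hermitian (n + n + m) (Wt X)"
proof -
  note d = carrier_matD[OF A] carrier_matD[OF B] carrier_matD[OF C] carrier_matD[OF D]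
    carrier_matD[OF hermitian_carrier[OF X]]
  have 1: "hermitian (n + n) (four_block_mat X (X * A) (mat_adjoint A * X) X)"
    using adjoint_mult_hermitian_index[OF X A] hermitian_carrier[OF X]
    by (intro hermitian_four_block X) (auto intro!: mult_carrier_mat[of _ n n])
  show ?thesis unfolding Wt_mat_def prod.case
  proof (rule hermitian_four_block[OF 1 hermitian_add_adjoint[OF D]])
    show "four_block_mat (X * B) (0\<^sub>m n 0) (mat_adjoint C) (0\<^sub>m n 0) \<in> carrier_mat (n + n) m"
      "four_block_mat (mat_adjoint B * X) C (0\<^sub>m 0 n) (0\<^sub>m 0 n) \<in> carrier_mat m (n + n)"
      using d by auto
    fix i j assume ij: "i < n + n" "j < m"
    show "four_block_mat (mat_adjoint B * X) C (0\<^sub>m 0 n) (0\<^sub>m 0 n) $$ (j, i)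
      = cnj (four_block_mat (X * B) (0\<^sub>m n 0) (mat_adjoint C) (0\<^sub>m n 0) $$ (i, j))"
    proof (cases "i < n")
      case True
      then show ?thesis using ij d adjoint_mult_hermitian_index[OF X B True ij(2)]
        by (simp del: index_mult_mat(1))
    next
      case False
      then show ?thesis using ij d by simp
    qed
  qed
qed

text \<open>Completing the square: with f = A x + B u the terms containing \<open>y\<close> are V(y)
  + 2 Re <X f, y> = V(y + f) - V(f). The other blocks give V(x) and the supplied energy.\<close>

lemma Wt_storage:
  assumes X: "hermitian n X" and y: "y \<in> carrier_vec n" and x: "x \<in> carrier_vec n" and u: "u \<in> carrier_vec m"
  shows "Re (quad_form (Wt X) ((y @\<^sub>v x) @\<^sub>v u))
    = storage X (y + step x u) - storage X (step x u) + storage X x + supplied x u"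
proof -
  note Xc [simp] = hermitian_carrier[OF X]
  note d = carrier_matD[OF A] carrier_matD[OF B] carrier_matD[OF C] carrier_matD[OF D] carrier_matD[OF Xc]
  have Xv [simp]: "z \<in> carrier_vec n \<Longrightarrow> X *\<^sub>v z \<in> carrier_vec n" for z by (rule mult_mat_vec_carrier[OF Xc])
  let ?Q = "four_block_mat (X * B) (0\<^sub>m n 0) (mat_adjoint C) (0\<^sub>m n 0)"
  let ?R = "four_block_mat (mat_adjoint B * X) C (0\<^sub>m 0 n) (0\<^sub>m 0 n)"
  have Q: "?Q *\<^sub>v u = (X *\<^sub>v (B *\<^sub>v u)) @\<^sub>v (mat_adjoint C *\<^sub>v u)"
  proof -
    \<comment> \<open>The block column is encoded with an empty right half, so \<open>u\<close> is
      padded by a vector of length 0 to fit the block multiplication rule.\<close>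
    have "?Q *\<^sub>v u = ?Q *\<^sub>v (u @\<^sub>v 0\<^sub>v 0)" using u by (intro arg_cong2[where f = "(*\<^sub>v)"] eq_vecI) auto
    also have "\<dots> = (X * B *\<^sub>v u + 0\<^sub>m n 0 *\<^sub>v 0\<^sub>v 0) @\<^sub>v (mat_adjoint C *\<^sub>v u + 0\<^sub>m n 0 *\<^sub>v 0\<^sub>v 0)"
      using u by (intro four_block_mat_mult_vec[OF mult_carrier_mat[OF Xc B] _ mat_adjoint_carrier[OF C]]) auto
    also have "X * B *\<^sub>v u = X *\<^sub>v (B *\<^sub>v u)" using u by (intro assoc_mult_mat_vec[OF Xc B]) auto
    also have "0\<^sub>m n 0 *\<^sub>v 0\<^sub>v 0 = (0\<^sub>v n :: complex vec)" by (intro eq_vecI) auto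
    finally show ?thesis using u by simp
  qed
  have R: "?R *\<^sub>v (y @\<^sub>v x) = mat_adjoint B *\<^sub>v (X *\<^sub>v y) + C *\<^sub>v x"
  proof -
    have "?R *\<^sub>v (y @\<^sub>v x) = (mat_adjoint B * X *\<^sub>v y + C *\<^sub>v x) @\<^sub>v (0\<^sub>m 0 n *\<^sub>v y + 0\<^sub>m 0 n *\<^sub>v x)"
      using x y by (intro four_block_mat_mult_vec[of _ m n _ n _ 0]) (auto intro!: mult_carrier_mat[of _ m n])
    also have "\<dots> = mat_adjoint B * X *\<^sub>v y + C *\<^sub>v x"
      using d x y by (intro eq_vecI) auto
    also have "mat_adjoint B * X *\<^sub>v y = mat_adjoint B *\<^sub>v (X *\<^sub>v y)"
      using y by (intro assoc_mult_mat_vec[of _ m n _ n]) auto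
    finally show ?thesis .
  qed
  have P: "quad_form (four_block_mat X (X * A) (mat_adjoint A * X) X) (y @\<^sub>v x)
    = quad_form X y + (X *\<^sub>v (A *\<^sub>v x)) \<bullet>c y + (mat_adjoint A *\<^sub>v (X *\<^sub>v y)) \<bullet>c x + quad_form X x"
    using x y by (simp add: quad_form_four_block[of _ n _ n] mult_carrier_mat[of _ n n]
        assoc_mult_mat_vec[of _ n n _ n])
  have app: "conjugate (y @\<^sub>v x) = conjugate y @\<^sub>v conjugate x" using x y by (intro eq_vecI) auto
  have "quad_form (Wt X) ((y @\<^sub>v x) @\<^sub>v u)
    = quad_form X y + (X *\<^sub>v (A *\<^sub>v x)) \<bullet>c y + (mat_adjoint A *\<^sub>v (X *\<^sub>v y)) \<bullet>c x + quad_form X x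
      + ((X *\<^sub>v (B *\<^sub>v u)) \<bullet>c y + (mat_adjoint C *\<^sub>v u) \<bullet>c x)
      + ((mat_adjoint B *\<^sub>v (X *\<^sub>v y)) \<bullet>c u + (C *\<^sub>v x) \<bullet>c u)
      + ((mat_adjoint D *\<^sub>v u) \<bullet>c u + (D *\<^sub>v u) \<bullet>c u)"
  proof -
    have "quad_form (Wt X) ((y @\<^sub>v x) @\<^sub>v u)
      = quad_form (four_block_mat X (X * A) (mat_adjoint A * X) X) (y @\<^sub>v x)
        + (?Q *\<^sub>v u) \<bullet>c (y @\<^sub>v x) + (?R *\<^sub>v (y @\<^sub>v x)) \<bullet>c u + quad_form (mat_adjoint D + D) u"
      unfolding Wt_mat_def prod.case using x y u d
      by (intro quad_form_four_block[of _ "n + n" _ m]) (auto intro!: carrier_matI)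
    also have "(?Q *\<^sub>v u) \<bullet>c (y @\<^sub>v x) = (X *\<^sub>v (B *\<^sub>v u)) \<bullet>c y + (mat_adjoint C *\<^sub>v u) \<bullet>c x"
      unfolding Q app using x y u by (intro scalar_prod_append[of _ n _ n]) auto
    also have "(?R *\<^sub>v (y @\<^sub>v x)) \<bullet>c u = (mat_adjoint B *\<^sub>v (X *\<^sub>v y)) \<bullet>c u + (C *\<^sub>v x) \<bullet>c u"
      unfolding R using x y u by (intro cprod_add_left[of _ m]) auto
    also have "quad_form (mat_adjoint D + D) u = (mat_adjoint D *\<^sub>v u) \<bullet>c u + (D *\<^sub>v u) \<bullet>c u"
      unfolding quad_form_def using u
      by (simp add: add_mult_distrib_mat_vec[of _ m m] cprod_add_left[of _ m])
    finally show ?thesis unfolding P .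
  qed
  moreover have "Re ((mat_adjoint A *\<^sub>v (X *\<^sub>v y)) \<bullet>c x) = Re ((X *\<^sub>v (A *\<^sub>v x)) \<bullet>c y)"
    using x y hermitian_form_swap[OF X, of y "A *\<^sub>v x"] by (simp add: cprod_adjoint[of A n n])
  moreover have "Re ((mat_adjoint B *\<^sub>v (X *\<^sub>v y)) \<bullet>c u) = Re ((X *\<^sub>v (B *\<^sub>v u)) \<bullet>c y)"
    using u y hermitian_form_swap[OF X, of y "B *\<^sub>v u"] by (simp add: cprod_adjoint[of B n m])
  moreover have "Re ((mat_adjoint C *\<^sub>v u) \<bullet>c x) = Re ((C *\<^sub>v x) \<bullet>c u)"
    using u x cprod_swap[of u m "C *\<^sub>v x"] by (simp add: cprod_adjoint[of C m n])
  moreover have "Re ((mat_adjoint D *\<^sub>v u) \<bullet>c u) = Re ((D *\<^sub>v u) \<bullet>c u)"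
    using u cprod_swap[of u m "D *\<^sub>v u"] by (simp add: cprod_adjoint[of D m m])
  moreover have "(X *\<^sub>v step x u) \<bullet>c y = (X *\<^sub>v (A *\<^sub>v x)) \<bullet>c y + (X *\<^sub>v (B *\<^sub>v u)) \<bullet>c y"
    using x y u by (simp add: state_step_def mult_add_distrib_mat_vec[of _ n n] cprod_add_left[of _ n])
  moreover have "supplied x u = 2 * Re ((C *\<^sub>v x) \<bullet>c u) + 2 * Re ((D *\<^sub>v u) \<bullet>c u)"
    using x u by (simp add: supply_rate_def cprod_add_left[of _ m])
  ultimately show ?thesis
    using quad_form_add[OF X y step_carrier[OF x u]] by simp
qed

lemma W_hermitian:
  assumes X: "hermitian n X"
  shows "hermitian (n + m) (W_mat X (A, B, C, D))"
proof -
  note Xc [simp] = hermitian_carrier[OF X]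
  note d = carrier_matD[OF A] carrier_matD[OF B] carrier_matD[OF C] carrier_matD[OF D] carrier_matD[OF Xc]
  have cong: "(mat_adjoint F * X * G) $$ (i, j) = cnj ((mat_adjoint G * X * F) $$ (j, i))"
    if F: "F \<in> carrier_mat n k" and G: "G \<in> carrier_mat n l" and ij: "i < k" "j < l" for F G k l i j
  proof -
    have "(mat_adjoint F * X * G) $$ (i, j) = (\<Sum>a<n. (mat_adjoint F * X) $$ (i, a) * G $$ (a, j))"
      using F G ij d by (simp add: scalar_prod_def atLeast0LessThan)
    also have "\<dots> = (\<Sum>a<n. cnj ((X * F) $$ (a, i)) * G $$ (a, j))"
      by (intro sum.cong refl) (use adjoint_mult_hermitian_index[OF X F _ ij(1)] in simp)
    also have "\<dots> = cnj (\<Sum>a<n. mat_adjoint G $$ (j, a) * (X * F) $$ (a, i))"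
      using F G ij d by (simp add: mult.commute)
    also have "(\<Sum>a<n. mat_adjoint G $$ (j, a) * (X * F) $$ (a, i)) = (mat_adjoint G * (X * F)) $$ (j, i)"
      using F G ij d by (simp add: scalar_prod_def atLeast0LessThan)
    also have "mat_adjoint G * (X * F) = mat_adjoint G * X * F"
      using F G by (intro assoc_mult_mat[symmetric, of _ l n _ n _ k]) auto
    finally show ?thesis .
  qed
  show ?thesis unfolding W_mat_def prod.case
  proof (rule hermitian_four_block)
    have "hermitian n (mat_adjoint A * X * A)" "hermitian m (mat_adjoint B * X * B)"
      using d by (auto intro!: hermitianI carrier_matI cong[OF A A] cong[OF B B] simp del: index_mult_mat(1))
    then show "hermitian n (X - mat_adjoint A * X * A)"
      "hermitian m (mat_adjoint D + D - mat_adjoint B * X * B)"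
      using X by (auto intro!: hermitian_diff hermitian_add_adjoint D)
    show "mat_adjoint C - mat_adjoint A * X * B \<in> carrier_mat n m"
      "C - mat_adjoint B * X * A \<in> carrier_mat m n" using d by (auto intro!: carrier_matI)
    fix i j assume ij: "i < n" "j < m"
    then show "(C - mat_adjoint B * X * A) $$ (j, i) = cnj ((mat_adjoint C - mat_adjoint A * X * B) $$ (i, j))"
      using d cong[OF B A ij(2,1)] by (simp del: index_mult_mat(1))
  qed
qed

text \<open>This is the value of the extended form at y = -(A x + B u), where the completed square
  vanishes; it turns membership in \<open>Xpos\<close> into a dissipation inequality.\<close>

lemma W_storage:
  assumes X: "hermitian n X" and x: "x \<in> carrier_vec n" and u: "u \<in> carrier_vec m"
  shows "Re (quad_form (W_mat X (A, B, C, D)) (x @\<^sub>v u))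
    = storage X x - storage X (step x u) + supplied x u"
proof -
  note Xc [simp] = hermitian_carrier[OF X]
  note d = carrier_matD[OF A] carrier_matD[OF B] carrier_matD[OF C] carrier_matD[OF D] carrier_matD[OF Xc]
  have Xv [simp]: "z \<in> carrier_vec n \<Longrightarrow> X *\<^sub>v z \<in> carrier_vec n" for z by (rule mult_mat_vec_carrier[OF Xc])
  have sand: "(mat_adjoint F * X * G *\<^sub>v b) \<bullet>c a = (X *\<^sub>v (G *\<^sub>v b)) \<bullet>c (F *\<^sub>v a)"
    if F: "F \<in> carrier_mat n k" and G: "G \<in> carrier_mat n l" and "b \<in> carrier_vec l" "a \<in> carrier_vec k" for F G k l a b
  proof -
    have Gb: "G *\<^sub>v b \<in> carrier_vec n" using that by (auto intro!: mult_mat_vec_carrier[of _ n l])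
    have "mat_adjoint F * X * G *\<^sub>v b = mat_adjoint F *\<^sub>v (X *\<^sub>v (G *\<^sub>v b))"
      using that Gb d by (simp add: assoc_mult_mat_vec[of _ k n _ l] assoc_mult_mat_vec[of _ k n _ n] mult_carrier_mat[of _ k n])
    then show ?thesis using that Gb by (simp add: cprod_adjoint[of F n k])
  qed
  have minus: "((M - N) *\<^sub>v b) \<bullet>c a = (M *\<^sub>v b) \<bullet>c a - (N *\<^sub>v b) \<bullet>c a"
    if "M \<in> carrier_mat k l" "N \<in> carrier_mat k l" "b \<in> carrier_vec l" "a \<in> carrier_vec k" for M N :: "complex mat" and k l a b
    using that by (simp add: minus_mult_distrib_mat_vec[of _ k l] minus_scalar_prod_distrib[of _ k])
  have car: "mat_adjoint F * X * G \<in> carrier_mat k l" if "F \<in> carrier_mat n k" "G \<in> carrier_mat n l" for F G k l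
    using that d by (auto intro!: carrier_matI)
  have "quad_form (W_mat X (A, B, C, D)) (x @\<^sub>v u)
    = quad_form X x - (X *\<^sub>v (A *\<^sub>v x)) \<bullet>c (A *\<^sub>v x)
      + ((mat_adjoint C *\<^sub>v u) \<bullet>c x - (X *\<^sub>v (B *\<^sub>v u)) \<bullet>c (A *\<^sub>v x))
      + ((C *\<^sub>v x) \<bullet>c u - (X *\<^sub>v (A *\<^sub>v x)) \<bullet>c (B *\<^sub>v u))
      + ((mat_adjoint D *\<^sub>v u) \<bullet>c u + (D *\<^sub>v u) \<bullet>c u - (X *\<^sub>v (B *\<^sub>v u)) \<bullet>c (B *\<^sub>v u))"
  proof -
    have "quad_form (W_mat X (A, B, C, D)) (x @\<^sub>v u) = quad_form (X - mat_adjoint A * X * A) x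
        + ((mat_adjoint C - mat_adjoint A * X * B) *\<^sub>v u) \<bullet>c x + ((C - mat_adjoint B * X * A) *\<^sub>v x) \<bullet>c u
        + quad_form (mat_adjoint D + D - mat_adjoint B * X * B) u"
      unfolding W_mat_def prod.case using x u d
      by (intro quad_form_four_block[of _ n _ m]) (auto intro!: carrier_matI)
    also have "quad_form (X - mat_adjoint A * X * A) x = quad_form X x - (X *\<^sub>v (A *\<^sub>v x)) \<bullet>c (A *\<^sub>v x)"
      unfolding quad_form_def using x by (simp add: minus[OF Xc car[OF A A]] sand[OF A A])
    also have "((mat_adjoint C - mat_adjoint A * X * B) *\<^sub>v u) \<bullet>c x
        = (mat_adjoint C *\<^sub>v u) \<bullet>c x - (X *\<^sub>v (B *\<^sub>v u)) \<bullet>c (A *\<^sub>v x)"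
      using x u by (simp add: minus[OF mat_adjoint_carrier[OF C] car[OF A B]] sand[OF A B])
    also have "((C - mat_adjoint B * X * A) *\<^sub>v x) \<bullet>c u = (C *\<^sub>v x) \<bullet>c u - (X *\<^sub>v (A *\<^sub>v x)) \<bullet>c (B *\<^sub>v u)"
      using x u by (simp add: minus[OF C car[OF B A]] sand[OF B A])
    also have "quad_form (mat_adjoint D + D - mat_adjoint B * X * B) u
        = (mat_adjoint D *\<^sub>v u) \<bullet>c u + (D *\<^sub>v u) \<bullet>c u - (X *\<^sub>v (B *\<^sub>v u)) \<bullet>c (B *\<^sub>v u)"
    proof -
      have "mat_adjoint D + D \<in> carrier_mat m m" by simp
      then show ?thesis unfolding quad_form_def using u
        by (simp add: minus[OF _ car[OF B B]] sand[OF B B] add_mult_distrib_mat_vec[of _ m m] cprod_add_left[of _ m])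
    qed
    finally show ?thesis .
  qed
  moreover have "Re ((mat_adjoint C *\<^sub>v u) \<bullet>c x) = Re ((C *\<^sub>v x) \<bullet>c u)"
    using u x cprod_swap[of u m "C *\<^sub>v x"] by (simp add: cprod_adjoint[of C m n])
  moreover have "Re ((mat_adjoint D *\<^sub>v u) \<bullet>c u) = Re ((D *\<^sub>v u) \<bullet>c u)"
    using u cprod_swap[of u m "D *\<^sub>v u"] by (simp add: cprod_adjoint[of D m m])
  moreover have "storage X (step x u) = Re ((X *\<^sub>v (A *\<^sub>v x)) \<bullet>c (A *\<^sub>v x))
      + 2 * Re ((X *\<^sub>v (B *\<^sub>v u)) \<bullet>c (A *\<^sub>v x)) + Re ((X *\<^sub>v (B *\<^sub>v u)) \<bullet>c (B *\<^sub>v u))"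
    unfolding state_step_def using x u by (subst quad_form_add[OF X]) (auto simp: quad_form_def)
  moreover have "Re ((X *\<^sub>v (A *\<^sub>v x)) \<bullet>c (B *\<^sub>v u)) = Re ((X *\<^sub>v (B *\<^sub>v u)) \<bullet>c (A *\<^sub>v x))"
    using x u by (intro hermitian_form_swap[OF X]) auto
  moreover have "supplied x u = 2 * Re ((C *\<^sub>v x) \<bullet>c u) + 2 * Re ((D *\<^sub>v u) \<bullet>c u)"
    using x u by (simp add: supply_rate_def cprod_add_left[of _ m])
  ultimately show ?thesis by simp
qed

end

lemma diag3_hermitian:
  assumes X: "hermitian n X"
  shows "hermitian (n + n + m) (diag3 n m X)"
  unfolding diag3_def
  by (intro hermitian_four_block X) (auto intro!: hermitianI)

lemma diag3_storage:
  assumes X: "hermitian n X" and y: "y \<in> carrier_vec n" and x: "x \<in> carrier_vec n" and u: "u \<in> carrier_vec m"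
  shows "Re (quad_form (diag3 n m X) ((y @\<^sub>v x) @\<^sub>v u)) = storage X y + storage X x + 2 * Re (u \<bullet>c u)"
proof -
  note Xc = hermitian_carrier[OF X]
  have "quad_form (diag3 n m X) ((y @\<^sub>v x) @\<^sub>v u) = quad_form (four_block_mat X (0\<^sub>m n n) (0\<^sub>m n n) X) (y @\<^sub>v x)
      + (0\<^sub>m (n + n) m *\<^sub>v u) \<bullet>c (y @\<^sub>v x) + (0\<^sub>m m (n + n) *\<^sub>v (y @\<^sub>v x)) \<bullet>c u + quad_form (2 \<cdot>\<^sub>m 1\<^sub>m m) u"
    unfolding diag3_def using Xc x y u
    by (intro quad_form_four_block[of _ "n + n" _ m]) (auto intro!: carrier_matI)
  also have "quad_form (four_block_mat X (0\<^sub>m n n) (0\<^sub>m n n) X) (y @\<^sub>v x) = quad_form X y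
      + (0\<^sub>m n n *\<^sub>v x) \<bullet>c y + (0\<^sub>m n n *\<^sub>v y) \<bullet>c x + quad_form X x"
    using Xc x y by (intro quad_form_four_block[of _ n _ n]) auto
  also have "0\<^sub>m (n + n) m *\<^sub>v u = 0\<^sub>v (n + n)" using u by auto
  also have "0\<^sub>m m (n + n) *\<^sub>v (y @\<^sub>v x) = 0\<^sub>v m" using x y by auto
  also have "0\<^sub>m n n *\<^sub>v x = 0\<^sub>v n" using x by auto
  also have "0\<^sub>m n n *\<^sub>v y = 0\<^sub>v n" using y by auto
  also have "quad_form (2 \<cdot>\<^sub>m 1\<^sub>m m) u = 2 * (u \<bullet>c u)"
  proof -
    have "(2 \<cdot>\<^sub>m 1\<^sub>m m) *\<^sub>v u = 2 \<cdot>\<^sub>v u" using u by (intro eq_vecI) auto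
    then show ?thesis using u by (simp add: quad_form_def cprod_smult_left[of _ m])
  qed
  finally show ?thesis using x y u by (simp add: scalar_prod_left_zero[of _ "n + n"] scalar_prod_left_zero[of _ n])
qed

section \<open>Linear algebra and controllability\<close>

lemma sum_lessThan_add:
  fixes g :: "nat \<Rightarrow> 'a :: comm_monoid_add"
  shows "(\<Sum>j<k + l. g j) = (\<Sum>j<k. g j) + (\<Sum>j<l. g (k + j))"
  by (induction l) (simp_all add: add.assoc)

lemma pow_mat_Suc_left:
  fixes M :: "'a :: semiring_1 mat"
  assumes M: "M \<in> carrier_mat n n"
  shows "M ^\<^sub>m Suc j = M * M ^\<^sub>m j"
proof (induction j)
  case 0
  then show ?case using M carrier_matD[OF M] by simp
next
  case (Suc j)
  have "M ^\<^sub>m Suc (Suc j) = M * M ^\<^sub>m j * M" using Suc by simp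
  also have "\<dots> = M * (M ^\<^sub>m j * M)" by (rule assoc_mult_mat[OF M pow_carrier_mat[OF M] M])
  finally show ?case by simp
qed

text \<open>A maximal independent set of columns has as many elements as the rank, hence
  \<open>n\<close>, so it is a basis of the whole space.\<close>

lemma full_row_rank_surj:
  fixes M :: "complex mat"
  assumes M: "M \<in> carrier_mat n k" and rank: "vec_space.rank n M = n" and v: "v \<in> carrier_vec n"
  shows "\<exists>w\<in>carrier_vec k. M *\<^sub>v w = v"
proof -
  interpret vec_space "TYPE(complex)" n .
  obtain S where S: "maximal S (\<lambda>T. T \<subseteq> set (cols M) \<and> lin_indpt T)"
    using maximal_exists[of "\<lambda>T. T \<subseteq> set (cols M) \<and> lin_indpt T" "card (set (cols M))" "{}"]
    by (meson List.finite_set card_mono empty_iff empty_subsetI finite_lin_indpt2 rev_finite_subset)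
  have card: "card S = n" using rank_card_indpt[OF M S] rank by simp
  have sub: "S \<subseteq> set (cols M)" "lin_indpt S" using S by (auto simp: maximal_def)
  have cols: "set (cols M) \<subseteq> carrier_vec n" using cols_dim[of M] M by simp
  have "basis S"
    using sub cols card by (intro dim_li_is_basis) (auto simp: dim_is_n intro: finite_subset)
  then have "v \<in> span S" using v by (simp add: basis_def)
  then have "v \<in> col_space M" unfolding col_space_def using span_is_monotone[OF sub(1)] by blast
  then show ?thesis using col_space_eq[of M k] M by auto
qed

text \<open>A set of columns forgets repetitions, so distinctness comes first: with a repeated
  column fewer than \<open>n\<close> vectors would be left to carry the rank. A nonzero kernel
  vector is then a linear dependence among the columns.\<close>

lemma full_column_rank_inj:
  fixes M :: "complex mat"
  assumes M: "M \<in> carrier_mat k n" and rank: "vec_space.rank k M = n"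
    and v: "v \<in> carrier_vec n" and 0: "M *\<^sub>v v = 0\<^sub>v k"
  shows "v = 0\<^sub>v n"
proof (rule ccontr)
  assume nz: "v \<noteq> 0\<^sub>v n"
  interpret vec_space "TYPE(complex)" k .
  have "distinct (cols M)"
  proof (rule ccontr)
    assume nd: "\<not> distinct (cols M)"
    obtain S where S: "maximal S (\<lambda>T. T \<subseteq> set (cols M) \<and> lin_indpt T)"
      using maximal_exists[of "\<lambda>T. T \<subseteq> set (cols M) \<and> lin_indpt T" "card (set (cols M))" "{}"]
      by (meson List.finite_set card_mono empty_iff empty_subsetI finite_lin_indpt2 rev_finite_subset)
    have "n = card S" using rank_card_indpt[OF M S] rank by simp
    also have "\<dots> \<le> card (set (cols M))" using S by (intro card_mono) (auto simp: maximal_def)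
    also have "\<dots> < length (cols M)"
      using nd card_distinct card_length[of "cols M"] by (metis le_neq_implies_less)
    finally show False using M by simp
  qed
  then show False
    using lin_depI[OF M v nz 0] full_rank_lin_indpt[OF M rank] by blast
qed

text \<open>\<open>transfer\<close> applies \<open>the\<close> to \<open>mat_inverse\<close>; when
  \<open>z\<close> is not an eigenvalue, this yields a genuine two-sided inverse.\<close>

lemma resolvent_exists:
  fixes A :: "complex mat"
  assumes A: "A \<in> carrier_mat n n" and inj: "\<And>x. x \<in> carrier_vec n \<Longrightarrow> A *\<^sub>v x = z \<cdot>\<^sub>v x \<Longrightarrow> x = 0\<^sub>v n"
  shows "\<exists>G. mat_inverse (z \<cdot>\<^sub>m 1\<^sub>m n - A) = Some G \<and> G \<in> carrier_mat n n
     \<and> (z \<cdot>\<^sub>m 1\<^sub>m n - A) * G = 1\<^sub>m n \<and> G * (z \<cdot>\<^sub>m 1\<^sub>m n - A) = 1\<^sub>m n"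
proof -
  let ?N = "z \<cdot>\<^sub>m 1\<^sub>m n - A"
  have N: "?N \<in> carrier_mat n n" using A by auto
  have "det ?N \<noteq> 0"
  proof
    assume "det ?N = 0"
    then obtain v where v: "v \<in> carrier_vec n" "v \<noteq> 0\<^sub>v n" "?N *\<^sub>v v = 0\<^sub>v n"
      using det_0_iff_vec_prod_zero_field[OF N] by blast
    have "?N *\<^sub>v v = z \<cdot>\<^sub>v v - A *\<^sub>v v"
      using A v by (subst minus_mult_distrib_mat_vec[of _ n n]) auto
    with v have "z \<cdot>\<^sub>v v - A *\<^sub>v v = 0\<^sub>v n" by simp
    then have "A *\<^sub>v v = z \<cdot>\<^sub>v v"
    proof (intro eq_vecI)
      fix i assume i: "i < dim_vec (z \<cdot>\<^sub>v v)"
      assume "z \<cdot>\<^sub>v v - A *\<^sub>v v = 0\<^sub>v n"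
      then have "(z \<cdot>\<^sub>v v - A *\<^sub>v v) $ i = 0" using i v by simp
      then show "(A *\<^sub>v v) $ i = (z \<cdot>\<^sub>v v) $ i" using i v A by simp
    qed (use A v in auto)
    then show False using inj v by blast
  qed
  then have "?N \<in> Units (ring_mat TYPE(complex) n ())" by (rule det_non_zero_imp_unit[OF N])
  then obtain G where "mat_inverse ?N = Some G" using mat_inverse(1)[OF N, where b = "()"] by (cases "mat_inverse ?N") auto
  then show ?thesis using mat_inverse(2)[OF N] by blast
qed

lemma power_bounded_of_spectrum:
  fixes A :: "complex mat"
  assumes A: "A \<in> carrier_mat n n" and n: "0 < n" and ev: "\<And>l. eigenvalue A l \<Longrightarrow> cmod l < 1"
  shows "\<exists>c. \<forall>k. norm_bound (A ^\<^sub>m k) c"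
proof (rule spectral_radius_jnf_norm_bound_less_1[OF A])
  show "spectral_radius A < 1"
    using spectral_radius_mem_max(1)[OF A n] ev by (auto simp: spectrum_def)
  show "\<exists>n_as. jordan_nf A n_as"
    using char_poly_factorized[OF A] jordan_nf_exists[OF A] by blast
qed

text \<open>If the kernel does not grow from the first to the second power of the characteristic
  matrix, it never grows. The algebraic multiplicity is the kernel dimension of a high power, hence
  that of the first.\<close>

lemma semisimple_eigenvalueI:
  fixes A :: "complex mat"
  assumes A: "A \<in> carrier_mat n n" and ev: "eigenvalue A l"
    and inj: "\<And>v. v \<in> carrier_vec n \<Longrightarrow> char_matrix A l *\<^sub>v (char_matrix A l *\<^sub>v v) = 0\<^sub>v n \<Longrightarrow> char_matrix A l *\<^sub>v v = 0\<^sub>v n"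
  shows "semisimple_eigenvalue A l"
proof -
  let ?M = "char_matrix A l"
  have M: "?M \<in> carrier_mat n n" using A by simp
  obtain n_as where jnf: "jordan_nf A n_as" using char_poly_factorized[OF A] jordan_nf_exists[OF A] by blast
  \<comment> \<open>At least the size of every Jordan block, so the generalized eigenspace is
    complete; \<open>Suc\<close> keeps the exponent positive, as the comparison with the kernel of
    the first power requires.\<close>
  define N where "N = Suc (sum_list (map fst n_as))"
  have "Polynomial.order l (char_poly A) = sum_list (map fst (filter (\<lambda>na. snd na = l) n_as))"
    by (rule jordan_nf_order[OF jnf])
  also have "\<dots> = dim_gen_eigenspace A l N"
  proof -
    have "min N s = s" if "(s, e) \<in> set n_as" for s e
    proof -
      have "s \<le> sum_list (map fst n_as)" using that by (intro member_le_sum_list) force+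
      then show ?thesis by (simp add: N_def)
    qed
    then have eq: "map (min N) (map fst [(n, e)\<leftarrow>n_as . e = l]) = map fst [(n, e)\<leftarrow>n_as . e = l]"
      by (intro map_idI) auto
    show ?thesis unfolding dim_gen_eigenspace[OF jnf] eq by (simp add: case_prod_beta')
  qed
  also have "\<dots> = kernel_dim (?M ^\<^sub>m N)" by (simp add: dim_gen_eigenspace_def)
  also have "\<dots> = kernel_dim ?M"
  proof -
    have Mk: "?M ^\<^sub>m k \<in> carrier_mat n n" for k using M by simp
    have step: "?M ^\<^sub>m Suc (Suc k) *\<^sub>v v = 0\<^sub>v n \<Longrightarrow> ?M ^\<^sub>m Suc k *\<^sub>v v = 0\<^sub>v n" if v: "v \<in> carrier_vec n" for k v
    proof -
      have c: "?M ^\<^sub>m k *\<^sub>v v \<in> carrier_vec n" by (rule mult_mat_vec_carrier[OF Mk v])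
      have e: "?M ^\<^sub>m Suc j *\<^sub>v v = ?M *\<^sub>v (?M ^\<^sub>m j *\<^sub>v v)" for j
        unfolding pow_mat_Suc_left[OF M] by (rule assoc_mult_mat_vec[OF M Mk v])
      assume "?M ^\<^sub>m Suc (Suc k) *\<^sub>v v = 0\<^sub>v n"
      then show ?thesis unfolding e using inj[OF c] by simp
    qed
    have all: "?M ^\<^sub>m Suc k *\<^sub>v v = 0\<^sub>v n \<Longrightarrow> ?M *\<^sub>v v = 0\<^sub>v n" if v: "v \<in> carrier_vec n" for k v
    proof (induction k)
      case 0
      then show ?case using M by simp
    next
      case (Suc k)
      then show ?case using step[OF v] by blast
    qed
    have zero: "?M *\<^sub>v v = 0\<^sub>v n \<Longrightarrow> ?M ^\<^sub>m Suc k *\<^sub>v v = 0\<^sub>v n" if v: "v \<in> carrier_vec n" for k v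
    proof -
      assume 0: "?M *\<^sub>v v = 0\<^sub>v n"
      have "?M ^\<^sub>m Suc k *\<^sub>v v = ?M ^\<^sub>m k *\<^sub>v (?M *\<^sub>v v)" using assoc_mult_mat_vec[OF Mk M v] by simp
      also have "\<dots> = 0\<^sub>v n" unfolding 0 using carrier_matD[OF Mk[of k]] by (intro eq_vecI) (auto simp: scalar_prod_def)
      finally show ?thesis .
    qed
    have "mat_kernel (?M ^\<^sub>m N) = mat_kernel ?M"
      using all zero unfolding N_def mat_kernel[OF Mk] mat_kernel[OF M] by blast
    moreover have "dim_col (?M ^\<^sub>m N) = dim_col ?M" using Mk[of N] M by simp
    ultimately show ?thesis unfolding kernel_dim_def by simp
  qed
  finally show ?thesis using ev by (simp add: semisimple_eigenvalue_def)
qed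

section \<open>States reachable in a fixed number of steps\<close>

primrec reachable :: "nat \<Rightarrow> nat \<Rightarrow> complex mat \<Rightarrow> complex mat \<Rightarrow> nat \<Rightarrow> complex vec set" where
  "reachable n m A B 0 = {0\<^sub>v n}"
| "reachable n m A B (Suc k) = {state_step A B x u | x u. x \<in> reachable n m A B k \<and> u \<in> carrier_vec m}"

context linear_system
begin

lemma reachable_carrier: "x \<in> reachable n m A B k \<Longrightarrow> x \<in> carrier_vec n"
  by (induction k arbitrary: x) auto

text \<open>The first \<open>m\<close> entries of \<open>w\<close> act as the last input through
  \<open>B\<close>; the other blocks are \<open>A\<close> times the shorter matrix of the same
  shape. A general block number \<open>k\<close> makes this an induction.\<close>

lemma krylov_mat_reachable:
  assumes "w \<in> carrier_vec (k * m)"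
  shows "mat n (k * m) (\<lambda>(i, j). (A ^\<^sub>m (j div m) * B) $$ (i, j mod m)) *\<^sub>v w \<in> reachable n m A B k"
  using assms
proof (induction k arbitrary: w)
  case 0
  then show ?case by (auto intro!: eq_vecI simp: scalar_prod_def)
next
  case (Suc k)
  let ?K = "\<lambda>k. mat n (k * m) (\<lambda>(i, j). (A ^\<^sub>m (j div m) * B) $$ (i, j mod m))"
  define u where "u = vec m (\<lambda>j. w $ j)"
  define w' where "w' = vec (k * m) (\<lambda>j. w $ (m + j))"
  have IH: "?K k *\<^sub>v w' \<in> reachable n m A B k" by (rule Suc.IH) (simp add: w'_def)
  note pow = pow_mat_Suc_left[OF A]
  have "?K (Suc k) *\<^sub>v w = step (?K k *\<^sub>v w') u"
  proof (rule eq_vecI)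
    fix i assume "i < dim_vec (step (?K k *\<^sub>v w') u)"
    then have i: "i < n" using B by (simp add: state_step_def)
    have m0: "j < m \<Longrightarrow> m \<noteq> 0" for j by simp
    have "(?K (Suc k) *\<^sub>v w) $ i = (\<Sum>j<m + k * m. (A ^\<^sub>m (j div m) * B) $$ (i, j mod m) * w $ j)"
      using i Suc.prems by (simp add: scalar_prod_def atLeast0LessThan)
    also have "\<dots> = (\<Sum>j<m. (A ^\<^sub>m (j div m) * B) $$ (i, j mod m) * w $ j)
        + (\<Sum>j<k * m. (A ^\<^sub>m ((m + j) div m) * B) $$ (i, (m + j) mod m) * w $ (m + j))"
      by (rule sum_lessThan_add)
    also have "(\<Sum>j<m. (A ^\<^sub>m (j div m) * B) $$ (i, j mod m) * w $ j) = (B *\<^sub>v u) $ i"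
      using i A B carrier_matD[OF B] by (simp add: scalar_prod_def atLeast0LessThan u_def carrier_matD[OF A])
    also have "(\<Sum>j<k * m. (A ^\<^sub>m ((m + j) div m) * B) $$ (i, (m + j) mod m) * w $ (m + j))
        = (\<Sum>j<k * m. \<Sum>a<n. A $$ (i, a) * ((A ^\<^sub>m (j div m) * B) $$ (a, j mod m) * w' $ j))"
    proof (rule sum.cong[OF refl])
      fix j assume "j \<in> {..<k * m}"
      then have j: "j < k * m" "0 < m" by (auto intro: Nat.gr0I)
      have "A ^\<^sub>m ((m + j) div m) * B = A * (A ^\<^sub>m (j div m) * B)"
        using j pow[of "j div m"] assoc_mult_mat[OF A pow_carrier_mat[OF A] B] by simp
      then show "(A ^\<^sub>m ((m + j) div m) * B) $$ (i, (m + j) mod m) * w $ (m + j)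
        = (\<Sum>a<n. A $$ (i, a) * ((A ^\<^sub>m (j div m) * B) $$ (a, j mod m) * w' $ j))"
        using i j A B carrier_matD[OF A] carrier_matD[OF B]
        by (simp add: scalar_prod_def atLeast0LessThan w'_def sum_distrib_right mult.assoc del: pow_mat.simps)
    qed
    also have "\<dots> = (\<Sum>a<n. A $$ (i, a) * (?K k *\<^sub>v w') $ a)"
      by (subst sum.swap, intro sum.cong refl)
         (simp add: scalar_prod_def atLeast0LessThan w'_def sum_distrib_left)
    also have "\<dots> = (A *\<^sub>v (?K k *\<^sub>v w')) $ i"
      using i carrier_matD[OF A] by (simp add: scalar_prod_def atLeast0LessThan)
    finally show "(?K (Suc k) *\<^sub>v w) $ i = step (?K k *\<^sub>v w') u $ i"
      using i carrier_matD[OF A] carrier_matD[OF B] by (simp add: state_step_def add.commute)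
  qed (use carrier_matD[OF B] in \<open>simp add: state_step_def\<close>)
  moreover have "u \<in> carrier_vec m" by (simp add: u_def)
  ultimately show ?case unfolding reachable.simps using IH by blast
qed

lemma controllable_reachable:
  assumes "controllable n m A B" "x \<in> carrier_vec n"
  shows "x \<in> reachable n m A B n"
proof -
  obtain w where "w \<in> carrier_vec (n * m)" "ctrb_mat n m A B *\<^sub>v w = x"
    using full_row_rank_surj[of "ctrb_mat n m A B" n "n * m" x] assms
    by (auto simp: controllable_def ctrb_mat_def)
  then show ?thesis using krylov_mat_reachable[of w n] by (auto simp: ctrb_mat_def)
qed

lemma observable_inj:
  assumes obs: "observable n m A C" and x: "x \<in> carrier_vec n"
    and 0: "\<And>k. C *\<^sub>v (A ^\<^sub>m k *\<^sub>v x) = 0\<^sub>v m"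
  shows "x = 0\<^sub>v n"
proof (rule full_column_rank_inj[of "obsv_mat n m A C" "n * m" n])
  show "obsv_mat n m A C *\<^sub>v x = 0\<^sub>v (n * m)"
  proof (rule eq_vecI)
    fix i assume "i < dim_vec (0\<^sub>v (n * m))"
    then have i: "i < n * m" and m: "0 < m" by (auto intro: Nat.gr0I)
    have "(obsv_mat n m A C *\<^sub>v x) $ i = ((C * A ^\<^sub>m (i div m)) *\<^sub>v x) $ (i mod m)"
      using i m x carrier_matD[OF A] carrier_matD[OF C] pow_carrier_mat[OF A]
      by (simp add: obsv_mat_def scalar_prod_def)
    also have "(C * A ^\<^sub>m (i div m)) *\<^sub>v x = C *\<^sub>v (A ^\<^sub>m (i div m) *\<^sub>v x)"
      by (rule assoc_mult_mat_vec[OF C pow_carrier_mat[OF A] x])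
    finally show "(obsv_mat n m A C *\<^sub>v x) $ i = 0\<^sub>v (n * m) $ i" using 0 i m by simp
  qed (simp add: obsv_mat_def)
qed (use obs x in \<open>auto simp: observable_def obsv_mat_def\<close>)

end

section \<open>Strict passivity with a margin\<close>

definition coords :: "complex vec \<Rightarrow> nat \<Rightarrow> complex"
  where "coords v = (\<lambda>i. if i < dim_vec v then v $ i else 0)"

lemma mat_vec_zero: "M \<in> carrier_mat p q \<Longrightarrow> M *\<^sub>v 0\<^sub>v q = 0\<^sub>v p" for M :: "'a :: semiring_0 mat"
  by (intro eq_vecI) auto

lemma vec_coords: "v \<in> carrier_vec k \<Longrightarrow> vec k (coords v) = v"
  by (intro eq_vecI) (auto simp: coords_def)

lemma coords_vec: "x \<in> supp k \<Longrightarrow> coords (vec k x) = x"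
  by (auto simp: coords_def supp_def fun_eq_iff)

lemma coords_supp: "v \<in> carrier_vec k \<Longrightarrow> coords v \<in> supp k"
  by (auto simp: coords_def supp_def)

lemma coords_zero: "coords (0\<^sub>v k) = 0"
  by (auto simp: coords_def fun_eq_iff)

lemma coords_add: "v \<in> carrier_vec k \<Longrightarrow> w \<in> carrier_vec k \<Longrightarrow> coords (v + w) = coords v + coords w"
  by (auto simp: coords_def fun_eq_iff)

lemma coords_smult: "coords (c \<cdot>\<^sub>v v) = c *\<^sub>f coords v"
  by (auto simp: coords_def fun_eq_iff)

lemma hform_mat: "hform d (\<lambda>a b. M $$ (a, b)) w = storage M (vec d w)" if "M \<in> carrier_mat d d"
  unfolding hform_def using that by (subst quad_form_sum[of M d]) auto

lemma hform_diff_diagonal: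
  "hform d (\<lambda>a b. H a b - (if a = b then complex_of_real e else 0)) w = hform d H w - e * (\<Sum>a<d. (cmod (w a))\<^sup>2)"
proof -
  have "(\<Sum>a<d. \<Sum>b<d. (H a b - (if a = b then complex_of_real e else 0)) * w b * cnj (w a))
      = (\<Sum>a<d. \<Sum>b<d. H a b * w b * cnj (w a)) - (\<Sum>a<d. complex_of_real e * (w a * cnj (w a)))"
    unfolding sum_subtractf[symmetric]
  proof (intro sum.cong refl)
    fix a assume "a \<in> {..<d}"
    then have "(\<Sum>b<d. H a b * w b * cnj (w a)) - complex_of_real e * (w a * cnj (w a))
      = (\<Sum>b<d. H a b * w b * cnj (w a) - (if a = b then complex_of_real e * (w a * cnj (w a)) else 0))"
      by (simp add: sum_subtractf)
    also have "\<dots> = (\<Sum>b<d. (H a b - (if a = b then complex_of_real e else 0)) * w b * cnj (w a))"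
      by (intro sum.cong refl) (auto simp: algebra_simps)
    finally show "(\<Sum>b<d. (H a b - (if a = b then complex_of_real e else 0)) * w b * cnj (w a))
      = (\<Sum>b<d. H a b * w b * cnj (w a)) - complex_of_real e * (w a * cnj (w a))" by simp
  qed
  also have "(\<Sum>a<d. complex_of_real e * (w a * cnj (w a))) = complex_of_real (e * (\<Sum>a<d. (cmod (w a))\<^sup>2))"
    by (simp add: sum_distrib_left complex_norm_square del: of_real_power)
  finally show ?thesis unfolding hform_def by simp
qed

context linear_system
begin

lemma step_add:
  assumes "x \<in> carrier_vec n" "x' \<in> carrier_vec n" "u \<in> carrier_vec m" "u' \<in> carrier_vec m"
  shows "step (x + x') (u + u') = step x u + step x' u'"
proof -
  have "step (x + x') (u + u') = (A *\<^sub>v x + A *\<^sub>v x') + (B *\<^sub>v u + B *\<^sub>v u')"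
    unfolding state_step_def using assms
    by (simp add: mult_add_distrib_mat_vec[OF A] mult_add_distrib_mat_vec[OF B])
  also have "\<dots> = step x u + step x' u'"
    unfolding state_step_def using assms mult_vec_carriers by (intro eq_vecI) (auto simp: carrier_matD[OF A] carrier_matD[OF B])
  finally show ?thesis .
qed

lemma step_smult:
  assumes "x \<in> carrier_vec n" "u \<in> carrier_vec m"
  shows "step (c \<cdot>\<^sub>v x) (c \<cdot>\<^sub>v u) = c \<cdot>\<^sub>v step x u"
  unfolding state_step_def using assms
  by (simp add: mult_mat_vec[OF A] mult_mat_vec[OF B] smult_add_distrib_vec[of _ n])

lemma supply_smult:
  assumes "x \<in> carrier_vec n" "u \<in> carrier_vec m"
  shows "supplied (c \<cdot>\<^sub>v x) (c \<cdot>\<^sub>v u) = (cmod c)\<^sup>2 * supplied x u"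
proof -
  have "C *\<^sub>v (c \<cdot>\<^sub>v x) + D *\<^sub>v (c \<cdot>\<^sub>v u) = c \<cdot>\<^sub>v (C *\<^sub>v x + D *\<^sub>v u)"
    using assms by (simp add: mult_mat_vec[OF C] mult_mat_vec[OF D] smult_add_distrib_vec[of _ m])
  moreover have "(c \<cdot>\<^sub>v (C *\<^sub>v x + D *\<^sub>v u)) \<bullet>c (c \<cdot>\<^sub>v u) = complex_of_real ((cmod c)\<^sup>2) * ((C *\<^sub>v x + D *\<^sub>v u) \<bullet>c u)"
    unfolding complex_norm_square using assms
    by (simp add: cprod_smult_left[of _ m] cprod_smult_right[of _ m])
  ultimately show ?thesis by (simp add: supply_rate_def del: of_real_power)
qed

lemma transfer_carrier:
  assumes "\<And>x. x \<in> carrier_vec n \<Longrightarrow> A *\<^sub>v x = z \<cdot>\<^sub>v x \<Longrightarrow> x = 0\<^sub>v n"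
  shows "transfer n (A, B, C, D) z \<in> carrier_mat m m"
  using resolvent_exists[OF A assms] D by (auto simp: transfer_def)

abbreviation "popov z \<equiv> mat_adjoint (transfer n (A, B, C, D) z) + transfer n (A, B, C, D) z"

text \<open>The state x = (z I - A)^-1 B u solves the step equation at frequency \<open>z\<close>,
  and its output is the transfer function applied to \<open>u\<close>.\<close>

lemma transfer_supply:
  assumes inj: "\<And>x. x \<in> carrier_vec n \<Longrightarrow> A *\<^sub>v x = z \<cdot>\<^sub>v x \<Longrightarrow> x = 0\<^sub>v n" and u: "u \<in> carrier_vec m"
  shows "\<exists>x\<in>carrier_vec n. step x u = z \<cdot>\<^sub>v x \<and>
    storage (popov z) u = supplied x u"
proof -
  let ?N = "z \<cdot>\<^sub>m 1\<^sub>m n - A" and ?T = "transfer n (A, B, C, D) z"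
  obtain G where G: "mat_inverse ?N = Some G" "G \<in> carrier_mat n n" "?N * G = 1\<^sub>m n"
    using resolvent_exists[OF A inj] by blast
  have N: "?N \<in> carrier_mat n n" by (rule minus_carrier_mat[OF A])
  define x where "x = G *\<^sub>v (B *\<^sub>v u)"
  have Bu: "B *\<^sub>v u \<in> carrier_vec n" using u by simp
  have x: "x \<in> carrier_vec n" unfolding x_def by (rule mult_mat_vec_carrier[OF G(2) Bu])
  have "?N *\<^sub>v x = ?N * G *\<^sub>v (B *\<^sub>v u)" unfolding x_def by (rule assoc_mult_mat_vec[OF N G(2) Bu, symmetric])
  then have "?N *\<^sub>v x = B *\<^sub>v u" using G Bu by simp
  moreover have "(z \<cdot>\<^sub>m 1\<^sub>m n) *\<^sub>v x = z \<cdot>\<^sub>v x" using x by (intro eq_vecI) auto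
  then have "?N *\<^sub>v x = z \<cdot>\<^sub>v x - A *\<^sub>v x"
    using x by (subst minus_mult_distrib_mat_vec[of _ n n]) auto
  ultimately have Bu_eq: "B *\<^sub>v u = z \<cdot>\<^sub>v x - A *\<^sub>v x" by simp
  then have step: "step x u = z \<cdot>\<^sub>v x"
    unfolding state_step_def Bu_eq using x carrier_matD[OF A] by (intro eq_vecI) auto
  have T: "?T \<in> carrier_mat m m" by (rule transfer_carrier[OF inj])
  have "?T *\<^sub>v u = C * G * B *\<^sub>v u + D *\<^sub>v u"
    using G u mult_carrier_mat[OF mult_carrier_mat[OF C G(2)] B] by (simp add: transfer_def add_mult_distrib_mat_vec[of _ m m])
  also have "C * G * B *\<^sub>v u = C *\<^sub>v x"
    unfolding x_def using assoc_mult_mat_vec[OF mult_carrier_mat[OF C G(2)] B u] assoc_mult_mat_vec[OF C G(2) Bu] by simp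
  finally have Tu: "?T *\<^sub>v u = C *\<^sub>v x + D *\<^sub>v u" .
  have Tc: "?T *\<^sub>v u \<in> carrier_vec m" "mat_adjoint ?T *\<^sub>v u \<in> carrier_vec m"
    using mult_mat_vec_carrier[OF T u] mult_mat_vec_carrier[OF mat_adjoint_carrier[OF T] u] by auto
  have "quad_form (mat_adjoint ?T + ?T) u = (mat_adjoint ?T *\<^sub>v u) \<bullet>c u + (?T *\<^sub>v u) \<bullet>c u"
    unfolding quad_form_def using T u Tc
    by (simp add: add_mult_distrib_mat_vec[OF mat_adjoint_carrier[OF T] T] cprod_add_left[of _ m])
  moreover have "(mat_adjoint ?T *\<^sub>v u) \<bullet>c u = cnj ((?T *\<^sub>v u) \<bullet>c u)"
    using cprod_adjoint[OF T u u] cprod_swap[OF u Tc(1)] by simp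
  ultimately have "storage (mat_adjoint ?T + ?T) u = supplied x u"
    unfolding supply_rate_def Tu by simp
  then show ?thesis using x step by blast
qed

text \<open>A description free of inverses: passing to limits and testing against a storage function
  act directly on triples \<open>(z, x, u)\<close>.\<close>

lemma is_strictly_passive_iff:
  "is_strictly_passive n m (A, B, C, D) \<longleftrightarrow>
    (\<forall>z. \<forall>x\<in>carrier_vec n. 1 \<le> cmod z \<longrightarrow> A *\<^sub>v x = z \<cdot>\<^sub>v x \<longrightarrow> x = 0\<^sub>v n) \<and>
    (\<forall>z. \<forall>x\<in>carrier_vec n. \<forall>u\<in>carrier_vec m. cmod z = 1 \<longrightarrow> step x u = z \<cdot>\<^sub>v x \<longrightarrow>
       u \<noteq> 0\<^sub>v m \<longrightarrow> 0 < supplied x u)" (is "?l \<longleftrightarrow> ?stable \<and> ?pos")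
proof
  assume l: ?l
  have stable: ?stable
  proof (intro allI ballI impI)
    fix z x assume x: "x \<in> carrier_vec n" "1 \<le> cmod z" "A *\<^sub>v x = z \<cdot>\<^sub>v x"
    show "x = 0\<^sub>v n"
    proof (rule ccontr)
      assume "x \<noteq> 0\<^sub>v n"
      then have "eigenvalue A z" unfolding eigenvalue_def eigenvector_def using x carrier_matD[OF A] by auto
      then show False using l x by (auto simp: is_strictly_passive_def)
    qed
  qed
  moreover have ?pos
  proof (intro allI ballI impI)
    fix z x u assume z: "cmod z = 1" and x: "x \<in> carrier_vec n" and u: "u \<in> carrier_vec m" "u \<noteq> 0\<^sub>v m"
      and step: "step x u = z \<cdot>\<^sub>v x"
    have zc: "z = cis (Arg z)" using z cis_Arg[of z] by (cases "z = 0") (auto simp: sgn_div_norm)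
    have inj: "x = 0\<^sub>v n" if "x \<in> carrier_vec n" "A *\<^sub>v x = z \<cdot>\<^sub>v x" for x using stable z that by (metis order.refl)
    obtain x' where x': "x' \<in> carrier_vec n" "step x' u = z \<cdot>\<^sub>v x'"
      "storage (popov z) u = supplied x' u"
      using transfer_supply[of z u, OF inj u(1)] by blast
    \<comment> \<open>Two states answering the same input at \<open>z\<close> differ by a solution
      of A v = z v, so the given \<open>x\<close> is the one that the resolvent produces.\<close>
    have "x - x' = 0\<^sub>v n"
    proof (rule inj)
      have "A *\<^sub>v (x - x') = A *\<^sub>v x - A *\<^sub>v x'" using x x' by (intro mult_minus_distrib_mat_vec[OF A])
      also have "\<dots> = z \<cdot>\<^sub>v x - z \<cdot>\<^sub>v x'"
        unfolding step[symmetric] x'(2)[symmetric] state_step_def using x x' u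
        by (intro eq_vecI) (auto simp: carrier_matD[OF A] carrier_matD[OF B])
      also have "\<dots> = z \<cdot>\<^sub>v (x - x')" using x x' by (intro eq_vecI) (auto simp: right_diff_distrib)
      finally show "A *\<^sub>v (x - x') = z \<cdot>\<^sub>v (x - x')" .
    qed (use x x' in simp)
    then have xx: "x = x'" using x x'
      by (intro eq_vecI) (auto dest!: arg_cong[where f = "\<lambda>v. v $ i" for i] simp: vec_eq_iff)
    have "pd m (popov z)"
      using l Arg_bounded[of z] by (subst (1 2) zc) (auto simp: is_strictly_passive_def)
    then have "0 < storage (popov z) u"
      using u unfolding pd_def by blast
    then show "0 < supplied x u" unfolding xx x'(3) .
  qed
  ultimately show "?stable \<and> ?pos" by blast
next
  assume r: "?stable \<and> ?pos"
  have "pd m (popov z)" if z: "cmod z = 1" for z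
  proof -
    have inj: "x = 0\<^sub>v n" if "x \<in> carrier_vec n" "A *\<^sub>v x = z \<cdot>\<^sub>v x" for x using r z that by (metis order.refl)
    show ?thesis unfolding pd_def
    proof (intro conjI ballI impI)
      show "hermitian m (popov z)"
        by (rule hermitian_add_adjoint[OF transfer_carrier[OF inj]])
      fix u :: "complex vec" assume u: "u \<in> carrier_vec m" "u \<noteq> 0\<^sub>v m"
      show "0 < storage (popov z) u"
      proof -
        obtain x where x: "x \<in> carrier_vec n" "step x u = z \<cdot>\<^sub>v x"
          "storage (popov z) u = supplied x u"
          using transfer_supply[of z u, OF inj u(1)] by blast
        then have "0 < supplied x u" using r z u by blast
        then show ?thesis unfolding x(3) .
      qed
    qed
  qed
  moreover have "cmod l < 1" if ev: "eigenvalue A l" for l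
  proof -
    obtain v where "v \<in> carrier_vec n" "v \<noteq> 0\<^sub>v n" "A *\<^sub>v v = l \<cdot>\<^sub>v v"
      using ev carrier_matD[OF A] by (auto simp: eigenvalue_def eigenvector_def)
    then show ?thesis using r by (meson not_le)
  qed
  ultimately show ?l by (simp add: is_strictly_passive_def)
qed

text \<open>Compactness of the unit sphere and the unit circle. Normalized violations for margins
  1/(k + 1) subconverge to a pair of norm 1 with supplied energy at most 0; \<open>pos\<close>
  forces its input to be 0, then the state solves A x = z x and \<open>stable\<close> makes it 0 as
  well.\<close>

lemma strict_margin:
  assumes stable: "\<And>z x. cmod z = 1 \<Longrightarrow> x \<in> carrier_vec n \<Longrightarrow> A *\<^sub>v x = z \<cdot>\<^sub>v x \<Longrightarrow> x = 0\<^sub>v n"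
    and pos: "\<And>z x u. cmod z = 1 \<Longrightarrow> x \<in> carrier_vec n \<Longrightarrow> u \<in> carrier_vec m \<Longrightarrow> step x u = z \<cdot>\<^sub>v x
       \<Longrightarrow> u \<noteq> 0\<^sub>v m \<Longrightarrow> 0 < supplied x u"
  shows "\<exists>\<epsilon>>0. \<forall>z. \<forall>x\<in>carrier_vec n. \<forall>u\<in>carrier_vec m. cmod z = 1 \<longrightarrow> step x u = z \<cdot>\<^sub>v x \<longrightarrow>
     \<epsilon> * (Re (x \<bullet>c x) + Re (u \<bullet>c u)) \<le> supplied x u"
proof (rule ccontr)
  define bad where "bad e z x u \<longleftrightarrow> x \<in> carrier_vec n \<and> u \<in> carrier_vec m \<and> cmod z = 1 \<and> step x u = z \<cdot>\<^sub>v x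
     \<and> supplied x u < e * (Re (x \<bullet>c x) + Re (u \<bullet>c u))" for e z x u
  assume "\<not> ?thesis"
  then have ex: "\<exists>z x u. bad e z x u" if "e > 0" for e :: real using that unfolding bad_def not_ex not_all by (meson not_le)
  have ex1: "\<exists>z x u. bad e z x u \<and> Re (x \<bullet>c x) + Re (u \<bullet>c u) = 1" if e: "e > 0" for e :: real
  proof -
    obtain z x u where b: "bad e z x u" using ex[OF e] by blast
    then have c: "x \<in> carrier_vec n" "u \<in> carrier_vec m" by (auto simp: bad_def)
    define N where "N = Re (x \<bullet>c x) + Re (u \<bullet>c u)"
    \<comment> \<open>The violation is strict, so the zero pair, where both sides are 0, is never
      one.\<close>
    have "N \<noteq> 0"
    proof
      assume "N = 0"
      then have "Re (x \<bullet>c x) = 0" "Re (u \<bullet>c u) = 0"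
        using cprod_self_nonneg[of x] cprod_self_nonneg[of u] by (auto simp: N_def)
      then have "u = 0\<^sub>v m" using cprod_self_pos[OF c(2)] by force
      then have "supplied x u = 0" using c by (simp add: supply_rate_def)
      then show False using b \<open>N = 0\<close> by (simp add: bad_def N_def)
    qed
    then have N: "N > 0" using cprod_self_nonneg[of x] cprod_self_nonneg[of u] by (simp add: N_def)
    define c where "c = complex_of_real (1 / sqrt N)"
    have cn: "cmod c = 1 / sqrt N" using N unfolding c_def norm_of_real by simp
    then have c2: "(cmod c)\<^sup>2 = 1 / N" using N by (simp add: power_divide)
    have sq: "Re ((c \<cdot>\<^sub>v v) \<bullet>c (c \<cdot>\<^sub>v v)) = (cmod c)\<^sup>2 * Re (v \<bullet>c v)" for v :: "complex vec"
    proof -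
      have "(c \<cdot>\<^sub>v v) \<bullet>c (c \<cdot>\<^sub>v v) = complex_of_real ((cmod c)\<^sup>2) * (v \<bullet>c v)"
        unfolding complex_norm_square
        by (simp add: cprod_smult_left[of _ "dim_vec v"] cprod_smult_right[of _ "dim_vec v"])
      then show ?thesis by (simp del: of_real_power)
    qed
    have n1: "Re ((c \<cdot>\<^sub>v x) \<bullet>c (c \<cdot>\<^sub>v x)) + Re ((c \<cdot>\<^sub>v u) \<bullet>c (c \<cdot>\<^sub>v u)) = 1"
      unfolding sq c2 distrib_left[symmetric] N_def[symmetric] using N by simp
    have "bad e z (c \<cdot>\<^sub>v x) (c \<cdot>\<^sub>v u)"
    proof -
      have "supplied (c \<cdot>\<^sub>v x) (c \<cdot>\<^sub>v u) = supplied x u / N"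
        using c2 \<open>x \<in> carrier_vec n\<close> \<open>u \<in> carrier_vec m\<close> by (simp add: supply_smult)
      also have "\<dots> < e" using b N by (simp add: bad_def N_def divide_less_eq)
      finally have s: "supplied (c \<cdot>\<^sub>v x) (c \<cdot>\<^sub>v u) < e * 1" by simp
      have "step (c \<cdot>\<^sub>v x) (c \<cdot>\<^sub>v u) = c \<cdot>\<^sub>v (z \<cdot>\<^sub>v x)"
        using b by (simp add: step_smult bad_def)
      then have "step (c \<cdot>\<^sub>v x) (c \<cdot>\<^sub>v u) = z \<cdot>\<^sub>v (c \<cdot>\<^sub>v x)" by (simp add: smult_smult_assoc mult.commute)
      then show ?thesis using b s unfolding bad_def n1 by simp
    qed
    then show ?thesis using n1 by blast
  qed
  have "\<forall>k. \<exists>z x u. bad (1 / real (Suc k)) z x u \<and> Re (x \<bullet>c x) + Re (u \<bullet>c u) = 1"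
    using ex1 by simp
  then obtain zs xs us where seq: "\<And>k. bad (1 / real (Suc k)) (zs k) (xs k) (us k)"
    "\<And>k. Re (xs k \<bullet>c xs k) + Re (us k \<bullet>c us k) = 1" by metis
  then have xs: "xs k \<in> carrier_vec n" and us: "us k \<in> carrier_vec m" for k by (auto simp: bad_def)
  have norms: "Re (xs k \<bullet>c xs k) = (\<Sum>i<n. (cmod (xs k $ i))\<^sup>2)" "Re (us k \<bullet>c us k) = (\<Sum>i<m. (cmod (us k $ i))\<^sup>2)" for k
    using xs[of k] us[of k] unfolding cprod_self Re_complex_of_real by auto
  \<comment> \<open>State, input and frequency become one family of coordinates, with the frequency
    at index \<open>n + m\<close>.\<close>
  define g where "g k a = (if a < n then xs k $ a else if a < n + m then us k $ (a - n) else zs k)" for k a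
  have "\<exists>r :: nat \<Rightarrow> nat. strict_mono r \<and> (\<forall>a\<in>{..n + m}. convergent (\<lambda>k. g (r k) a))"
  proof (rule bounded_coordinates_convergent_subseq)
    fix a
    have le: "t \<le> 1" if "t\<^sup>2 \<le> S" "S + S' = 1" "0 \<le> S'" for t S S' :: real
      by (rule power2_le_imp_le) (use that in simp_all)
    have "cmod (g k a) \<le> 1" for k
    proof -
      consider "a < n" | "\<not> a < n" "a < n + m" | "\<not> a < n + m" by blast
      then show ?thesis
      proof cases
        case 1
        then have "(cmod (xs k $ a))\<^sup>2 \<le> (\<Sum>i<n. (cmod (xs k $ i))\<^sup>2)" by (intro member_le_sum) auto
        then show ?thesis using le[OF _ seq(2)[of k, unfolded norms]] 1 by (simp add: g_def sum_nonneg)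
      next
        case 2
        then have "(cmod (us k $ (a - n)))\<^sup>2 \<le> (\<Sum>i<m. (cmod (us k $ i))\<^sup>2)" by (intro member_le_sum) auto
        then show ?thesis using le[OF _ trans[OF add.commute seq(2)[of k, unfolded norms]]] 2 by (simp add: g_def sum_nonneg)
      next
        case 3
        then show ?thesis using seq(1)[of k] by (simp add: g_def bad_def)
      qed
    qed
    then show "\<exists>K. \<forall>k. cmod (g k a) \<le> K" by blast
  qed simp
  then obtain r :: "nat \<Rightarrow> nat" where r: "strict_mono r" "\<And>a. a \<le> n + m \<Longrightarrow> convergent (\<lambda>k. g (r k) a)" by auto
  define l where "l a = lim (\<lambda>k. g (r k) a)" for a
  have lim: "(\<lambda>k. g (r k) a) \<longlonglongrightarrow> l a" if "a \<le> n + m" for a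
    using r(2)[OF that] by (simp add: l_def convergent_LIMSEQ_iff)
  define x u z where "x = vec n l" and "u = vec m (\<lambda>i. l (n + i))" and "z = l (n + m)"
  have x: "x \<in> carrier_vec n" and u: "u \<in> carrier_vec m" by (auto simp: x_def u_def)
  have lx: "(\<lambda>k. xs (r k) $ i) \<longlonglongrightarrow> x $ i" if "i < n" for i using lim[of i] that by (simp add: g_def x_def)
  have lu: "(\<lambda>k. us (r k) $ i) \<longlonglongrightarrow> u $ i" if "i < m" for i using lim[of "n + i"] that by (simp add: g_def u_def)
  have lz: "(\<lambda>k. zs (r k)) \<longlonglongrightarrow> z" using lim[of "n + m"] by (simp add: g_def z_def)
  have "(\<lambda>k. cmod (zs (r k))) \<longlonglongrightarrow> cmod z" by (intro tendsto_norm lz)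
  then have cz: "cmod z = 1" using seq(1) by (simp add: bad_def LIMSEQ_const_iff)
  have row: "(\<lambda>k. (M *\<^sub>v ys k) $ i) \<longlonglongrightarrow> (M *\<^sub>v y) $ i"
    if "M \<in> carrier_mat p q" "i < p" "\<And>k. ys k \<in> carrier_vec q" "y \<in> carrier_vec q"
      "\<And>j. j < q \<Longrightarrow> (\<lambda>k. ys k $ j) \<longlonglongrightarrow> y $ j" for M :: "complex mat" and p q ys y i
  proof -
    have e: "(M *\<^sub>v v) $ i = (\<Sum>j<q. M $$ (i, j) * v $ j)" if "v \<in> carrier_vec q" for v
      using that \<open>M \<in> carrier_mat p q\<close> \<open>i < p\<close> by (auto simp: scalar_prod_def atLeast0LessThan intro!: sum.cong)
    show ?thesis unfolding e[OF that(3)] e[OF that(4)] using that(5) by (intro tendsto_intros) auto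
  qed
  have step: "step x u = z \<cdot>\<^sub>v x"
  proof (rule eq_vecI)
    fix i assume "i < dim_vec (z \<cdot>\<^sub>v x)"
    then have i: "i < n" by (simp add: x_def)
    have "(\<lambda>k. (A *\<^sub>v xs (r k)) $ i + (B *\<^sub>v us (r k)) $ i) \<longlonglongrightarrow> (A *\<^sub>v x) $ i + (B *\<^sub>v u) $ i"
      by (intro tendsto_add row[OF A i] row[OF B i] xs us x u lx lu)
    moreover have "(A *\<^sub>v xs (r k)) $ i + (B *\<^sub>v us (r k)) $ i = zs (r k) * xs (r k) $ i" for k
    proof -
      have "step (xs (r k)) (us (r k)) $ i = (zs (r k) \<cdot>\<^sub>v xs (r k)) $ i"
        using seq(1)[of "r k"] by (simp add: bad_def)
      then show ?thesis using i xs[of "r k"] us[of "r k"] carrier_matD[OF A] carrier_matD[OF B] by (simp add: state_step_def)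
    qed
    ultimately have "(\<lambda>k. zs (r k) * xs (r k) $ i) \<longlonglongrightarrow> (A *\<^sub>v x) $ i + (B *\<^sub>v u) $ i" by simp
    moreover have "(\<lambda>k. zs (r k) * xs (r k) $ i) \<longlonglongrightarrow> z * x $ i" by (intro tendsto_mult lz lx i)
    ultimately have "(A *\<^sub>v x) $ i + (B *\<^sub>v u) $ i = z * x $ i" by (rule LIMSEQ_unique)
    then show "step x u $ i = (z \<cdot>\<^sub>v x) $ i"
      using i x u carrier_matD[OF A] carrier_matD[OF B] by (simp add: state_step_def)
  qed (simp add: state_step_def x_def carrier_matD[OF B])
  have sup: "supplied v w = 2 * Re (\<Sum>i<m. ((C *\<^sub>v v) $ i + (D *\<^sub>v w) $ i) * cnj (w $ i))"
    if "v \<in> carrier_vec n" "w \<in> carrier_vec m" for v w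
    using that carrier_matD[OF C] carrier_matD[OF D]
    unfolding supply_rate_def scalar_prod_def by (auto simp: atLeast0LessThan simp del: index_mult_mat_vec)
  have "(\<lambda>k. supplied (xs (r k)) (us (r k))) \<longlonglongrightarrow> supplied x u"
    unfolding sup[OF xs us] sup[OF x u]
    by (intro tendsto_intros row[OF C] row[OF D] xs us x u lx lu) auto
  moreover have "(\<lambda>k. 1 / real (Suc (r k))) \<longlonglongrightarrow> 0"
    using LIMSEQ_subseq_LIMSEQ[OF LIMSEQ_Suc[OF lim_1_over_n] r(1)] by (simp add: o_def)
  moreover have "supplied (xs (r k)) (us (r k)) \<le> 1 / real (Suc (r k))" for k
    using seq[of "r k"] by (simp add: bad_def)
  ultimately have neg: "supplied x u \<le> 0" by (intro LIMSEQ_le) auto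
  then have u0: "u = 0\<^sub>v m" using pos[OF cz x u step] by force
  then have "A *\<^sub>v x = z \<cdot>\<^sub>v x" using step x mult_vec_carriers(1)[OF x] carrier_matD[OF B]
    by (simp add: state_step_def mat_vec_zero[OF B])
  then have x0: "x = 0\<^sub>v n" by (rule stable[OF cz x])
  have "(\<lambda>k. (\<Sum>i<n. (cmod (xs (r k) $ i))\<^sup>2) + (\<Sum>i<m. (cmod (us (r k) $ i))\<^sup>2)) 
     \<longlonglongrightarrow> (\<Sum>i<n. (cmod (x $ i))\<^sup>2) + (\<Sum>i<m. (cmod (u $ i))\<^sup>2)"
    by (intro tendsto_intros lx lu) auto
  then have "(\<Sum>i<n. (cmod (x $ i))\<^sup>2) + (\<Sum>i<m. (cmod (u $ i))\<^sup>2) = 1"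
    using seq(2) unfolding norms by (simp add: LIMSEQ_const_iff)
  then show False using x0 u0 by simp
qed

end

section \<open>The strict KYP lemma\<close>

context linear_system
begin

theorem strict_kyp:
  assumes ctrb: "\<And>x. x \<in> carrier_vec n \<Longrightarrow> x \<in> reachable n m A B n"
    and stable: "\<And>z x. cmod z = 1 \<Longrightarrow> x \<in> carrier_vec n \<Longrightarrow> A *\<^sub>v x = z \<cdot>\<^sub>v x \<Longrightarrow> x = 0\<^sub>v n"
    and pos: "\<And>z x u. cmod z = 1 \<Longrightarrow> x \<in> carrier_vec n \<Longrightarrow> u \<in> carrier_vec m \<Longrightarrow> step x u = z \<cdot>\<^sub>v x
       \<Longrightarrow> u \<noteq> 0\<^sub>v m \<Longrightarrow> 0 < supplied x u"
  shows "\<exists>X \<epsilon>. hermitian n X \<and> 0 < \<epsilon> \<and> (\<forall>x\<in>carrier_vec n. \<forall>u\<in>carrier_vec m.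
     storage X (step x u) + \<epsilon> * (Re (x \<bullet>c x) + Re (u \<bullet>c u)) \<le> storage X x + supplied x u)"
proof -
  obtain \<epsilon> where e: "\<epsilon> > 0" and margin: "\<And>z x u. x \<in> carrier_vec n \<Longrightarrow> u \<in> carrier_vec m \<Longrightarrow> cmod z = 1 \<Longrightarrow>
      step x u = z \<cdot>\<^sub>v x \<Longrightarrow> \<epsilon> * (Re (x \<bullet>c x) + Re (u \<bullet>c u)) \<le> supplied x u"
  proof -
    have "\<exists>\<epsilon>>0. \<forall>z. \<forall>x\<in>carrier_vec n. \<forall>u\<in>carrier_vec m. cmod z = 1 \<longrightarrow> step x u = z \<cdot>\<^sub>v x \<longrightarrow>
       \<epsilon> * (Re (x \<bullet>c x) + Re (u \<bullet>c u)) \<le> supplied x u"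
      by (rule strict_margin) (fact stable, fact pos)
    then show ?thesis using that by blast
  qed
  \<comment> \<open>The abstract system lives on \<open>n + m\<close> coordinates: the first
    \<open>n\<close> are the state, the others the input.\<close>
  define st where "st w = vec n w" for w :: "nat \<Rightarrow> complex"
  define inp where "inp w = vec m (\<lambda>i. w (n + i))" for w :: "nat \<Rightarrow> complex"
  have stc [simp]: "st w \<in> carrier_vec n" and inpc [simp]: "inp w \<in> carrier_vec m" for w
    by (simp_all add: st_def inp_def)
  have st_add: "st (v + w) = st v + st w" and inp_add: "inp (v + w) = inp v + inp w"
    and st_sc: "st (c *\<^sub>f w) = c \<cdot>\<^sub>v st w" and inp_sc: "inp (c *\<^sub>f w) = c \<cdot>\<^sub>v inp w" for v w c
    by (auto simp: st_def inp_def intro!: eq_vecI)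
  define p where "p w = coords (st w)" for w
  define f where "f w = coords (step (st w) (inp w))" for w
  \<comment> \<open>The zero upper left block makes this the form 2 Re <C x + D u, u>.
    \<open>H\<close> lowers it by \<epsilon> on the diagonal, so that \<open>freq\<close> becomes
    the margin inequality and the storage inequality inherits the margin.\<close>
  define S where "S = four_block_mat (0\<^sub>m n n) (mat_adjoint C) C (mat_adjoint D + D)"
  define H where "H a b = S $$ (a, b) - (if a = b then complex_of_real \<epsilon> else 0)" for a b
  have Sc: "S \<in> carrier_mat (n + m) (n + m)" unfolding S_def by simp
  have joined: "vec (n + m) w = st w @\<^sub>v inp w" for w
    by (intro eq_vecI) (auto simp: st_def inp_def)
  have H: "hform (n + m) H w = supplied (st w) (inp w)
      - \<epsilon> * (Re (st w \<bullet>c st w) + Re (inp w \<bullet>c inp w))" for w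
  proof -
    let ?x = "st w" and ?u = "inp w"
    have "hform (n + m) H w = storage S (vec (n + m) w) - \<epsilon> * (\<Sum>a<n + m. (cmod (w a))\<^sup>2)"
      unfolding H_def hform_diff_diagonal hform_mat[OF Sc] ..
    also have "(\<Sum>a<n + m. (cmod (w a))\<^sup>2) = Re (?x \<bullet>c ?x) + Re (?u \<bullet>c ?u)"
      unfolding sum_lessThan_add cprod_self Re_complex_of_real by (simp add: st_def inp_def)
    also have "quad_form S (vec (n + m) w) = quad_form (0\<^sub>m n n) ?x + (mat_adjoint C *\<^sub>v ?u) \<bullet>c ?x
        + (C *\<^sub>v ?x) \<bullet>c ?u + quad_form (mat_adjoint D + D) ?u"
      unfolding joined S_def by (intro quad_form_four_block[of _ n _ m]) auto
    also have "quad_form (0\<^sub>m n n) ?x = 0"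
    proof -
      have "0\<^sub>m n n *\<^sub>v ?x = 0\<^sub>v n" by (intro eq_vecI) (auto simp: st_def)
      then show ?thesis by (simp add: quad_form_def scalar_prod_left_zero[of _ n])
    qed
    also have "quad_form (mat_adjoint D + D) ?u = (mat_adjoint D *\<^sub>v ?u) \<bullet>c ?u + (D *\<^sub>v ?u) \<bullet>c ?u"
      unfolding quad_form_def by (simp add: add_mult_distrib_mat_vec[of _ m m] cprod_add_left[of _ m])
    finally have "hform (n + m) H w = Re ((mat_adjoint C *\<^sub>v ?u) \<bullet>c ?x) + Re ((C *\<^sub>v ?x) \<bullet>c ?u)
        + Re ((mat_adjoint D *\<^sub>v ?u) \<bullet>c ?u) + Re ((D *\<^sub>v ?u) \<bullet>c ?u) - \<epsilon> * (Re (?x \<bullet>c ?x) + Re (?u \<bullet>c ?u))"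
      by simp
    moreover have "Re ((mat_adjoint C *\<^sub>v ?u) \<bullet>c ?x) = Re ((C *\<^sub>v ?x) \<bullet>c ?u)"
      using cprod_swap[of ?u m "C *\<^sub>v ?x"] by (simp add: cprod_adjoint[of C m n])
    moreover have "Re ((mat_adjoint D *\<^sub>v ?u) \<bullet>c ?u) = Re ((D *\<^sub>v ?u) \<bullet>c ?u)"
      using cprod_swap[of ?u m "D *\<^sub>v ?u"] by (simp add: cprod_adjoint[of D m m])
    moreover have "supplied ?x ?u = 2 * Re ((C *\<^sub>v ?x) \<bullet>c ?u) + 2 * Re ((D *\<^sub>v ?u) \<bullet>c ?u)"
      by (simp add: supply_rate_def cprod_add_left[of _ m])
    ultimately show ?thesis by simp
  qed
  have st_coords: "st (coords (x @\<^sub>v u)) = x" "inp (coords (x @\<^sub>v u)) = u"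
    if "x \<in> carrier_vec n" "u \<in> carrier_vec m" for x u
    using that by (auto simp: st_def inp_def coords_def intro!: eq_vecI)
  have inj: "x = y" if "coords x = coords y" "x \<in> carrier_vec n" "y \<in> carrier_vec n" for x y
    using that by (metis vec_coords)
  \<comment> \<open>Each step of \<open>reachable\<close> is pushed in front at index 0, so the
    inductive construction of a state yields a path in reversed time.\<close>
  have path: "\<exists>w. (\<forall>k. p (w k) = f (w (Suc k))) \<and> (\<forall>k\<ge>K. w k = 0) \<and> f (w 0) = coords x"
    if "x \<in> reachable n m A B K" for K x
    using that
  proof (induction K arbitrary: x)
    case 0
    have "st 0 = 0\<^sub>v n" "inp 0 = 0\<^sub>v m" by (auto simp: st_def inp_def)
    then have "f 0 = 0" "p 0 = 0"
      by (simp_all add: f_def p_def state_step_def mat_vec_zero[OF A] mat_vec_zero[OF B] coords_zero)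
    then show ?case using 0 by (intro exI[of _ "\<lambda>_. 0"]) (auto simp: coords_zero zero_fun_def)
  next
    case (Suc K)
    then obtain x' u where x': "x' \<in> reachable n m A B K" "u \<in> carrier_vec m" "x = step x' u" by auto
    obtain w where w: "\<And>k. p (w k) = f (w (Suc k))" "\<And>k. k \<ge> K \<Longrightarrow> w k = 0" "f (w 0) = coords x'"
      using Suc.IH[OF x'(1)] by blast
    let ?w = "case_nat (coords (x' @\<^sub>v u)) w"
    have xc: "x' \<in> carrier_vec n" by (rule reachable_carrier[OF x'(1)])
    show ?case
    proof (intro exI[of _ ?w] conjI allI impI)
      fix k show "p (?w k) = f (?w (Suc k))"
        using w st_coords[OF xc x'(2)] by (cases k) (auto simp: p_def)
    next
      fix k assume "Suc K \<le> k"
      then show "?w k = 0" using w by (cases k) auto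
    next
      show "f (?w 0) = coords x" using st_coords[OF xc x'(2)] x' by (simp add: f_def)
    qed
  qed
  interpret dissipative_system n "n + m" p f H n
  proof
    show "p (v + w) = p v + p w" for v w by (simp add: p_def st_add coords_add[of _ n])
    show "p (c *\<^sub>f w) = c *\<^sub>f p w" for c w by (simp add: p_def st_sc coords_smult)
    show "f (v + w) = f v + f w" for v w by (simp add: f_def st_add inp_add step_add coords_add[of _ n])
    show "f (c *\<^sub>f w) = c *\<^sub>f f w" for c w by (simp add: f_def st_sc inp_sc step_smult coords_smult)
    show "p w \<in> supp n" "f w \<in> supp n" for w unfolding p_def f_def by (intro coords_supp; simp)+
    show "\<exists>w. p w = x" if "x \<in> supp n" for x
      using that by (intro exI[of _ x]) (simp add: p_def st_def coords_vec)
    show "0 \<le> hform (n + m) H w" if z: "cmod z = 1" and fw: "f w = z *\<^sub>f p w" for z w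
    proof -
      have "step (st w) (inp w) = z \<cdot>\<^sub>v st w"
        using fw unfolding f_def p_def coords_smult[symmetric] by (rule inj) auto
      from margin[OF _ _ z this] show ?thesis unfolding H by simp
    qed
    show "\<exists>w. (\<forall>k. p (w k) = f (w (Suc k))) \<and> (\<forall>k\<ge>n. w k = 0) \<and> f (w 0) = x" if x: "x \<in> supp n" for x
      using path[OF ctrb[of "vec n x"]] coords_vec[OF x] by simp
  qed
  obtain Y where Y: "\<And>i j. Y j i = cnj (Y i j)" "\<And>w. hform n Y (f w) \<le> hform n Y (p w) + hform (n + m) H w"
    using storage_exists by blast
  define X where "X = mat n n (\<lambda>(i, j). Y i j)"
  have "hermitian n X" by (rule hermitianI) (simp_all add: X_def Y(1)[symmetric])
  moreover have YX: "hform n Y (coords x) = storage X x" if "x \<in> carrier_vec n" for x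
  proof -
    have "hform n Y (coords x) = hform n (\<lambda>a b. X $$ (a, b)) (coords x)" by (simp add: hform_def X_def)
    moreover have "X \<in> carrier_mat n n" by (simp add: X_def)
    ultimately show ?thesis using that by (simp add: hform_mat vec_coords)
  qed
  have "storage X (step x u) + \<epsilon> * (Re (x \<bullet>c x) + Re (u \<bullet>c u)) \<le> storage X x + supplied x u"
    if "x \<in> carrier_vec n" "u \<in> carrier_vec m" for x u
    using Y(2)[of "coords (x @\<^sub>v u)"] that YX[of x] YX[of "step x u"]
    unfolding H f_def p_def st_coords[OF that] by simp
  ultimately show ?thesis using e by blast
qed

text \<open>Summing the decrease along A^k x bounds the sum of the squared norms, because the
  storages stay bounded. So A^k x and with it V(A^k x) tend to 0. The first term of the sum is the
  lower bound for V(x), without any prior knowledge of the sign of \<open>X\<close>.\<close>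

lemma storage_pos:
  assumes X: "hermitian n X" and e: "0 < \<epsilon>" and bounded: "\<exists>c. \<forall>k. norm_bound (A ^\<^sub>m k) c"
    and decr: "\<And>x. x \<in> carrier_vec n \<Longrightarrow> storage X (A *\<^sub>v x) + \<epsilon> * Re (x \<bullet>c x) \<le> storage X x"
    and x: "x \<in> carrier_vec n"
  shows "\<epsilon> * Re (x \<bullet>c x) \<le> storage X x"
proof -
  obtain c where c: "\<And>k. norm_bound (A ^\<^sub>m k) c" using bounded by blast
  define y where "y k = A ^\<^sub>m k *\<^sub>v x" for k
  have y: "y k \<in> carrier_vec n" for k unfolding y_def by (rule mult_mat_vec_carrier[OF pow_carrier_mat[OF A] x])
  have y0: "y 0 = x" using x by (simp add: y_def carrier_matD[OF A])
  have yS: "y (Suc k) = A *\<^sub>v y k" for k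
    unfolding y_def pow_mat_Suc_left[OF A] by (rule assoc_mult_mat_vec[OF A pow_carrier_mat[OF A] x])
  have entry: "cmod (y k $ i) \<le> (\<Sum>j<n. c * cmod (x $ j))" if "i < n" for k i
  proof -
    have "y k $ i = (\<Sum>j<n. (A ^\<^sub>m k) $$ (i, j) * x $ j)"
      using that x pow_carrier_mat[OF A] by (auto simp: y_def scalar_prod_def atLeast0LessThan carrier_matD[OF A])
    also have "cmod \<dots> \<le> (\<Sum>j<n. c * cmod (x $ j))"
      using c[of k] that carrier_matD[OF pow_carrier_mat[OF A, of k]]
      by (intro sum_norm_le) (auto simp: norm_mult norm_bound_def intro!: mult_right_mono)
    finally show ?thesis .
  qed
  have sum_le: "storage X (y k) + \<epsilon> * (\<Sum>j<k. Re (y j \<bullet>c y j)) \<le> storage X x" for k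
  proof (induction k)
    case (Suc k)
    then show ?case using decr[OF y[of k]] by (simp add: yS distrib_left)
  qed (simp add: y0)
  define b where "b = (\<Sum>j<n. c * cmod (x $ j))"
  have st_abs: "\<bar>storage X v\<bar> \<le> (\<Sum>i<n. \<Sum>j<n. cmod (X $$ (i, j)) * cmod (v $ j) * cmod (v $ i))"
    if "v \<in> carrier_vec n" for v
  proof -
    have "\<bar>storage X v\<bar> \<le> cmod (quad_form X v)" by (rule abs_Re_le_cmod)
    also have "\<dots> \<le> (\<Sum>i<n. \<Sum>j<n. cmod (X $$ (i, j)) * cmod (v $ j) * cmod (v $ i))"
      unfolding quad_form_sum[OF hermitian_carrier[OF X] that]
      by (intro sum_norm_le) (simp add: norm_mult)
    finally show ?thesis .
  qed
  have "\<bar>storage X (y k)\<bar> \<le> (\<Sum>i<n. \<Sum>j<n. cmod (X $$ (i, j)) * b * b)" for k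
  proof (rule order.trans[OF st_abs[OF y]], intro sum_mono)
    fix i j assume ij: "i \<in> {..<n}" "j \<in> {..<n}"
    then have "0 \<le> b" using order.trans[OF norm_ge_zero entry[of i 0]] by (simp add: b_def)
    then show "cmod (X $$ (i, j)) * cmod (y k $ j) * cmod (y k $ i) \<le> cmod (X $$ (i, j)) * b * b"
      using ij by (intro mult_mono) (auto simp: b_def entry)
  qed
  note bdd = this
  have "summable (\<lambda>j. Re (y j \<bullet>c y j))"
  proof (rule bounded_imp_summable)
    show "0 \<le> Re (y j \<bullet>c y j)" for j by (rule cprod_self_nonneg)
    fix k
    have "\<epsilon> * (\<Sum>j<Suc k. Re (y j \<bullet>c y j)) \<le> storage X x + (\<Sum>i<n. \<Sum>j<n. cmod (X $$ (i, j)) * b * b)"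
      using sum_le[of "Suc k"] bdd[of "Suc k"] by linarith
    then show "(\<Sum>j\<le>k. Re (y j \<bullet>c y j)) \<le> (storage X x + (\<Sum>i<n. \<Sum>j<n. cmod (X $$ (i, j)) * b * b)) / \<epsilon>"
      using e by (simp add: pos_le_divide_eq mult.commute lessThan_Suc_atMost)
  qed
  then have y_lim: "(\<lambda>k. Re (y k \<bullet>c y k)) \<longlonglongrightarrow> 0" by (rule summable_LIMSEQ_zero)
  have yi: "(\<lambda>k. cmod (y k $ i)) \<longlonglongrightarrow> 0" if i: "i < n" for i
  proof -
    have "(\<lambda>k. (cmod (y k $ i))\<^sup>2) \<longlonglongrightarrow> 0"
    proof (rule tendsto_sandwich[OF _ _ tendsto_const y_lim])
      show "\<forall>\<^sub>F k in sequentially. (cmod (y k $ i))\<^sup>2 \<le> Re (y k \<bullet>c y k)"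
        unfolding cprod_self Re_complex_of_real using y i
        by (intro always_eventually allI member_le_sum) (auto simp: carrier_vecD[OF y])
    qed simp
    from tendsto_real_sqrt[OF this] show ?thesis by simp
  qed
  have "(\<lambda>k. storage X (y k)) \<longlonglongrightarrow> 0"
  proof (rule tendsto_rabs_zero_cancel, rule tendsto_sandwich[OF _ _ tendsto_const])
    show "\<forall>\<^sub>F k in sequentially. \<bar>storage X (y k)\<bar> \<le> (\<Sum>i<n. \<Sum>j<n. cmod (X $$ (i, j)) * cmod (y k $ j) * cmod (y k $ i))"
      using st_abs[OF y] by (intro always_eventually allI)
    have "(\<lambda>k. \<Sum>i<n. \<Sum>j<n. cmod (X $$ (i, j)) * cmod (y k $ j) * cmod (y k $ i))
      \<longlonglongrightarrow> (\<Sum>i<n. \<Sum>j<n. cmod (X $$ (i, j)) * 0 * 0)"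
      by (intro tendsto_intros yi) auto
    then show "(\<lambda>k. \<Sum>i<n. \<Sum>j<n. cmod (X $$ (i, j)) * cmod (y k $ j) * cmod (y k $ i)) \<longlonglongrightarrow> 0" by simp
  qed simp
  then have "(\<lambda>k. storage X (y (Suc k))) \<longlonglongrightarrow> 0" by (rule LIMSEQ_Suc)
  moreover have "storage X (y (Suc k)) \<le> storage X x - \<epsilon> * Re (x \<bullet>c x)" for k
  proof -
    have "Re (y 0 \<bullet>c y 0) \<le> (\<Sum>j<Suc k. Re (y j \<bullet>c y j))"
      by (intro member_le_sum) (auto intro: cprod_self_nonneg)
    then have "\<epsilon> * Re (x \<bullet>c x) \<le> \<epsilon> * (\<Sum>j<Suc k. Re (y j \<bullet>c y j))" using e by (simp add: y0)
    then show ?thesis using sum_le[of "Suc k"] by linarith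
  qed
  ultimately have "0 \<le> storage X x - \<epsilon> * Re (x \<bullet>c x)" by (intro LIMSEQ_le_const2) auto
  then show ?thesis by simp
qed

text \<open>With input 0 the strict dissipation inequality is a Lyapunov inequality, so stability
  makes \<open>X\<close> positive definite. The extended form is then a nonnegative square plus the
  slack of the dissipation inequality.\<close>

lemma strictly_passive_storage:
  assumes n: "0 < n" and ctrb: "\<And>x. x \<in> carrier_vec n \<Longrightarrow> x \<in> reachable n m A B n"
    and sp: "is_strictly_passive n m (A, B, C, D)"
  shows "\<exists>X. hermitian n X \<and> pd (n + n + m) (Wt X)"
proof -
  note sp' = sp[unfolded is_strictly_passive_iff]
  have st: "x = 0\<^sub>v n" if "cmod z = 1" "x \<in> carrier_vec n" "A *\<^sub>v x = z \<cdot>\<^sub>v x" for z x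
    using sp' that by (metis order.refl)
  have pos: "0 < supplied x u" if "cmod z = 1" "x \<in> carrier_vec n" "u \<in> carrier_vec m"
    "step x u = z \<cdot>\<^sub>v x" "u \<noteq> 0\<^sub>v m" for z x u using sp' that by blast
  obtain X \<epsilon> where X: "hermitian n X" "0 < \<epsilon>" and diss: "\<And>x u. x \<in> carrier_vec n \<Longrightarrow> u \<in> carrier_vec m \<Longrightarrow>
     storage X (step x u) + \<epsilon> * (Re (x \<bullet>c x) + Re (u \<bullet>c u)) \<le> storage X x + supplied x u"
  proof -
    have "\<exists>X \<epsilon>. hermitian n X \<and> 0 < \<epsilon> \<and> (\<forall>x\<in>carrier_vec n. \<forall>u\<in>carrier_vec m.
       storage X (step x u) + \<epsilon> * (Re (x \<bullet>c x) + Re (u \<bullet>c u)) \<le> storage X x + supplied x u)"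
      by (rule strict_kyp) (fact ctrb, fact st, fact pos)
    then show ?thesis using that by blast
  qed
  have "\<epsilon> * Re (x \<bullet>c x) \<le> storage X x" if x: "x \<in> carrier_vec n" for x
  proof (rule storage_pos[OF X _ _ x])
    show "\<exists>c. \<forall>k. norm_bound (A ^\<^sub>m k) c"
      using sp by (intro power_bounded_of_spectrum[OF A n]) (auto simp: is_strictly_passive_def)
    fix x :: "complex vec" assume x: "x \<in> carrier_vec n"
    show "storage X (A *\<^sub>v x) + \<epsilon> * Re (x \<bullet>c x) \<le> storage X x"
      using diss[OF x, of "0\<^sub>v m"] x
      by (simp add: state_step_def supply_rate_def mat_vec_zero[OF B] mat_vec_zero[OF D])
  qed
  then have Xpos: "0 < storage X x" if "x \<in> carrier_vec n" "x \<noteq> 0\<^sub>v n" for x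
    using cprod_self_pos[OF that] that X(2) by (smt (verit) mult_pos_pos)
  have X0: "storage X (0\<^sub>v n) = 0" by (simp add: quad_form_def mat_vec_zero[OF hermitian_carrier[OF X(1)]])
  have Xnn: "0 \<le> storage X x" if "x \<in> carrier_vec n" for x
    using Xpos[OF that] X0 by (cases "x = 0\<^sub>v n") auto
  have "pd (n + n + m) (Wt X)" unfolding pd_def
  proof (intro conjI ballI impI)
    show "hermitian (n + n + m) (Wt X)" by (rule Wt_hermitian[OF X(1)])
    fix v :: "complex vec" assume v: "v \<in> carrier_vec (n + n + m)" "v \<noteq> 0\<^sub>v (n + n + m)"
    obtain yx u where 1: "yx \<in> carrier_vec (n + n)" "u \<in> carrier_vec m" "v = yx @\<^sub>v u" using split_vec[OF v(1)] .
    obtain y x where 2: "y \<in> carrier_vec n" "x \<in> carrier_vec n" "yx = y @\<^sub>v x" using split_vec[OF 1(1)] .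
    \<comment> \<open>Where \<open>x\<close> and \<open>u\<close> vanish the margin is lost, but the
      square is then V(y) with \<open>y\<close> nonzero.\<close>
    have "0 < storage X (y + step x u) + \<epsilon> * (Re (x \<bullet>c x) + Re (u \<bullet>c u))"
    proof (cases "x = 0\<^sub>v n \<and> u = 0\<^sub>v m")
      case True
      then have "y \<noteq> 0\<^sub>v n" using v 1 2 by (auto simp: append_zero_vec)
      then show ?thesis using True Xpos[OF 2(1)] 2(1)
        by (simp add: state_step_def mat_vec_zero[OF A] mat_vec_zero[OF B])
    next
      case False
      then have "0 < Re (x \<bullet>c x) + Re (u \<bullet>c u)"
        using cprod_self_pos[OF 2(2)] cprod_self_pos[OF 1(2)]
          cprod_self_nonneg[of x] cprod_self_nonneg[of u] by (smt (verit))
      then have "0 < \<epsilon> * (Re (x \<bullet>c x) + Re (u \<bullet>c u))" using X(2) by simp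
      moreover have "0 \<le> storage X (y + step x u)" using 1 2 by (intro Xnn) simp
      ultimately show ?thesis by simp
    qed
    then show "0 < storage (Wt X) v"
      unfolding 1(3) 2(3) Wt_storage[OF X(1) 2(1,2) 1(2)] using diss[OF 2(2) 1(2)] by simp
  qed
  then show ?thesis using X(1) by blast
qed

end

section \<open>From linear matrix inequalities to passivity\<close>

lemma storage_zero [simp]: "hermitian k X \<Longrightarrow> storage X (0\<^sub>v k) = 0"
  by (simp add: quad_form_def mat_vec_zero[OF hermitian_carrier])

lemma storage_uminus:
  assumes "hermitian k X" "x \<in> carrier_vec k"
  shows "storage X (- x) = storage X x"
proof -
  have "- x = (- 1) \<cdot>\<^sub>v x" by (intro eq_vecI) auto
  then show ?thesis using quad_form_smult[OF hermitian_carrier[OF assms(1)] assms(2), of "- 1"] by simp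
qed

lemma pd_imp_psd_storage:
  assumes "pd k X" "x \<in> carrier_vec k"
  shows "0 \<le> storage X x"
  using assms storage_zero[of k X] by (cases "x = 0\<^sub>v k") (auto simp: pd_def intro: less_imp_le)

lemma smult_mat_vec:
  fixes M :: "complex mat"
  assumes "M \<in> carrier_mat p q" "x \<in> carrier_vec q"
  shows "(c \<cdot>\<^sub>m M) *\<^sub>v x = c \<cdot>\<^sub>v (M *\<^sub>v x)"
proof (rule eq_vecI)
  fix i assume "i < dim_vec (c \<cdot>\<^sub>v (M *\<^sub>v x))"
  then have i: "i < p" using assms(1) by simp
  then have "row M i \<in> carrier_vec q" using assms(1) by simp
  then show "((c \<cdot>\<^sub>m M) *\<^sub>v x) $ i = (c \<cdot>\<^sub>v (M *\<^sub>v x)) $ i"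
    using i assms carrier_matD[OF assms(1)] smult_scalar_prod_distrib[of "row M i" q x c] by simp
qed simp

text \<open>For large \<open>k\<close> the quadratic term wins. It serves for Jordan chains and for
  small output feedback, where a family indexed by \<open>k\<close> reveals the sign of its leading
  coefficient.\<close>

lemma linear_growth_bound:
  fixes q b :: real
  assumes "\<And>k :: nat. (real k)\<^sup>2 * q + real k * b \<le> 0"
  shows "q \<le> 0"
proof (rule ccontr)
  assume "\<not> q \<le> 0"
  then obtain k :: nat where k: "- b < real k * q" using reals_Archimedean3[of q] by auto
  define r where "r = real (Suc k)"
  have "0 < r * q + b" using k \<open>\<not> q \<le> 0\<close> by (simp add: r_def distrib_right)
  then have "0 < r * (r * q + b)" by (intro mult_pos_pos) (simp_all add: r_def)
  then show False using assms[of "Suc k"] unfolding r_def[symmetric] by (simp add: power2_eq_square distrib_left mult.assoc)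
qed

context linear_system
begin

lemma step_zero [simp]: "step (0\<^sub>v n) (0\<^sub>v m) = 0\<^sub>v n"
  by (simp add: state_step_def mat_vec_zero[OF A] mat_vec_zero[OF B])

lemma step_zero_input: "x \<in> carrier_vec n \<Longrightarrow> step x (0\<^sub>v m) = A *\<^sub>v x"
  by (simp add: state_step_def mat_vec_zero[OF B])

lemma supply_zero_input [simp]: "x \<in> carrier_vec n \<Longrightarrow> supplied x (0\<^sub>v m) = 0"
  by (simp add: supply_rate_def mat_vec_zero[OF D])

lemma Wt_vec_eq_zero_iff:
  assumes "y \<in> carrier_vec n" "x \<in> carrier_vec n" "u \<in> carrier_vec m"
  shows "(y @\<^sub>v x) @\<^sub>v u = 0\<^sub>v (n + n + m) \<longleftrightarrow> y = 0\<^sub>v n \<and> x = 0\<^sub>v n \<and> u = 0\<^sub>v m"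
  using assms append_eq_zero_iff[of "y @\<^sub>v x" "n + n" u m] append_eq_zero_iff[of y n x n] by auto

lemma pd_Wt_imp_pd:
  assumes "hermitian n X" "pd (n + n + m) (Wt X)"
  shows "pd n X"
  unfolding pd_def
proof (intro conjI ballI impI assms(1))
  fix y :: "complex vec" assume y: "y \<in> carrier_vec n" "y \<noteq> 0\<^sub>v n"
  have "0 < storage (Wt X) ((y @\<^sub>v 0\<^sub>v n) @\<^sub>v 0\<^sub>v m)"
    using assms(2) y Wt_vec_eq_zero_iff[of y "0\<^sub>v n" "0\<^sub>v m"] unfolding pd_def by auto
  then show "0 < storage X y" using assms(1) y by (simp add: Wt_storage)
qed

text \<open>At y = -(A x + B u) the square drops out and dissipation is strict. An eigenvector for
  an eigenvalue outside the open disc would lose storage in a step that cannot decrease it; at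
  frequencies on the circle the two storages cancel and only the supply is left.\<close>

lemma pd_Wt_strictly_passive:
  assumes X: "hermitian n X" and Wt: "pd (n + n + m) (Wt X)"
  shows "is_strictly_passive n m (A, B, C, D)"
proof -
  have diss: "storage X (step x u) < storage X x + supplied x u"
    if x: "x \<in> carrier_vec n" and u: "u \<in> carrier_vec m" and nz: "x \<noteq> 0\<^sub>v n \<or> u \<noteq> 0\<^sub>v m" for x u
  proof -
    let ?f = "step x u"
    have f: "?f \<in> carrier_vec n" using x u by simp
    have "(- ?f @\<^sub>v x) @\<^sub>v u \<in> carrier_vec (n + n + m)" using x u f by auto
    moreover have "(- ?f @\<^sub>v x) @\<^sub>v u \<noteq> 0\<^sub>v (n + n + m)" using Wt_vec_eq_zero_iff[of "- ?f" x u] f x u nz by auto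
    ultimately have "0 < storage (Wt X) ((- ?f @\<^sub>v x) @\<^sub>v u)" using Wt by (simp add: pd_def)
    moreover have "- ?f + ?f = 0\<^sub>v n" using f by (intro eq_vecI) auto
    ultimately show ?thesis using Wt_storage[OF X, of "- ?f" x u] X f x u by simp
  qed
  have nn: "0 \<le> storage X x" if "x \<in> carrier_vec n" for x
    using pd_imp_psd_storage[OF pd_Wt_imp_pd[OF X Wt] that] .
  note sc = quad_form_smult[OF hermitian_carrier[OF X]]
  show ?thesis unfolding is_strictly_passive_iff
  proof (intro conjI allI ballI impI)
    fix z :: complex and x :: "complex vec"
    assume x: "x \<in> carrier_vec n" and z: "1 \<le> cmod z" and eq: "A *\<^sub>v x = z \<cdot>\<^sub>v x"
    show "x = 0\<^sub>v n"
    proof (rule ccontr)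
      assume "x \<noteq> 0\<^sub>v n"
      then have "(cmod z)\<^sup>2 * storage X x < storage X x"
        using diss[OF x, of "0\<^sub>v m"] x by (simp add: step_zero_input eq sc)
      moreover have "1 \<le> (cmod z)\<^sup>2" using z by (simp add: one_le_power)
      ultimately show False using nn[OF x] mult_right_mono[of 1 "(cmod z)\<^sup>2" "storage X x"] by simp
    qed
  next
    fix z :: complex and x u :: "complex vec"
    assume x: "x \<in> carrier_vec n" and u: "u \<in> carrier_vec m" "u \<noteq> 0\<^sub>v m" and z: "cmod z = 1"
      and eq: "step x u = z \<cdot>\<^sub>v x"
    show "0 < supplied x u" using diss[OF x u(1)] u x z by (simp add: eq sc)
  qed
qed

definition dissipates :: "complex mat \<Rightarrow> bool"
  where "dissipates X \<longleftrightarrow> (\<forall>x\<in>carrier_vec n. \<forall>u\<in>carrier_vec m.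
     storage X (step x u) \<le> storage X x + supplied x u)"

lemma psd_Wt_dissipates:
  assumes X: "hermitian n X" and Wt: "psd (n + n + m) (Wt X)"
  shows "dissipates X"
  unfolding dissipates_def
proof (intro ballI)
  fix x u :: "complex vec" assume x: "x \<in> carrier_vec n" and u: "u \<in> carrier_vec m"
  let ?f = "step x u"
  have f: "?f \<in> carrier_vec n" using x u by simp
  then have "(- ?f @\<^sub>v x) @\<^sub>v u \<in> carrier_vec (n + n + m)" using x u by auto
  then have "0 \<le> storage (Wt X) ((- ?f @\<^sub>v x) @\<^sub>v u)" using Wt by (simp add: psd_def)
  moreover have "- ?f + ?f = 0\<^sub>v n" using f by (intro eq_vecI) auto
  ultimately show "storage X ?f \<le> storage X x + supplied x u" using Wt_storage[OF X, of "- ?f" x u] X x u f by simp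
qed

text \<open>On the unit circle V(z x) = V(x), so dissipation leaves nonnegative supply. With input 0
  the storage does not increase, which bounds the eigenvalues, while a Jordan chain at a unimodular
  eigenvalue would make it grow quadratically.\<close>

lemma dissipation_passive:
  assumes X: "pd n X"
    and dissX: "dissipates X"
  shows "is_passive n m (A, B, C, D)"
proof -
  note diss = dissX[unfolded dissipates_def, rule_format]
  have hX: "hermitian n X" using X by (simp add: pd_def)
  have Xpos: "0 < storage X x" if "x \<in> carrier_vec n" "x \<noteq> 0\<^sub>v n" for x using X that by (simp add: pd_def)
  note sc = quad_form_smult[OF hermitian_carrier[OF hX]]
  have decr: "storage X (A *\<^sub>v x) \<le> storage X x" if "x \<in> carrier_vec n" for x
    using diss[OF that, of "0\<^sub>v m"] that by (simp add: step_zero_input)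
  have freq: "psd m (popov z)"
    if z: "cmod z = 1" and inv: "invertible_mat (z \<cdot>\<^sub>m 1\<^sub>m n - A)" for z
  proof -
    let ?N = "z \<cdot>\<^sub>m 1\<^sub>m n - A"
    have N: "?N \<in> carrier_mat n n" by (rule minus_carrier_mat[OF A])
    \<comment> \<open>\<open>invertible_mat\<close> does not state the size of the inverse; it is
      recovered from the dimensions of the two products.\<close>
    obtain G where "inverts_mat ?N G" "inverts_mat G ?N" using inv by (auto simp: invertible_mat_def)
    then have G1: "?N * G = 1\<^sub>m n" and G2: "G * ?N = 1\<^sub>m (dim_row G)"
      using carrier_matD[OF N] by (simp_all add: inverts_mat_def)
    have "dim_col (G * ?N) = n" using carrier_matD[OF N] by simp
    then have dr: "dim_row G = n" unfolding G2 by simp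
    have "dim_col (?N * G) = n" unfolding G1 by simp
    then have G: "G \<in> carrier_mat n n" using dr by (intro carrier_matI) auto
    have inj: "x = 0\<^sub>v n" if x: "x \<in> carrier_vec n" and eq: "A *\<^sub>v x = z \<cdot>\<^sub>v x" for x
    proof -
      have "(z \<cdot>\<^sub>m 1\<^sub>m n) *\<^sub>v x = z \<cdot>\<^sub>v x" using x by (intro eq_vecI) auto
      then have "?N *\<^sub>v x = z \<cdot>\<^sub>v x - A *\<^sub>v x" using x by (subst minus_mult_distrib_mat_vec[of _ n n]) auto
      also have "\<dots> = 0\<^sub>v n" unfolding eq using x by (intro eq_vecI) auto
      finally have "G *\<^sub>v (?N *\<^sub>v x) = 0\<^sub>v n" by (simp add: mat_vec_zero[OF G])
      then show ?thesis using assoc_mult_mat_vec[OF G N x] G2 dr x by simp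
    qed
    show ?thesis unfolding psd_def
    proof (intro conjI ballI)
      show "hermitian m (popov z)"
        by (rule hermitian_add_adjoint[OF transfer_carrier[OF inj]])
      fix u :: "complex vec" assume u: "u \<in> carrier_vec m"
      obtain x where x: "x \<in> carrier_vec n" "step x u = z \<cdot>\<^sub>v x"
        "storage (popov z) u = supplied x u"
        using transfer_supply[of z u, OF inj u] by blast
      show "0 \<le> storage (popov z) u"
        unfolding x(3) using diss[OF x(1) u] z x(1) by (simp add: x(2) sc)
    qed
  qed
  have eig: "\<exists>v\<in>carrier_vec n. v \<noteq> 0\<^sub>v n \<and> A *\<^sub>v v = l \<cdot>\<^sub>v v" if ev: "eigenvalue A l" for l
    using ev carrier_matD[OF A] by (auto simp: eigenvalue_def eigenvector_def)
  have le1: "cmod l \<le> 1" if ev: "eigenvalue A l" for l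
  proof -
    obtain v where v: "v \<in> carrier_vec n" "v \<noteq> 0\<^sub>v n" "A *\<^sub>v v = l \<cdot>\<^sub>v v" using eig[OF ev] by blast
    have "(cmod l)\<^sup>2 * storage X v \<le> 1 * storage X v" using decr[OF v(1)] v by (simp add: sc)
    then have "(cmod l)\<^sup>2 \<le> 1\<^sup>2" using Xpos[OF v(1,2)] by (simp add: mult_le_cancel_right)
    then show ?thesis by (rule power2_le_imp_le) simp
  qed
  have semi: "semisimple_eigenvalue A l" if ev: "eigenvalue A l" and l: "cmod l = 1" for l
  proof (rule semisimple_eigenvalueI[OF A ev])
    fix v :: "complex vec" assume v: "v \<in> carrier_vec n"
    define w where "w = char_matrix A l *\<^sub>v v"
    assume "char_matrix A l *\<^sub>v (char_matrix A l *\<^sub>v v) = 0\<^sub>v n"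
    then have Mw: "char_matrix A l *\<^sub>v w = 0\<^sub>v n" by (simp add: w_def)
    have ch: "char_matrix A l *\<^sub>v x = A *\<^sub>v x - l \<cdot>\<^sub>v x" if "x \<in> carrier_vec n" for x
    proof -
      have "((- l) \<cdot>\<^sub>m 1\<^sub>m n) *\<^sub>v x = (- l) \<cdot>\<^sub>v x" using that by (intro eq_vecI) auto
      moreover have "char_matrix A l = A + (- l) \<cdot>\<^sub>m 1\<^sub>m n" unfolding char_matrix_def carrier_matD[OF A] ..
      ultimately have "char_matrix A l *\<^sub>v x = A *\<^sub>v x + (- l) \<cdot>\<^sub>v x"
        using that by (simp add: add_mult_distrib_mat_vec[of _ n n])
      also have "\<dots> = A *\<^sub>v x - l \<cdot>\<^sub>v x" using that carrier_matD[OF A] by (intro eq_vecI) auto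
      finally show ?thesis .
    qed
    have w: "w \<in> carrier_vec n" unfolding w_def by (rule mult_mat_vec_carrier[OF char_matrix_closed[OF A] v])
    have Av: "A *\<^sub>v v = l \<cdot>\<^sub>v v + w" unfolding w_def ch[OF v] using v carrier_matD[OF A] by (intro eq_vecI) auto
    have "A *\<^sub>v w - l \<cdot>\<^sub>v w = 0\<^sub>v n" using Mw ch[OF w] by simp
    moreover have "A *\<^sub>v w = (A *\<^sub>v w - l \<cdot>\<^sub>v w) + l \<cdot>\<^sub>v w" using w carrier_matD[OF A] by (intro eq_vecI) auto
    ultimately have Aw: "A *\<^sub>v w = l \<cdot>\<^sub>v w" using w by simp
    have ll: "l * cnj l = 1" using l complex_norm_square[of l] by simp
    define \<phi> where "\<phi> k = storage X (v + (of_nat k * cnj l) \<cdot>\<^sub>v w)" for k :: nat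
    text \<open>Because \<open>A v = l v + w\<close>, one step moves \<open>v + k l\<^sup>-\<^sup>1 w\<close> to \<open>l\<close> times \<open>v + (k + 1) l\<^sup>-\<^sup>1 w\<close>.\<close>
    have dec: "\<phi> (Suc k) \<le> \<phi> k" for k
    proof -
      let ?x = "v + (of_nat k * cnj l) \<cdot>\<^sub>v w" and ?y = "v + (of_nat (Suc k) * cnj l) \<cdot>\<^sub>v w"
      have "A *\<^sub>v ?x = A *\<^sub>v v + (of_nat k * cnj l) \<cdot>\<^sub>v (A *\<^sub>v w)"
        using v w by (simp add: mult_add_distrib_mat_vec[OF A] mult_mat_vec[OF A])
      also have "\<dots> = l \<cdot>\<^sub>v ?y" unfolding Av Aw
      proof (intro eq_vecI)
        fix i assume "i < dim_vec (l \<cdot>\<^sub>v ?y)"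
        then have i: "i < n" using w by simp
        have "l * v $ i + w $ i + of_nat k * (l * cnj l) * w $ i = l * (v $ i) + (of_nat k + 1) * (l * cnj l) * w $ i"
          unfolding ll by (simp add: algebra_simps)
        then show "(l \<cdot>\<^sub>v v + w + (of_nat k * cnj l) \<cdot>\<^sub>v (l \<cdot>\<^sub>v w)) $ i = (l \<cdot>\<^sub>v ?y) $ i"
          using i v w by (simp add: algebra_simps)
      qed (use v w in auto)
      finally have "A *\<^sub>v ?x = l \<cdot>\<^sub>v ?y" .
      then show ?thesis using decr[of ?x] v w l by (simp add: \<phi>_def sc)
    qed
    have "\<phi> k \<le> \<phi> 0" for k by (induction k) (use dec in \<open>auto intro: order.trans\<close>)
    moreover have "\<phi> 0 = storage X v"
    proof -
      have "v + 0 \<cdot>\<^sub>v w = v" using v w by (intro eq_vecI) auto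
      then show ?thesis by (simp add: \<phi>_def)
    qed
    \<comment> \<open>Along the chain \<phi> is quadratic in \<open>k\<close> with leading
      coefficient V(w), yet it never exceeds its value at 0. So V(w) is at most 0, and positivity of
      \<open>X\<close> gives w = 0.\<close>
    moreover have "\<phi> k = storage X v + real k * (2 * Re (cnj l * ((X *\<^sub>v w) \<bullet>c v))) + (real k)\<^sup>2 * storage X w" for k
    proof -
      have Xw: "X *\<^sub>v w \<in> carrier_vec n" by (rule mult_mat_vec_carrier[OF hermitian_carrier[OF hX] w])
      have "(X *\<^sub>v ((of_nat k * cnj l) \<cdot>\<^sub>v w)) \<bullet>c v = of_nat k * (cnj l * ((X *\<^sub>v w) \<bullet>c v))"
        using v w Xw by (simp add: mult_mat_vec[OF hermitian_carrier[OF hX]] cprod_smult_left[of _ n] mult.assoc)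
      then show ?thesis unfolding \<phi>_def
        using v w l by (simp add: quad_form_add[OF hX] sc norm_mult power_mult_distrib)
    qed
    ultimately have "(real k)\<^sup>2 * storage X w + real k * (2 * Re (cnj l * ((X *\<^sub>v w) \<bullet>c v))) \<le> 0" for k
      by (smt (verit))
    then have "storage X w \<le> 0" by (rule linear_growth_bound)
    then show "char_matrix A l *\<^sub>v v = 0\<^sub>v n" using Xpos[OF w] unfolding w_def by fastforce
  qed
  show ?thesis unfolding is_passive_def using freq le1 semi by auto
qed

text \<open>For fixed arguments affine in \<xi>, with slope minus the form of \<open>diag3\<close>;
  comparisons between different shifts rest on this.\<close>

definition gap :: "complex mat \<Rightarrow> real \<Rightarrow> complex vec \<Rightarrow> complex vec \<Rightarrow> complex vec \<Rightarrow> real"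
  where "gap X \<xi> y x u = storage X (y + step x u) - storage X (step x u) + storage X x
     + supplied x u - \<xi> * (storage X y + storage X x + 2 * Re (u \<bullet>c u))"

definition gap_nonneg :: "complex mat \<Rightarrow> real \<Rightarrow> bool"
  where "gap_nonneg X \<xi> \<longleftrightarrow> (\<forall>y\<in>carrier_vec n. \<forall>x\<in>carrier_vec n. \<forall>u\<in>carrier_vec m. 0 \<le> gap X \<xi> y x u)"

definition gap_pos :: "complex mat \<Rightarrow> real \<Rightarrow> bool"
  where "gap_pos X \<xi> \<longleftrightarrow> (\<forall>y\<in>carrier_vec n. \<forall>x\<in>carrier_vec n. \<forall>u\<in>carrier_vec m.
     \<not> (y = 0\<^sub>v n \<and> x = 0\<^sub>v n \<and> u = 0\<^sub>v m) \<longrightarrow> 0 < gap X \<xi> y x u)"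

lemma all_Wt_vec_iff:
  fixes Q :: "complex vec \<Rightarrow> bool"
  shows "(\<forall>v\<in>carrier_vec (n + n + m). Q v) \<longleftrightarrow>
   (\<forall>y\<in>carrier_vec n. \<forall>x\<in>carrier_vec n. \<forall>u\<in>carrier_vec m. Q ((y @\<^sub>v x) @\<^sub>v u))"
proof (intro iffI ballI)
  fix v :: "complex vec" assume r: "\<forall>y\<in>carrier_vec n. \<forall>x\<in>carrier_vec n. \<forall>u\<in>carrier_vec m. Q ((y @\<^sub>v x) @\<^sub>v u)"
    and "v \<in> carrier_vec (n + n + m)"
  then obtain y x u where "y \<in> carrier_vec n" "x \<in> carrier_vec n" "u \<in> carrier_vec m" "v = (y @\<^sub>v x) @\<^sub>v u"
    using split_vec by metis
  then show "Q v" using r by blast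
qed auto

lemma loewner_ge_iff:
  assumes X: "hermitian n X"
  shows "loewner_ge (n + n + m) (Wt X) (complex_of_real \<xi> \<cdot>\<^sub>m diag3 n m X)
    \<longleftrightarrow> gap_nonneg X \<xi>"
proof -
  let ?W = "Wt X" and ?E = "complex_of_real \<xi> \<cdot>\<^sub>m diag3 n m X"
  note W = hermitian_carrier[OF Wt_hermitian[OF X]] and E = hermitian_carrier[OF diag3_hermitian[OF X, of m]]
  have form: "storage (?W - ?E) ((y @\<^sub>v x) @\<^sub>v u) = gap X \<xi> y x u"
    if y: "y \<in> carrier_vec n" and x: "x \<in> carrier_vec n" and u: "u \<in> carrier_vec m" for y x u
  proof -
    let ?v = "(y @\<^sub>v x) @\<^sub>v u"
    have v: "?v \<in> carrier_vec (n + n + m)" using that by auto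
    note sm = smult_mat_vec[OF E v, of "complex_of_real \<xi>"]
    have "quad_form (?W - ?E) ?v = quad_form ?W ?v - complex_of_real \<xi> * quad_form (diag3 n m X) ?v"
      unfolding quad_form_def using v W E mult_mat_vec_carrier[OF W v] mult_mat_vec_carrier[OF E v]
      by (simp add: sm minus_mult_distrib_mat_vec[of _ "n + n + m" "n + n + m"]
          minus_scalar_prod_distrib[of _ "n + n + m"] cprod_smult_left[of _ "n + n + m"])
    then show ?thesis using that X by (simp add: gap_def Wt_storage diag3_storage)
  qed
  have "hermitian (n + n + m) (?W - ?E)"
    by (intro hermitian_diff hermitian_smult_real Wt_hermitian diag3_hermitian X)
  then show ?thesis unfolding loewner_ge_def psd_def all_Wt_vec_iff gap_nonneg_def by (simp add: form)
qed

lemma psd_W_iff: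
  assumes X: "hermitian n X"
  shows "psd (n + m) (W_mat X (A, B, C, D)) \<longleftrightarrow> dissipates X"
proof -
  have "(\<forall>v\<in>carrier_vec (n + m). Q v) \<longleftrightarrow> (\<forall>x\<in>carrier_vec n. \<forall>u\<in>carrier_vec m. Q (x @\<^sub>v u))" for Q
    by (metis split_vec append_carrier_vec)
  note all = this
  show ?thesis unfolding psd_def dissipates_def all
    using W_hermitian[OF X] by (simp add: W_storage[OF X] diff_add_eq le_diff_eq)
qed

section \<open>The shifted models\<close>

abbreviation "shifted_system \<xi> \<equiv> linear_system n m (complex_of_real (1 / (1 - \<xi>)) \<cdot>\<^sub>m A)
   (complex_of_real (1 / (1 - \<xi>)) \<cdot>\<^sub>m B) (complex_of_real (1 / (1 - \<xi>)) \<cdot>\<^sub>m C)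
   (complex_of_real (1 / (1 - \<xi>)) \<cdot>\<^sub>m (D - complex_of_real \<xi> \<cdot>\<^sub>m 1\<^sub>m m))"

lemma shifted_system: "shifted_system \<xi>"
  by unfold_locales (auto intro!: minus_carrier_mat)

lemma shifted_step:
  assumes "x \<in> carrier_vec n" "u \<in> carrier_vec m"
  shows "state_step (c \<cdot>\<^sub>m A) (c \<cdot>\<^sub>m B) x u = c \<cdot>\<^sub>v step x u"
  unfolding state_step_def using assms
  by (simp add: smult_mat_vec[OF A] smult_mat_vec[OF B] smult_add_distrib_vec[of _ n])

lemma shifted_supply:
  assumes x: "x \<in> carrier_vec n" and u: "u \<in> carrier_vec m"
  shows "supply_rate (complex_of_real c \<cdot>\<^sub>m C) (complex_of_real c \<cdot>\<^sub>m (D - complex_of_real \<xi> \<cdot>\<^sub>m 1\<^sub>m m)) x u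
    = c * (supplied x u - 2 * \<xi> * Re (u \<bullet>c u))"
proof -
  have D': "D - complex_of_real \<xi> \<cdot>\<^sub>m 1\<^sub>m m \<in> carrier_mat m m" by (auto intro!: minus_carrier_mat)
  have "(complex_of_real \<xi> \<cdot>\<^sub>m 1\<^sub>m m) *\<^sub>v u = complex_of_real \<xi> \<cdot>\<^sub>v u" using u by (intro eq_vecI) auto
  then have "(D - complex_of_real \<xi> \<cdot>\<^sub>m 1\<^sub>m m) *\<^sub>v u = D *\<^sub>v u - complex_of_real \<xi> \<cdot>\<^sub>v u"
    using u by (subst minus_mult_distrib_mat_vec[of _ m m]) auto
  then have eq: "((complex_of_real c \<cdot>\<^sub>m C) *\<^sub>v x + (complex_of_real c \<cdot>\<^sub>m (D - complex_of_real \<xi> \<cdot>\<^sub>m 1\<^sub>m m)) *\<^sub>v u) \<bullet>c u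
    = complex_of_real c * ((C *\<^sub>v x) \<bullet>c u + ((D *\<^sub>v u) \<bullet>c u - complex_of_real \<xi> * (u \<bullet>c u)))"
    using x u by (simp add: smult_mat_vec[OF C] smult_mat_vec[OF D'] cprod_add_left[of _ m]
        cprod_smult_left[of _ m] minus_scalar_prod_distrib[of _ m] distrib_left)
  show ?thesis unfolding supply_rate_def eq using x u by (simp add: cprod_add_left[of _ m] algebra_simps)
qed

text \<open>Multiplying by 1 - \<xi> restores \<open>A\<close>, \<open>B\<close>, \<open>C\<close>
  and D - \<xi> I in the scaled entries and leaves (1 - \<xi>) V(y) and (1 - \<xi>) V(x) from the
  diagonal blocks: precisely the subtraction of \<xi> times \<open>diag3\<close>. The factor is
  positive, so signs agree.\<close>

lemma shifted_Wt_storage: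
  assumes X: "hermitian n X" and xi: "\<xi> < 1"
    and y: "y \<in> carrier_vec n" and x: "x \<in> carrier_vec n" and u: "u \<in> carrier_vec m"
  shows "storage (Wt_mat n m X (shifted \<xi>)) ((y @\<^sub>v x) @\<^sub>v u) = gap X \<xi> y x u / (1 - \<xi>)"
proof -
  define c where "c = 1 / (1 - \<xi>)"
  let ?f = "step x u"
  have f: "?f \<in> carrier_vec n" using x u by simp
  have Xf: "X *\<^sub>v ?f \<in> carrier_vec n" by (rule mult_mat_vec_carrier[OF hermitian_carrier[OF X] f])
  have cross: "Re ((X *\<^sub>v (complex_of_real c \<cdot>\<^sub>v ?f)) \<bullet>c y) = c * Re ((X *\<^sub>v ?f) \<bullet>c y)"
    using f y Xf by (simp add: mult_mat_vec[OF hermitian_carrier[OF X]] cprod_smult_left[of _ n])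
  have "storage (Wt_mat n m X (shifted \<xi>)) ((y @\<^sub>v x) @\<^sub>v u)
    = storage X (y + complex_of_real c \<cdot>\<^sub>v ?f) - storage X (complex_of_real c \<cdot>\<^sub>v ?f) + storage X x
      + c * (supplied x u - 2 * \<xi> * Re (u \<bullet>c u))"
    unfolding shift_model_def prod.case c_def[symmetric] linear_system.Wt_storage[OF shifted_system[of \<xi>] X y x u, folded c_def]
    using x u by (simp add: shifted_step shifted_supply)
  also have "\<dots> = storage X y + 2 * c * Re ((X *\<^sub>v ?f) \<bullet>c y) + storage X x
      + c * (supplied x u - 2 * \<xi> * Re (u \<bullet>c u))"
    using quad_form_add[OF X y, of "complex_of_real c \<cdot>\<^sub>v ?f"] f cross by simp
  also have "\<dots> = gap X \<xi> y x u / (1 - \<xi>)"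
  proof -
    let ?R = "Re ((X *\<^sub>v ?f) \<bullet>c y)" and ?S = "supplied x u" and ?U = "Re (u \<bullet>c u)"
    have c1: "c * (1 - \<xi>) = 1" using xi by (simp add: c_def)
    have "(storage X y + 2 * c * ?R + storage X x + c * (?S - 2 * \<xi> * ?U)) * (1 - \<xi>)
      = (storage X y + storage X x) * (1 - \<xi>) + (c * (1 - \<xi>)) * (2 * ?R + ?S - 2 * \<xi> * ?U)"
      by (simp only: algebra_simps)
    also have "\<dots> = gap X \<xi> y x u"
      unfolding c1 gap_def using quad_form_add[OF X y f] by (simp add: algebra_simps)
    finally show ?thesis using xi by (simp add: eq_divide_eq)
  qed
  finally show ?thesis .
qed

lemma shifted_Wt_hermitian: "hermitian n X \<Longrightarrow> hermitian (n + n + m) (Wt_mat n m X (shifted \<xi>))"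
  unfolding shift_model_def prod.case by (rule linear_system.Wt_hermitian[OF shifted_system])

lemma psd_shift_iff:
  assumes X: "hermitian n X" and xi: "\<xi> < 1"
  shows "psd (n + n + m) (Wt_mat n m X (shifted \<xi>)) \<longleftrightarrow> gap_nonneg X \<xi>"
  unfolding psd_def all_Wt_vec_iff gap_nonneg_def
  using shifted_Wt_hermitian[OF X] xi by (simp add: shifted_Wt_storage[OF X xi] zero_le_divide_iff)

lemma pd_shift_iff:
  assumes X: "hermitian n X" and xi: "\<xi> < 1"
  shows "pd (n + n + m) (Wt_mat n m X (shifted \<xi>)) \<longleftrightarrow> gap_pos X \<xi>"
  unfolding pd_def all_Wt_vec_iff gap_pos_def
  using shifted_Wt_hermitian[OF X] xi
  by (simp add: shifted_Wt_storage[OF X xi] Wt_vec_eq_zero_iff zero_less_divide_iff)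

lemma reachable_smult:
  "x \<in> reachable n m A B k \<Longrightarrow> c \<cdot>\<^sub>v x \<in> reachable n m A B k"
proof (induction k arbitrary: x)
  case (Suc k)
  then obtain x' u where x': "x' \<in> reachable n m A B k" "u \<in> carrier_vec m" "x = step x' u" by auto
  have "c \<cdot>\<^sub>v x = step (c \<cdot>\<^sub>v x') (c \<cdot>\<^sub>v u)"
    using step_smult[OF reachable_carrier[OF x'(1)] x'(2)] x'(3) by simp
  then show ?case using Suc.IH[OF x'(1)] smult_carrier_vec[of c u m] x'(2) unfolding reachable.simps by blast
qed auto

text \<open>The factor \<open>c\<close> gained in a step is compensated by starting it from state
  and input divided by \<open>c\<close>, which \<open>reachable_smult\<close> permits.\<close>

lemma reachable_scaled:
  assumes "c \<noteq> 0" "x \<in> reachable n m A B k"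
  shows "x \<in> reachable n m (c \<cdot>\<^sub>m A) (c \<cdot>\<^sub>m B) k"
  using assms(2)
proof (induction k arbitrary: x)
  case (Suc k)
  then obtain x' u where x': "x' \<in> reachable n m A B k" "u \<in> carrier_vec m" "x = step x' u" by auto
  let ?i = "inverse c"
  have xc: "x' \<in> carrier_vec n" by (rule reachable_carrier[OF x'(1)])
  have "state_step (c \<cdot>\<^sub>m A) (c \<cdot>\<^sub>m B) (?i \<cdot>\<^sub>v x') (?i \<cdot>\<^sub>v u) = c \<cdot>\<^sub>v (?i \<cdot>\<^sub>v x)"
    using xc x' by (simp add: shifted_step step_smult)
  also have "\<dots> = x" using assms(1) by (simp add: smult_smult_assoc)
  finally have "x = state_step (c \<cdot>\<^sub>m A) (c \<cdot>\<^sub>m B) (?i \<cdot>\<^sub>v x') (?i \<cdot>\<^sub>v u)" by simp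
  moreover have "?i \<cdot>\<^sub>v x' \<in> reachable n m (c \<cdot>\<^sub>m A) (c \<cdot>\<^sub>m B) k" by (rule Suc.IH[OF reachable_smult[OF x'(1)]])
  moreover have "?i \<cdot>\<^sub>v u \<in> carrier_vec m" using x' by simp
  ultimately show ?case unfolding reachable.simps by blast
qed simp

end

section \<open>The supremum of the admissible shifts\<close>

text \<open>By compactness of the unit sphere a positive definite form dominates a small multiple of
  any other. The multiple 1/(j + 2) is below 1, which keeps the enlarged shift in
  \<open>gap_pos_open\<close> below 1.\<close>

lemma pd_perturb:
  assumes M: "pd k M" and E: "E \<in> carrier_mat k k"
  shows "\<exists>j :: nat. \<forall>v\<in>carrier_vec k. v \<noteq> 0\<^sub>v k \<longrightarrow> storage E v / (real j + 2) < storage M v"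
proof (rule ccontr)
  have Mc: "M \<in> carrier_mat k k" using M by (simp add: pd_def)
  assume "\<not> ?thesis"
  then have "\<forall>j :: nat. \<exists>v. v \<in> carrier_vec k \<and> v \<noteq> 0\<^sub>v k \<and> storage M v \<le> storage E v / (real j + 2)"
    by (meson not_le)
  then obtain w where w: "\<And>j. w j \<in> carrier_vec k" "\<And>j. w j \<noteq> 0\<^sub>v k"
    "\<And>j :: nat. storage M (w j) \<le> storage E (w j) / (real j + 2)" by metis
  define N where "N j = Re (w j \<bullet>c w j)" for j
  have N: "N j > 0" for j unfolding N_def by (rule cprod_self_pos[OF w(1,2)])
  define v where "v j = complex_of_real (1 / sqrt (N j)) \<cdot>\<^sub>v w j" for j
  have v: "v j \<in> carrier_vec k" for j using w by (simp add: v_def)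
  have c2: "(cmod (complex_of_real (1 / sqrt (N j))))\<^sup>2 = 1 / N j" for j
    using N[of j] by (simp only: norm_of_real power2_abs) (simp add: power_divide)
  have vs: "storage F (v j) = storage F (w j) / N j" if "F \<in> carrier_mat k k" for F j
    unfolding v_def quad_form_smult[OF that w(1)] c2 by simp
  have le: "storage M (v j) \<le> storage E (v j) / (real j + 2)" for j
    using divide_right_mono[OF w(3)[of j], of "N j"] N[of j] unfolding vs[OF Mc] vs[OF E] by (simp add: mult.commute)
  have n1: "(\<Sum>i<k. (cmod (v j $ i))\<^sup>2) = 1" for j
  proof -
    have "(\<Sum>i<k. (cmod (v j $ i))\<^sup>2) = (\<Sum>i<k. (1 / N j) * (cmod (w j $ i))\<^sup>2)"
    proof (intro sum.cong refl)
      fix i assume "i \<in> {..<k}"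
      then have "v j $ i = complex_of_real (1 / sqrt (N j)) * w j $ i" using carrier_vecD[OF w(1)[of j]] by (simp add: v_def)
      then show "(cmod (v j $ i))\<^sup>2 = 1 / N j * (cmod (w j $ i))\<^sup>2"
        unfolding c2[of j, symmetric] by (simp only: norm_mult power_mult_distrib)
    qed
    also have "\<dots> = (1 / N j) * N j"
      unfolding sum_distrib_left[symmetric] N_def cprod_self Re_complex_of_real by (simp add: carrier_vecD[OF w(1)])
    finally show ?thesis using N[of j] by simp
  qed
  have "\<exists>r :: nat \<Rightarrow> nat. strict_mono r \<and> (\<forall>a\<in>{..<k}. convergent (\<lambda>j. v (r j) $ a))"
  proof (rule bounded_coordinates_convergent_subseq)
    fix a assume a: "a \<in> {..<k}"
    have "cmod (v j $ a) \<le> 1" for j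
    proof (rule power2_le_imp_le)
      have "(cmod (v j $ a))\<^sup>2 \<le> (\<Sum>i<k. (cmod (v j $ i))\<^sup>2)" using a by (intro member_le_sum) auto
      then show "(cmod (v j $ a))\<^sup>2 \<le> 1\<^sup>2" unfolding n1 by simp
    qed simp
    then show "\<exists>K. \<forall>j. cmod (v j $ a) \<le> K" by blast
  qed simp
  then obtain r :: "nat \<Rightarrow> nat" where r: "strict_mono r" "\<And>a. a < k \<Longrightarrow> convergent (\<lambda>j. v (r j) $ a)" by auto
  define l where "l = vec k (\<lambda>a. lim (\<lambda>j. v (r j) $ a))"
  have l: "l \<in> carrier_vec k" by (simp add: l_def)
  have lim: "(\<lambda>j. v (r j) $ a) \<longlonglongrightarrow> l $ a" if "a < k" for a
    using r(2)[OF that] that by (simp add: l_def convergent_LIMSEQ_iff)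
  have st: "(\<lambda>j. storage F (v (r j))) \<longlonglongrightarrow> storage F l" if "F \<in> carrier_mat k k" for F
    unfolding quad_form_sum[OF that v] quad_form_sum[OF that l] by (intro tendsto_intros lim) auto
  have "(\<lambda>j. inverse (real (r j) + 2)) \<longlonglongrightarrow> 0"
    by (rule tendsto_inverse_0_at_top, rule filterlim_at_top_mono[OF filterlim_compose[OF filterlim_real_sequentially filterlim_subseq[OF r(1)]]]) auto
  then have "(\<lambda>j. storage E (v (r j)) / (real (r j) + 2)) \<longlonglongrightarrow> storage E l * 0"
    unfolding divide_inverse by (intro tendsto_mult st[OF E])
  then have "storage M l \<le> storage E l * 0"
    using le by (intro LIMSEQ_le[OF st[OF Mc]]) auto
  moreover have "(\<Sum>i<k. (cmod (l $ i))\<^sup>2) = 1"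
  proof -
    have "(\<lambda>j. \<Sum>i<k. (cmod (v (r j) $ i))\<^sup>2) \<longlonglongrightarrow> (\<Sum>i<k. (cmod (l $ i))\<^sup>2)" by (intro tendsto_intros lim) auto
    then show ?thesis unfolding n1 by (simp add: LIMSEQ_const_iff)
  qed
  then have "l \<noteq> 0\<^sub>v k" by auto
  ultimately show False using M l by (fastforce simp: pd_def)
qed

context linear_system
begin

text \<open>The constant is the energy supplied along one fixed path and does not mention
  \<open>X\<close>; a limit of solutions needs this uniformity.\<close>

lemma reachable_storage_bound:
  assumes "x \<in> reachable n m A B k"
  shows "\<exists>c. \<forall>X. hermitian n X \<longrightarrow> dissipates X \<longrightarrow> storage X x \<le> c"
  using assms
proof (induction k arbitrary: x)
  case 0
  then show ?case by (intro exI[of _ 0]) auto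
next
  case (Suc k)
  then obtain x' u where x': "x' \<in> reachable n m A B k" "u \<in> carrier_vec m" "x = step x' u" by auto
  obtain c where c: "\<And>X. hermitian n X \<Longrightarrow> dissipates X \<Longrightarrow> storage X x' \<le> c" using Suc.IH[OF x'(1)] by blast
  have "storage X x \<le> c + supplied x' u" if "hermitian n X" "dissipates X" for X
  proof -
    have "storage X x \<le> storage X x' + supplied x' u"
      using that(2) reachable_carrier[OF x'(1)] x'(2) unfolding dissipates_def x'(3) by blast
    then show ?thesis using c[OF that] by simp
  qed
  then show ?case by blast
qed

text \<open>The input -t C x extracts energy to first order in \<open>t\<close>, while
  \<open>D\<close> enters only to second order. A small positive \<open>t\<close> therefore detects
  that \<open>C x\<close> is nonzero.\<close>

lemma supply_output_feedback:
  assumes "x \<in> carrier_vec n"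
  shows "supplied x (complex_of_real (- t) \<cdot>\<^sub>v (C *\<^sub>v x))
    = - 2 * t * Re ((C *\<^sub>v x) \<bullet>c (C *\<^sub>v x)) + 2 * t\<^sup>2 * Re ((D *\<^sub>v (C *\<^sub>v x)) \<bullet>c (C *\<^sub>v x))"
  using assms
  by (simp add: supply_rate_def cprod_add_left[of _ m] mult_mat_vec[OF D] cprod_smult_left[of _ m]
    cprod_smult_right[of _ m] power2_eq_square algebra_simps del: of_real_minus)

text \<open>If V(x) = 0, no input can extract energy from \<open>x\<close>; small negative output
  feedback would do so if \<open>C x\<close> were nonzero.\<close>

lemma storage_kernel_unobserved:
  assumes X: "hermitian n X" and nn: "\<And>x. x \<in> carrier_vec n \<Longrightarrow> 0 \<le> storage X x" and diss: "dissipates X"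
    and x: "x \<in> carrier_vec n" and 0: "storage X x = 0"
  shows "C *\<^sub>v x = 0\<^sub>v m" "storage X (A *\<^sub>v x) = 0"
proof -
  have le: "storage X (step x u) \<le> supplied x u" if "u \<in> carrier_vec m" for u
    using diss x that 0 unfolding dissipates_def by force
  show "storage X (A *\<^sub>v x) = 0"
    using le[of "0\<^sub>v m"] nn[of "A *\<^sub>v x"] x by (simp add: step_zero_input)
  define q d where "q = Re ((C *\<^sub>v x) \<bullet>c (C *\<^sub>v x))" and "d = Re ((D *\<^sub>v (C *\<^sub>v x)) \<bullet>c (C *\<^sub>v x))"
  \<comment> \<open>Feedback gain 1/k; multiplying the resulting inequality by k^3 brings it into
    the shape of \<open>linear_growth_bound\<close>.\<close>
  have "(real k)\<^sup>2 * q + real k * (- d) \<le> 0" for k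
  proof (cases "k = 0")
    case False
    define t where "t = 1 / real k"
    let ?u = "complex_of_real (- t) \<cdot>\<^sub>v (C *\<^sub>v x)"
    have u: "?u \<in> carrier_vec m" using x by simp
    have "0 \<le> supplied x ?u" using le[OF u] nn[of "step x ?u"] x u by (auto intro: order.trans)
    then have "0 \<le> - 2 * t * q + 2 * t\<^sup>2 * d" unfolding supply_output_feedback[OF x] q_def d_def .
    then have "0 \<le> (- 2 * t * q + 2 * t\<^sup>2 * d) * (real k) ^ 3" by simp
    also have "\<dots> = 2 * (real k * d - (real k)\<^sup>2 * q)"
      using False by (simp add: t_def field_simps power2_eq_square power3_eq_cube)
    finally show ?thesis by simp
  qed simp
  then have "q \<le> 0" by (rule linear_growth_bound)
  then show "C *\<^sub>v x = 0\<^sub>v m" using cprod_self_pos[of "C *\<^sub>v x" m] x by (fastforce simp: q_def)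
qed

text \<open>The zero set of the storage is invariant under \<open>A\<close> and contained in the
  kernel of \<open>C\<close>, so observability reduces it to 0.\<close>

lemma observable_storage_pd:
  assumes obs: "observable n m A C"
    and X: "hermitian n X" and nn: "\<And>x. x \<in> carrier_vec n \<Longrightarrow> 0 \<le> storage X x" and diss: "dissipates X"
  shows "pd n X"
  unfolding pd_def
proof (intro conjI ballI impI X)
  fix x :: "complex vec" assume x: "x \<in> carrier_vec n" "x \<noteq> 0\<^sub>v n"
  show "0 < storage X x"
  proof (rule ccontr)
    assume "\<not> 0 < storage X x"
    then have z: "storage X x = 0" using nn[OF x(1)] by simp
    have c: "A ^\<^sub>m k *\<^sub>v x \<in> carrier_vec n" for k by (rule mult_mat_vec_carrier[OF pow_carrier_mat[OF A] x(1)])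
    have "storage X (A ^\<^sub>m k *\<^sub>v x) = 0" for k
    proof (induction k)
      case 0
      then show ?case using z x carrier_matD[OF A] by simp
    next
      case (Suc k)
      have "A ^\<^sub>m Suc k *\<^sub>v x = A *\<^sub>v (A ^\<^sub>m k *\<^sub>v x)"
        unfolding pow_mat_Suc_left[OF A] by (rule assoc_mult_mat_vec[OF A pow_carrier_mat[OF A] x(1)])
      then show ?case using storage_kernel_unobserved(2)[OF X nn diss c Suc] by simp
    qed
    then have "C *\<^sub>v (A ^\<^sub>m k *\<^sub>v x) = 0\<^sub>v m" for k
      using storage_kernel_unobserved(1)[OF X nn diss c] by blast
    then show False using observable_inj[OF obs x(1)] x(2) by blast
  qed
qed

section \<open>Dependence of the gap on the shift\<close>

lemma gap_state:
  assumes "hermitian n X" "y \<in> carrier_vec n"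
  shows "gap X \<xi> y (0\<^sub>v n) (0\<^sub>v m) = (1 - \<xi>) * storage X y"
  using assms by (simp add: gap_def left_diff_distrib)

lemma gap_no_shift:
  assumes "hermitian n X" "x \<in> carrier_vec n" "u \<in> carrier_vec m"
  shows "gap X \<xi> (0\<^sub>v n) x u = (1 - \<xi>) * storage X x + supplied x u - 2 * \<xi> * Re (u \<bullet>c u)"
  using assms by (simp add: gap_def algebra_simps)

lemma gap_pos_nonneg:
  assumes "hermitian n X" "gap_pos X \<xi>"
  shows "gap_nonneg X \<xi>"
  unfolding gap_nonneg_def
proof (intro ballI)
  fix y x u :: "complex vec" assume v: "y \<in> carrier_vec n" "x \<in> carrier_vec n" "u \<in> carrier_vec m"
  show "0 \<le> gap X \<xi> y x u"
  proof (cases "y = 0\<^sub>v n \<and> x = 0\<^sub>v n \<and> u = 0\<^sub>v m")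
    case True
    then show ?thesis using assms(1) by (simp add: gap_state)
  next
    case False
    then show ?thesis using assms(2) v unfolding gap_pos_def by (auto intro: less_imp_le)
  qed
qed

lemma gap_pos_pd:
  assumes X: "hermitian n X" and "\<xi> < 1" "gap_pos X \<xi>"
  shows "pd n X"
  unfolding pd_def
proof (intro conjI ballI impI X)
  fix y :: "complex vec" assume y: "y \<in> carrier_vec n" "y \<noteq> 0\<^sub>v n"
  have "0 < gap X \<xi> y (0\<^sub>v n) (0\<^sub>v m)" using assms(3) y unfolding gap_pos_def by auto
  then show "0 < storage X y" unfolding gap_state[OF X y(1)] using assms(2) by (simp add: zero_less_mult_iff)
qed

lemma gap_nonneg_storage:
  assumes X: "hermitian n X" and "\<xi> < 1" "gap_nonneg X \<xi>" and y: "y \<in> carrier_vec n"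
  shows "0 \<le> storage X y"
proof -
  have "0 \<le> gap X \<xi> y (0\<^sub>v n) (0\<^sub>v m)" using assms(3) y unfolding gap_nonneg_def by auto
  then show ?thesis unfolding gap_state[OF X y(1)] using assms(2) by (simp add: zero_le_mult_iff)
qed

lemma gap_nonneg_dissipates:
  assumes X: "hermitian n X" and xi: "0 \<le> \<xi>" "\<xi> < 1" and gap: "gap_nonneg X \<xi>"
  shows "dissipates X"
  unfolding dissipates_def
proof (intro ballI)
  fix x u :: "complex vec" assume x: "x \<in> carrier_vec n" and u: "u \<in> carrier_vec m"
  let ?f = "step x u"
  have f: "?f \<in> carrier_vec n" using x u by simp
  then have "0 \<le> gap X \<xi> (- ?f) x u" using gap x u unfolding gap_nonneg_def by auto
  moreover have "- ?f + ?f = 0\<^sub>v n" using f by (intro eq_vecI) auto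
  ultimately have "\<xi> * (storage X ?f + storage X x + 2 * Re (u \<bullet>c u)) \<le> storage X x + supplied x u - storage X ?f"
    using X f by (simp add: gap_def storage_uminus)
  moreover have "0 \<le> \<xi> * (storage X ?f + storage X x + 2 * Re (u \<bullet>c u))"
    using xi gap_nonneg_storage[OF X xi(2) gap f] gap_nonneg_storage[OF X xi(2) gap x] cprod_self_nonneg[of u]
    by (intro mult_nonneg_nonneg) auto
  ultimately show "storage X ?f \<le> storage X x + supplied x u" by simp
qed

lemma weight_pos:
  assumes X: "pd n X" and v: "y \<in> carrier_vec n" "x \<in> carrier_vec n" "u \<in> carrier_vec m"
    and nz: "\<not> (y = 0\<^sub>v n \<and> x = 0\<^sub>v n \<and> u = 0\<^sub>v m)"
  shows "0 < storage X y + storage X x + 2 * Re (u \<bullet>c u)"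
proof -
  have "0 \<le> storage X y" "0 \<le> storage X x" "0 \<le> Re (u \<bullet>c u)"
    using pd_imp_psd_storage[OF X] v cprod_self_nonneg by auto
  moreover have "0 < storage X y \<or> 0 < storage X x \<or> 0 < Re (u \<bullet>c u)"
    using nz X v cprod_self_pos[OF v(3)] unfolding pd_def by blast
  ultimately show ?thesis by linarith
qed

lemma gap_pos_below:
  assumes X: "pd n X" and gap: "gap_nonneg X \<xi>" and less: "\<xi>' < \<xi>"
  shows "gap_pos X \<xi>'"
  unfolding gap_pos_def
proof (intro ballI impI)
  fix y x u :: "complex vec"
  assume v: "y \<in> carrier_vec n" "x \<in> carrier_vec n" "u \<in> carrier_vec m"
    and nz: "\<not> (y = 0\<^sub>v n \<and> x = 0\<^sub>v n \<and> u = 0\<^sub>v m)"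
  let ?w = "storage X y + storage X x + 2 * Re (u \<bullet>c u)"
  have "0 < (\<xi> - \<xi>') * ?w" using less weight_pos[OF X v nz] by (intro mult_pos_pos) auto
  also have "\<dots> = gap X \<xi>' y x u - gap X \<xi> y x u" by (simp add: gap_def algebra_simps)
  also have "\<dots> \<le> gap X \<xi>' y x u" using gap v unfolding gap_nonneg_def by auto
  finally show "0 < gap X \<xi>' y x u" .
qed

lemma gap_pos_open:
  assumes X: "hermitian n X" and xi: "\<xi> < 1" and gap: "gap_pos X \<xi>"
  shows "\<exists>\<xi>'>\<xi>. \<xi>' < 1 \<and> gap_pos X \<xi>'"
proof -
  let ?M = "Wt_mat n m X (shifted \<xi>)"
  have "pd (n + n + m) ?M" using gap unfolding pd_shift_iff[OF X xi] .
  from pd_perturb[OF this hermitian_carrier[OF diag3_hermitian[OF X]]]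
  obtain j :: nat where j: "\<And>v. v \<in> carrier_vec (n + n + m) \<Longrightarrow> v \<noteq> 0\<^sub>v (n + n + m) \<Longrightarrow>
    storage (diag3 n m X) v / (real j + 2) < storage ?M v" by blast
  \<comment> \<open>\<open>pd_perturb\<close> is applied to the form of the shifted model, which is
    the gap divided by 1 - \<xi>; hence the factor 1 - \<xi> in the increment.\<close>
  define \<xi>' where "\<xi>' = \<xi> + (1 - \<xi>) / (real j + 2)"
  have "(1 - \<xi>) / (real j + 2) < 1 - \<xi>" using xi by (simp add: divide_less_eq)
  then have "\<xi>' < 1" by (simp add: \<xi>'_def)
  moreover have "\<xi> < \<xi>'" using xi by (simp add: \<xi>'_def)
  moreover have "gap_pos X \<xi>'" unfolding gap_pos_def
  proof (intro ballI impI)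
    fix y x u :: "complex vec"
    assume v: "y \<in> carrier_vec n" "x \<in> carrier_vec n" "u \<in> carrier_vec m"
      and nz: "\<not> (y = 0\<^sub>v n \<and> x = 0\<^sub>v n \<and> u = 0\<^sub>v m)"
    let ?w = "storage X y + storage X x + 2 * Re (u \<bullet>c u)"
    have "(y @\<^sub>v x) @\<^sub>v u \<in> carrier_vec (n + n + m)" using v by auto
    from j[OF this] have "?w / (real j + 2) < gap X \<xi> y x u / (1 - \<xi>)"
      using Wt_vec_eq_zero_iff[OF v] nz unfolding diag3_storage[OF X v] shifted_Wt_storage[OF X xi v] by blast
    then have "?w / (real j + 2) * (1 - \<xi>) < gap X \<xi> y x u" using xi by (simp add: pos_less_divide_eq)
    moreover have "gap X \<xi>' y x u = gap X \<xi> y x u - (\<xi>' - \<xi>) * ?w"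
      by (simp add: gap_def algebra_simps)
    moreover have "(\<xi>' - \<xi>) * ?w = ?w / (real j + 2) * (1 - \<xi>)" by (simp add: \<xi>'_def)
    ultimately show "0 < gap X \<xi>' y x u" by simp
  qed
  ultimately show ?thesis by blast
qed

text \<open>One direction is the strict KYP lemma for the shifted model, whose states remain
  reachable after scaling; the other tests with the storage function.\<close>

lemma shifted_strictly_passive_iff:
  assumes n: "0 < n" and ctrb: "controllable n m A B" and xi: "\<xi> < 1"
  shows "is_strictly_passive n m (shifted \<xi>) \<longleftrightarrow> (\<exists>X. hermitian n X \<and> gap_pos X \<xi>)"
proof -
  have "x \<in> reachable n m (complex_of_real (1 / (1 - \<xi>)) \<cdot>\<^sub>m A) (complex_of_real (1 / (1 - \<xi>)) \<cdot>\<^sub>m B) n"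
    if "x \<in> carrier_vec n" for x
    using xi by (intro reachable_scaled controllable_reachable[OF ctrb that]) simp
  note r = this
  have "is_strictly_passive n m (shifted \<xi>)
    \<longleftrightarrow> (\<exists>X. hermitian n X \<and> pd (n + n + m) (Wt_mat n m X (shifted \<xi>)))"
    unfolding shift_model_def prod.case
    using linear_system.strictly_passive_storage[OF shifted_system n r]
      linear_system.pd_Wt_strictly_passive[OF shifted_system] by blast
  then show ?thesis using pd_shift_iff[OF _ xi] by blast
qed

text \<open>The storage of a state enters with the factor 1 - \<xi> only and is bounded uniformly in
  \<open>X\<close>. A state with \<open>C x\<close> nonzero has an input that extracts a fixed
  amount of energy, so 1 - \<xi> cannot be small.\<close>

lemma shift_bounded_away_from_one:
  assumes n: "0 < n" and ctrb: "controllable n m A B" and obs: "observable n m A C"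
  shows "\<exists>\<eta>>0. \<forall>X \<xi>. hermitian n X \<longrightarrow> 0 \<le> \<xi> \<longrightarrow> \<xi> < 1 \<longrightarrow> gap_nonneg X \<xi> \<longrightarrow> \<xi> \<le> 1 - \<eta>"
proof -
  have "\<exists>x\<in>carrier_vec n. C *\<^sub>v x \<noteq> 0\<^sub>v m"
  proof (rule ccontr)
    assume "\<not> ?thesis"
    then have "C *\<^sub>v (A ^\<^sub>m k *\<^sub>v unit_vec n 0) = 0\<^sub>v m" for k
      using mult_mat_vec_carrier[OF pow_carrier_mat[OF A, of k] unit_vec_carrier] by blast
    then have "unit_vec n 0 = (0\<^sub>v n :: complex vec)" by (intro observable_inj[OF obs]) auto
    then show False using n by (auto simp: unit_vec_def dest: arg_cong[where f = "\<lambda>v. v $ 0"])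
  qed
  then obtain x where x: "x \<in> carrier_vec n" "C *\<^sub>v x \<noteq> 0\<^sub>v m" by blast
  obtain c where c: "\<And>X. hermitian n X \<Longrightarrow> dissipates X \<Longrightarrow> storage X x \<le> c"
    using reachable_storage_bound[OF controllable_reachable[OF ctrb x(1)]] by blast
  define q d where "q = Re ((C *\<^sub>v x) \<bullet>c (C *\<^sub>v x))" and "d = Re ((D *\<^sub>v (C *\<^sub>v x)) \<bullet>c (C *\<^sub>v x))"
  have q: "0 < q" unfolding q_def using x by (intro cprod_self_pos) auto
  \<comment> \<open>Small enough that the term through \<open>D\<close> cancels at most half of the
    first-order term; the energy extracted is then at least \<open>e = t * q\<close>.\<close>
  define t where "t = q / (2 * (\<bar>d\<bar> + 1))"
  have t: "0 < t" using q by (simp add: t_def)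
  have "t * d \<le> t * (\<bar>d\<bar> + 1)" using t by (intro mult_left_mono) auto
  also have "\<dots> = q / 2" by (simp add: t_def field_simps)
  finally have td: "t * d \<le> q / 2" .
  define e where "e = t * q"
  have e: "0 < e" using t q by (simp add: e_def)
  show ?thesis
  \<comment> \<open>\<open>max c 1\<close> is a positive denominator whatever the sign of the bound
    \<open>c\<close>.\<close>
  proof (intro exI[of _ "e / max c 1"] conjI allI impI)
    show "0 < e / max c 1" using e by simp
    fix X \<xi> assume X: "hermitian n X" and xi: "0 \<le> \<xi>" "\<xi> < 1" and gap: "gap_nonneg X \<xi>"
    let ?u = "complex_of_real (- t) \<cdot>\<^sub>v (C *\<^sub>v x)"
    have u: "?u \<in> carrier_vec m" using x by simp
    have "0 \<le> gap X \<xi> (0\<^sub>v n) x ?u" using gap x u unfolding gap_nonneg_def by auto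
    then have "0 \<le> (1 - \<xi>) * storage X x + (- 2 * t * q + 2 * t\<^sup>2 * d) - 2 * \<xi> * Re (?u \<bullet>c ?u)"
      unfolding gap_no_shift[OF X x(1) u] supply_output_feedback[OF x(1)] q_def d_def .
    moreover have "0 \<le> 2 * \<xi> * Re (?u \<bullet>c ?u)" 
      by (intro mult_nonneg_nonneg cprod_self_nonneg) (use xi in auto)
    moreover have "- 2 * t * q + 2 * t\<^sup>2 * d \<le> - e"
      using mult_left_mono[OF td, of "2 * t"] t by (simp add: e_def power2_eq_square mult_ac)
    moreover have "(1 - \<xi>) * storage X x \<le> (1 - \<xi>) * max c 1"
      using c[OF X gap_nonneg_dissipates[OF X xi gap]] xi by (intro mult_left_mono) auto
    ultimately have "e \<le> (1 - \<xi>) * max c 1" by linarith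
    then have "e / max c 1 \<le> 1 - \<xi>" by (subst pos_divide_le_eq) simp_all
    then show "\<xi> \<le> 1 - e / max c 1" by simp
  qed
qed

text \<open>Polarization recovers an entry from the storage at four vectors, so bounds on the
  storage bound the matrix.\<close>

lemma hermitian_entry:
  assumes X: "hermitian n X" and ij: "i < n" "j < n"
  shows "2 * Re (X $$ (i, j)) = storage X (unit_vec n i + unit_vec n j) - storage X (unit_vec n i) - storage X (unit_vec n j)"
    and "- 2 * Im (X $$ (i, j)) = storage X (unit_vec n i + \<i> \<cdot>\<^sub>v unit_vec n j) - storage X (unit_vec n i) - storage X (unit_vec n j)"
proof -
  note Xc = hermitian_carrier[OF X]
  have e: "X *\<^sub>v unit_vec n j = col X j" using Xc ij by (intro eq_vecI) auto
  have col: "col X j \<in> carrier_vec n" using Xc by auto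
  have ip: "(X *\<^sub>v unit_vec n j) \<bullet>c unit_vec n i = X $$ (i, j)"
  proof -
    have "conjugate (unit_vec n i) = (unit_vec n i :: complex vec)" by (intro eq_vecI) (auto simp: unit_vec_def)
    then show ?thesis unfolding e using Xc ij col by (simp add: scalar_prod_right_unit)
  qed
  show "2 * Re (X $$ (i, j)) = storage X (unit_vec n i + unit_vec n j) - storage X (unit_vec n i) - storage X (unit_vec n j)"
    by (subst quad_form_add[OF X]) (simp_all add: ip)
  have "(X *\<^sub>v (\<i> \<cdot>\<^sub>v unit_vec n j)) \<bullet>c unit_vec n i = \<i> * X $$ (i, j)"
    using col by (simp add: mult_mat_vec[OF Xc] cprod_smult_left[of _ n] ip[unfolded e] e)
  then show "- 2 * Im (X $$ (i, j)) = storage X (unit_vec n i + \<i> \<cdot>\<^sub>v unit_vec n j) - storage X (unit_vec n i) - storage X (unit_vec n j)"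
    by (subst quad_form_add[OF X]) (simp_all add: quad_form_smult[OF Xc])
qed

text \<open>All the solutions dissipate the same unshifted supply, so their storages lie between 0
  and the energy of fixed paths. Their entries subconverge, and the gap is continuous in the entries
  and in the shift.\<close>

lemma gap_nonneg_limit:
  assumes ctrb: "controllable n m A B"
    and X: "\<And>k. hermitian n (X k)" and xi: "\<And>k. 0 \<le> \<xi> k" "\<And>k. \<xi> k < 1" and gap: "\<And>k. gap_nonneg (X k) (\<xi> k)"
    and lim: "\<xi> \<longlonglongrightarrow> \<Xi>"
  shows "\<exists>Y. hermitian n Y \<and> gap_nonneg Y \<Xi>"
proof -
  note Xc = hermitian_carrier[OF X]
  have nn: "0 \<le> storage (X k) x" if "x \<in> carrier_vec n" for k x
    by (rule gap_nonneg_storage[OF X xi(2) gap that])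
  have bound: "\<exists>c. \<forall>k. storage (X k) x \<le> c" if "x \<in> carrier_vec n" for x
    using reachable_storage_bound[OF controllable_reachable[OF ctrb that]] X gap_nonneg_dissipates[OF X xi gap] by blast
  have "\<exists>r :: nat \<Rightarrow> nat. strict_mono r \<and> (\<forall>a\<in>{..<n} \<times> {..<n}. convergent (\<lambda>k. X (r k) $$ a))"
  proof (rule bounded_coordinates_convergent_subseq)
    fix a assume "a \<in> {..<n} \<times> {..<n}"
    then obtain i j where a: "a = (i, j)" and ij: "i < n" "j < n" by auto
    let ?s = "unit_vec n i + unit_vec n j" and ?t = "unit_vec n i + \<i> \<cdot>\<^sub>v unit_vec n j"
    have c: "?s \<in> carrier_vec n" "?t \<in> carrier_vec n" "unit_vec n i \<in> carrier_vec n" "unit_vec n j \<in> carrier_vec n" by auto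
    obtain c1 c2 c3 c4 where cs: "\<And>k. storage (X k) ?s \<le> c1" "\<And>k. storage (X k) ?t \<le> c2"
      "\<And>k. storage (X k) (unit_vec n i) \<le> c3" "\<And>k. storage (X k) (unit_vec n j) \<le> c4"
      using bound[OF c(1)] bound[OF c(2)] bound[OF c(3)] bound[OF c(4)] by blast
    have "cmod (X k $$ a) \<le> \<bar>c1\<bar> + \<bar>c2\<bar> + 2 * \<bar>c3\<bar> + 2 * \<bar>c4\<bar>" for k
    proof -
      have "\<bar>Re (X k $$ a)\<bar> \<le> \<bar>c1\<bar> + \<bar>c3\<bar> + \<bar>c4\<bar>"
        using hermitian_entry(1)[OF X ij, of k] cs(1,3,4)[of k] nn[OF c(1), of k] nn[OF c(3), of k] nn[OF c(4), of k] unfolding a by linarith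
      moreover have "\<bar>Im (X k $$ a)\<bar> \<le> \<bar>c2\<bar> + \<bar>c3\<bar> + \<bar>c4\<bar>"
        using hermitian_entry(2)[OF X ij, of k] cs(2,3,4)[of k] nn[OF c(2), of k] nn[OF c(3), of k] nn[OF c(4), of k] unfolding a by linarith
      ultimately show ?thesis using cmod_le[of "X k $$ a"] by linarith
    qed
    then show "\<exists>K. \<forall>k. cmod (X k $$ a) \<le> K" by blast
  qed simp
  then obtain r :: "nat \<Rightarrow> nat" where r: "strict_mono r" "\<And>i j. i < n \<Longrightarrow> j < n \<Longrightarrow> convergent (\<lambda>k. X (r k) $$ (i, j))" by auto
  define Y where "Y = mat n n (\<lambda>a. lim (\<lambda>k. X (r k) $$ a))"
  have Yc: "Y \<in> carrier_mat n n" by (simp add: Y_def)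
  have Ylim: "(\<lambda>k. X (r k) $$ (i, j)) \<longlonglongrightarrow> Y $$ (i, j)" if "i < n" "j < n" for i j
    using r(2)[OF that] that by (simp add: Y_def convergent_LIMSEQ_iff)
  have "hermitian n Y"
  proof (rule hermitianI[OF Yc])
    fix i j assume ij: "i < n" "j < n"
    have "(\<lambda>k. cnj (X (r k) $$ (i, j))) \<longlonglongrightarrow> cnj (Y $$ (i, j))" by (intro tendsto_cnj Ylim ij)
    then have "(\<lambda>k. X (r k) $$ (j, i)) \<longlonglongrightarrow> cnj (Y $$ (i, j))"
      using hermitian_index[OF X ij] by simp
    then show "Y $$ (j, i) = cnj (Y $$ (i, j))" using Ylim[OF ij(2,1)] LIMSEQ_unique by blast
  qed
  moreover have st: "(\<lambda>k. storage (X (r k)) x) \<longlonglongrightarrow> storage Y x" if "x \<in> carrier_vec n" for x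
    unfolding quad_form_sum[OF Xc that] quad_form_sum[OF Yc that] by (intro tendsto_intros Ylim) auto
  have "gap_nonneg Y \<Xi>" unfolding gap_nonneg_def
  proof (intro ballI)
    fix y x u :: "complex vec" assume v: "y \<in> carrier_vec n" "x \<in> carrier_vec n" "u \<in> carrier_vec m"
    have "(\<lambda>k. \<xi> (r k)) \<longlonglongrightarrow> \<Xi>" using LIMSEQ_subseq_LIMSEQ[OF lim r(1)] by (simp add: o_def)
    then have "(\<lambda>k. gap (X (r k)) (\<xi> (r k)) y x u) \<longlonglongrightarrow> gap Y \<Xi> y x u"
      unfolding gap_def using v by (intro tendsto_intros st) auto
    then show "0 \<le> gap Y \<Xi> y x u"
      using gap v unfolding gap_nonneg_def by (intro LIMSEQ_le_const) auto
  qed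
  ultimately show ?thesis by blast
qed

text \<open>\<open>GREATEST\<close> is meaningful only if a maximum exists. The admissible \<xi>
  contain 0 by dissipation, are at most 1 by a test with \<open>x\<close> and \<open>u\<close> zero,
  and contain their supremum because the gap is affine in \<xi>.\<close>

lemma xi_star_greatest:
  assumes n: "0 < n" and X: "X \<in> Xpos n m (A, B, C, D)"
  shows "gap_nonneg X (xi_star n m (A, B, C, D) X)" "xi_star n m (A, B, C, D) X \<le> 1"
    "gap_nonneg X \<xi> \<Longrightarrow> \<xi> \<le> xi_star n m (A, B, C, D) X"
proof -
  have hX: "hermitian n X" and pd: "pd n X" and diss: "dissipates X"
    using X unfolding Xpos_def by (auto simp: psd_W_iff)
  define T where "T = {\<xi>. gap_nonneg X \<xi>}"
  have le1: "\<xi> \<le> 1" if "\<xi> \<in> T" for \<xi>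
  proof -
    have nz: "unit_vec n 0 \<noteq> (0\<^sub>v n :: complex vec)"
      using n by (auto simp: unit_vec_def dest: arg_cong[where f = "\<lambda>v. v $ 0"])
    have "0 \<le> gap X \<xi> (unit_vec n 0) (0\<^sub>v n) (0\<^sub>v m)" using that by (auto simp: T_def gap_nonneg_def)
    moreover have "0 < storage X (unit_vec n 0)" using pd nz by (simp add: pd_def)
    ultimately show ?thesis using hX by (simp add: gap_state zero_le_mult_iff)
  qed
  have "0 \<in> T"
  proof -
    have "0 \<le> gap X 0 y x u" if "y \<in> carrier_vec n" "x \<in> carrier_vec n" "u \<in> carrier_vec m" for y x u
      using diss that pd_imp_psd_storage[OF pd, of "y + step x u"] unfolding dissipates_def gap_def
      by fastforce
    then show ?thesis by (simp add: T_def gap_nonneg_def)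
  qed
  have bdd: "bdd_above T" using le1 by (intro bdd_aboveI[of _ 1])
  have "gap_nonneg X (Sup T)" unfolding gap_nonneg_def
  proof (intro ballI)
    fix y x u :: "complex vec" assume v: "y \<in> carrier_vec n" "x \<in> carrier_vec n" "u \<in> carrier_vec m"
    define w where "w = storage X y + storage X x + 2 * Re (u \<bullet>c u)"
    have g: "gap X \<xi> y x u = gap X 0 y x u - \<xi> * w" for \<xi> by (simp add: gap_def w_def)
    have g0: "0 \<le> gap X \<xi> y x u" if "\<xi> \<in> T" for \<xi> using that v by (simp add: T_def gap_nonneg_def)
    \<comment> \<open>Where the weight vanishes the gap does not depend on \<xi>; elsewhere one
      quotient bounds every admissible \<xi> and so their supremum.\<close>
    show "0 \<le> gap X (Sup T) y x u"
    proof (cases "w = 0")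
      case True
      then have "gap X (Sup T) y x u = gap X 0 y x u" using g[of "Sup T"] by simp
      then show ?thesis using g0[OF \<open>0 \<in> T\<close>] by simp
    next
      case False
      have "0 \<le> w" unfolding w_def using pd_imp_psd_storage[OF pd] v cprod_self_nonneg[of u] by (simp add: add_nonneg_nonneg)
      then have w: "0 < w" using False by simp
      have "\<xi> \<le> gap X 0 y x u / w" if "\<xi> \<in> T" for \<xi>
        using g0[OF that] w unfolding g[of \<xi>] by (simp add: pos_le_divide_eq)
      then have "Sup T \<le> gap X 0 y x u / w" using \<open>0 \<in> T\<close> by (intro cSup_least) auto
      then show ?thesis using w unfolding g[of "Sup T"] by (simp add: pos_le_divide_eq)
    qed
  qed
  then have "Sup T \<in> T" by (simp add: T_def)
  moreover have eq: "xi_star n m (A, B, C, D) X = Sup T"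
    unfolding xi_star_def loewner_ge_iff[OF hX]
    using \<open>Sup T \<in> T\<close> bdd by (intro Greatest_equality) (auto simp: T_def intro: cSup_upper)
  ultimately show "gap_nonneg X (xi_star n m (A, B, C, D) X)" "xi_star n m (A, B, C, D) X \<le> 1"
    using le1 by (auto simp: T_def)
  show "\<xi> \<le> xi_star n m (A, B, C, D) X" if "gap_nonneg X \<xi>"
    unfolding eq using that bdd by (intro cSup_upper) (auto simp: T_def)
qed

theorem passivity_radius:
  assumes n: "0 < n" and sp: "is_strictly_passive n m (A, B, C, D)"
    and ctrb: "controllable n m A B" and obs: "observable n m A C"
    and Xi: "Xi = Sup {\<xi>. \<xi> < 1 \<and> is_strictly_passive n m (shifted \<xi>)}" (is "_ = Sup ?S")
  shows "bdd_above {\<xi>. \<xi> < 1 \<and> is_strictly_passive n m (shifted \<xi>)}"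
    and "{\<xi>. \<xi> < 1 \<and> is_strictly_passive n m (shifted \<xi>)} \<noteq> {}"
    and "is_passive n m (shifted Xi)"
    and "{X. hermitian n X \<and> psd (n + n + m) (Wt_mat n m X (shifted Xi))} \<noteq> {}"
    and "{X. hermitian n X \<and> pd (n + n + m) (Wt_mat n m X (shifted Xi))} = {}"
    and "\<And>\<xi>. \<xi> < Xi \<Longrightarrow> {X. hermitian n X \<and> pd (n + n + m) (Wt_mat n m X (shifted \<xi>))} \<noteq> {}"
    and "Xi = (SUP X \<in> Xpos n m (A, B, C, D). xi_star n m (A, B, C, D) X)"
proof -
  define S where "S = ?S"
  have S_iff: "\<xi> \<in> S \<longleftrightarrow> \<xi> < 1 \<and> (\<exists>X. hermitian n X \<and> gap_pos X \<xi>)" for \<xi>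
    unfolding S_def using shifted_strictly_passive_iff[OF n ctrb] by blast
  have bdd: "bdd_above S" by (intro bdd_aboveI[of _ 1]) (auto simp: S_def)
  \<comment> \<open>Shift 0 is the model itself, so strict passivity puts 0 into \<open>S\<close>.
    This gives \<open>0 \<le> Xi\<close>, on which the dissipation of the limit solution
    rests.\<close>
  have "shifted 0 = (A, B, C, D)"
    unfolding shift_model_def by (auto intro!: eq_matI simp: carrier_matD[OF D])
  then have 0: "0 \<in> S" using sp by (simp add: S_def)
  have Xi0: "0 \<le> Xi" unfolding Xi S_def[symmetric] by (rule cSup_upper[OF 0 bdd])
  have upper: "\<xi> \<le> Xi" if "\<xi> \<in> S" for \<xi> unfolding Xi S_def[symmetric] by (rule cSup_upper[OF that bdd])
  obtain \<eta> where eta: "0 < \<eta>" "\<And>X \<xi>. hermitian n X \<Longrightarrow> 0 \<le> \<xi> \<Longrightarrow> \<xi> < 1 \<Longrightarrow> gap_nonneg X \<xi> \<Longrightarrow> \<xi> \<le> 1 - \<eta>"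
    using shift_bounded_away_from_one[OF n ctrb obs] by blast
  \<comment> \<open>The bound away from 1 is stated for nonnegative shifts, hence the maximum with
    0.\<close>
  have S_le: "\<xi> \<le> max 0 (1 - \<eta>)" if "\<xi> \<in> S" for \<xi>
  proof (cases "0 \<le> \<xi>")
    case True
    then show ?thesis using that eta(2) gap_pos_nonneg unfolding S_iff by (metis max.coboundedI2)
  qed auto
  have Xi1: "Xi < 1"
  proof -
    have "Xi \<le> max 0 (1 - \<eta>)" unfolding Xi S_def[symmetric] using S_le 0 by (intro cSup_least) auto
    then show ?thesis using eta(1) by (auto simp: max_def split: if_splits)
  qed
  have below: "\<exists>X. hermitian n X \<and> gap_pos X \<xi>" if lt: "\<xi> < Xi" for \<xi>
  proof -
    obtain \<xi>' where "\<xi>' \<in> S" "\<xi> < \<xi>'" using lt less_cSup_iff[of S \<xi>] 0 bdd unfolding Xi S_def[symmetric] by blast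
    then obtain X where "hermitian n X" "gap_pos X \<xi>'" "\<xi>' < 1" unfolding S_iff by blast
    then show ?thesis using gap_pos_below[OF gap_pos_pd gap_pos_nonneg \<open>\<xi> < \<xi>'\<close>] by blast
  qed
  have "\<exists>Y. hermitian n Y \<and> gap_nonneg Y Xi"
  proof -
    have "\<exists>\<xi> X. \<xi> \<le> Xi \<and> Xi - 1 / real (Suc k) \<le> \<xi> \<and> 0 \<le> \<xi> \<and> hermitian n X \<and> gap_nonneg X \<xi>" for k
    proof -
      obtain \<xi> where x: "\<xi> \<in> S" "Xi - 1 / real (Suc k) \<le> \<xi>"
      proof -
        have "Xi - 1 / real (Suc k) < Sup S" unfolding Xi S_def by simp
        then show ?thesis using that less_cSup_iff[of S "Xi - 1 / real (Suc k)"] 0 bdd by (auto intro: less_imp_le)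
      qed
      \<comment> \<open>The limit argument takes nonnegative shifts; a negative one is replaced by
        0, which is also in \<open>S\<close> and no farther from \<open>Xi\<close>.\<close>
      then have "max 0 \<xi> \<in> S" using 0 by (simp add: max_def)
      moreover from this obtain X where "hermitian n X" "gap_pos X (max 0 \<xi>)" unfolding S_iff by blast
      ultimately show ?thesis using upper x Xi0 gap_pos_nonneg by (intro exI[of _ "max 0 \<xi>"] exI[of _ X]) auto
    qed
    then obtain \<xi> X where s: "\<And>k. \<xi> k \<le> Xi" "\<And>k. Xi - 1 / real (Suc k) \<le> \<xi> k" "\<And>k. 0 \<le> \<xi> k"
      "\<And>k. hermitian n (X k)" "\<And>k. gap_nonneg (X k) (\<xi> k)" by metis
    have "\<xi> \<longlonglongrightarrow> Xi"
    proof (rule tendsto_sandwich[of "\<lambda>k. Xi - 1 / real (Suc k)" \<xi> sequentially "\<lambda>_. Xi"])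
      have "(\<lambda>k. Xi - 1 / real (Suc k)) \<longlonglongrightarrow> Xi - 0"
        by (intro tendsto_diff tendsto_const LIMSEQ_Suc[OF lim_1_over_n])
      then show "(\<lambda>k. Xi - 1 / real (Suc k)) \<longlonglongrightarrow> Xi" by simp
    qed (use s in \<open>auto intro: always_eventually\<close>)
    then show ?thesis using s Xi1 by (intro gap_nonneg_limit[OF ctrb, of X \<xi>]) (auto intro: le_less_trans)
  qed
  then obtain Y where Y: "hermitian n Y" "gap_nonneg Y Xi" by blast
  have diss: "dissipates Y" by (rule gap_nonneg_dissipates[OF Y(1) Xi0 Xi1 Y(2)])
  have pdY: "pd n Y"
    by (rule observable_storage_pd[OF obs Y(1) gap_nonneg_storage[OF Y(1) Xi1 Y(2)] diss])
  have psdY: "psd (n + n + m) (Wt_mat n m Y (shifted Xi))"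
    using Y(2) unfolding psd_shift_iff[OF Y(1) Xi1] .
  show "bdd_above ?S"
    "?S \<noteq> {}"
    using bdd 0 unfolding S_def by blast+
  show "is_passive n m (shifted Xi)"
    using psdY unfolding shift_model_def prod.case
    by (intro linear_system.dissipation_passive[OF shifted_system pdY]
      linear_system.psd_Wt_dissipates[OF shifted_system Y(1)])
  show "{X. hermitian n X \<and> psd (n + n + m) (Wt_mat n m X (shifted Xi))} \<noteq> {}"
    using Y(1) psdY by blast
  show "{X. hermitian n X \<and> pd (n + n + m) (Wt_mat n m X (shifted Xi))} = {}"
  proof (rule ccontr)
    assume "\<not> ?thesis"
    then obtain X where "hermitian n X" "gap_pos X Xi" using pd_shift_iff[OF _ Xi1] by blast
    then obtain \<xi> where "Xi < \<xi>" "\<xi> \<in> S" using gap_pos_open[OF _ Xi1] unfolding S_iff by blast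
    then show False using upper by fastforce
  qed
  show "{X. hermitian n X \<and> pd (n + n + m) (Wt_mat n m X (shifted \<xi>))} \<noteq> {}" if "\<xi> < Xi" for \<xi>
  proof -
    have "\<xi> < 1" using that Xi1 by simp
    then show ?thesis using below[OF that] pd_shift_iff[of _ \<xi>] by blast
  qed
  \<comment> \<open>A shift strictly between \<open>Xi\<close> and \<open>xi_star\<close> would be
    strictly feasible with the same \<open>X\<close>, hence a member of \<open>S\<close> above its
    supremum.\<close>
  have le: "xi_star n m (A, B, C, D) X \<le> Xi" if X: "X \<in> Xpos n m (A, B, C, D)" for X
  proof (rule ccontr)
    assume "\<not> ?thesis"
    then obtain \<xi> where xi: "Xi < \<xi>" "\<xi> < xi_star n m (A, B, C, D) X" using dense not_le by metis
    have "gap_pos X \<xi>"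
      using X xi(2) by (intro gap_pos_below[OF _ xi_star_greatest(1)[OF n X]]) (auto simp: Xpos_def)
    then have "\<xi> \<in> S" using xi(2) xi_star_greatest(2)[OF n X] X by (auto simp: S_iff Xpos_def)
    then show False using upper xi(1) by fastforce
  qed
  \<comment> \<open>The limit solution belongs to \<open>Xpos\<close> and attains the value
    \<open>Xi\<close>, so the supremum over \<open>Xpos\<close> is a maximum.\<close>
  have YX: "Y \<in> Xpos n m (A, B, C, D)"
    using Y(1) pdY diss by (simp add: Xpos_def psd_W_iff)
  have "xi_star n m (A, B, C, D) Y = Xi"
    using le[OF YX] xi_star_greatest(3)[OF n YX Y(2)] by simp
  then have "(SUP X \<in> Xpos n m (A, B, C, D). xi_star n m (A, B, C, D) X) = Xi"
    using le YX by (intro cSup_eq_maximum) auto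
  then show "Xi = (SUP X \<in> Xpos n m (A, B, C, D). xi_star n m (A, B, C, D) X)" by simp
qed

end

theorem theorem5p4:
  fixes n m :: nat and M :: model and Xi :: real
  assumes "0 < n" and "0 < m"
    and "model_dims n m M"
    and "is_strictly_passive n m M"
    and "minimal n m M"
    and "Xi = Sup {\<xi>. \<xi> < 1 \<and> is_strictly_passive n m (shift_model m M \<xi>)}"
  shows "bdd_above {\<xi>. \<xi> < 1 \<and> is_strictly_passive n m (shift_model m M \<xi>)}
       \<and> {\<xi>. \<xi> < 1 \<and> is_strictly_passive n m (shift_model m M \<xi>)} \<noteq> {}
       \<and> is_passive n m (shift_model m M Xi)
       \<and> {X. hermitian n X \<and> psd (n + n + m) (Wt_mat n m X (shift_model m M Xi))} \<noteq> {}
       \<and> {X. hermitian n X \<and> pd (n + n + m) (Wt_mat n m X (shift_model m M Xi))} = {}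
       \<and> (\<forall>\<xi> < Xi. {X. hermitian n X \<and> pd (n + n + m) (Wt_mat n m X (shift_model m M \<xi>))} \<noteq> {})
       \<and> Xi = (SUP X \<in> Xpos n m M. xi_star n m M X)"
proof -
  obtain A B C D where M: "M = (A, B, C, D)" by (cases M)
  interpret linear_system n m A B C D
    using assms(3) by unfold_locales (auto simp: M model_dims_def)
  have ctrb: "controllable n m A B" and obs: "observable n m A C" using assms(5) by (auto simp: M minimal_def)
  note main = passivity_radius[OF assms(1) assms(4)[unfolded M] ctrb obs assms(6)[unfolded M]]
  show ?thesis unfolding M by (intro conjI allI impI main)
qed

end
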